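(* Let $s>r>0$ and $B>0$ be given. For a sequence $\rho_n>0$ let $\mathcal{P}_n=\Sigma(s)\cup\tilde\Sigma(r,\rho_n)$, and let $r_n(t)=(\log n/n)^{t/(2t+1)}$. (i) Assume $r>1/2$ and let $0<\alpha<1/2$. Suppose $C_n$ is a confidence band that is asymptotically honest with level $\alpha$ over $\mathcal{P}_n$ and adaptive over $\mathcal{P}_n$. Then necessarily $$\liminf_{n}\frac{\rho_n}{r_n(r)}>0.$$ (ii) Let $0<\alpha<1$. There exist a sequence $\rho_n$ satisfying $$\limsup_n \frac{\rho_n}{r_n(r)}<\infty$$ and a confidence band $C_n$ that is asymptotically honest with level $\alpha$ over $\mathcal{P}_n$ and adaptive over $\mathcal{P}_n$.
   Context: Model: one observes $Y_i=f(i/n)+\varepsilon_i$, $1\le i\le n$, with $\varepsilon_i$ i.i.d. $\mathcal{N}(0,\sigma^2)$, $\sigma^2>0$ known and fixed. $P_f,E_f$ denote probability and expectation when the regression function is $f$. Wavelets: $\{\phi_m,\psi_{jm}\}$ is the orthonormal basis of $L^2([0,1])$ given by Daubechies wavelets on the unit interval (boundary-corrected, Cohen–Daubechies–Vial), of regularity sufficient for the wavelet characterisation of the Hölder spaces $\mathcal{C}^t([0,1])$ for all $t$ considered; $\phi_m=\phi(\cdot-m)$, $\psi_{jm}=2^{j/2}\psi(2^j\cdot-m)$ (with the usual modification near the boundary), $\langle\cdot,\cdot\rangle$ is the inner product of $L^2([0,1])$. For $t>0$, $$\Vert f\Vert_{t,\infty}=\max\Big(\sup_m|\langle\phi_m,f\rangle|,\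 \sup_{j,m}2^{j(t+1/2)}|\langle\psi_{jm},f\rangle|\Big),$$ and $\Sigma(t)$ is the set of continuous $f:[0,1]\to\mathbb{R}$ with $\Vert f\Vert_{t,\infty}\le B$. With $d(f,\Sigma)=\inf_{g\in\Sigma}\Vert f-g\Vert_\infty$ (sup-norm on $[0,1]$) and $\rho_n>0$, put $\tilde\Sigma(r,\rho_n)=\{f\in\Sigma(r): d(f,\Sigma(s))\ge\rho_n\}$. A confidence band is a family of random intervals $C_n=C(Y_1,\dots,Y_n)=\{[c_n(y),c_n'(y)]\}_{y\in[0,1]}$ depending on the data; "$f\in C_n$" means $f(y)\in[c_n(y),c_n'(y)]$ for all $y\in[0,1]$; its diameter is $|C_n|=\sup_{y\in[0,1]}|c_n'(y)-c_n(y)|$. Honesty: $C_n$ is asymptotically honest with level $0<\alpha<1$ for $\mathcal{P}_n$ if $\liminf_n\inf_{f\in\mathcal{P}_n}P_f(f\in C_n)\ge 1-\alpha$. Adaptivity: $C_n$ is adaptive over $\mathcal{P}_n$ if there is a constant $L$ such that for every $n\in\mathbb{N}$, $\sup_{f\in\Sigma(s)}E_f|C_n|\le L r_n(s)$ and $\sup_{f\in\tilde\Sigma(r,\rho_n)}E_f|C_n|\le L r_n(r)$. *)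

theory Defs
  imports "HOL-Probability.Probability"
begin

section \<open>Daubechies wavelets on the unit interval\<close>

text \<open>
  Functions on [0,1] are represented by functions on the whole line whose values outside [0,1]
  are never inspected.
\<close>

definition L2_inner :: "(real \<Rightarrow> real) \<Rightarrow> (real \<Rightarrow> real) \<Rightarrow> real" where
  "L2_inner g f = (LBINT x:{0..1}. g x * f x)"

definition in_L2 :: "(real \<Rightarrow> real) \<Rightarrow> bool" where
  "in_L2 f \<longleftrightarrow> set_borel_measurable lborel {0..1} f \<and> set_integrable lborel {0..1} (\<lambda>x. (f x)\<^sup>2)"

definition L2_orthonormal_basis :: "'i set \<Rightarrow> ('i \<Rightarrow> real \<Rightarrow> real) \<Rightarrow> bool" where
  "L2_orthonormal_basis I e \<longleftrightarrow>
     (\<forall>i\<in>I. in_L2 (e i)) \<and>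
     (\<forall>i\<in>I. \<forall>k\<in>I. L2_inner (e i) (e k) = (if i = k then 1 else 0)) \<and>
     (\<forall>f. in_L2 f \<longrightarrow> (\<forall>\<epsilon>>0. \<exists>F c. finite F \<and> F \<subseteq> I \<and>
        (LBINT x:{0..1}. (f x - (\<Sum>i\<in>F. c i * e i x))\<^sup>2) < \<epsilon>))"

definition C_k_on_line :: "nat \<Rightarrow> (real \<Rightarrow> real) \<Rightarrow> bool" where
  "C_k_on_line k f \<longleftrightarrow>
     (\<forall>i<k. \<forall>x. (deriv ^^ i) f differentiable (at x)) \<and> continuous_on UNIV ((deriv ^^ k) f)"

text \<open>
  The orthonormal filters of length 2N with N vanishing moments. These are exactly the
  Daubechies filters of order N (all choices of the spectral factor), positioned so that the
  scaling function and the wavelet are both supported in [1 - N, N].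
\<close>

definition daubechies_filter :: "nat \<Rightarrow> (int \<Rightarrow> real) \<Rightarrow> bool" where
  "daubechies_filter N h \<longleftrightarrow> N \<ge> 1 \<and>
     (\<forall>k. k \<notin> {1 - int N..int N} \<longrightarrow> h k = 0) \<and>
     (\<Sum>k=1 - int N..int N. h k) = sqrt 2 \<and>
     (\<forall>l. (\<Sum>k=1 - int N..int N. h k * h (k + 2 * l)) = (if l = 0 then 1 else 0)) \<and>
     (\<forall>p<N. (\<Sum>k=1 - int N..int N. (- 1) powi k * of_int k ^ p * h k) = 0)"

definition daubechies_wavelet ::
  "nat \<Rightarrow> (real \<Rightarrow> real) \<Rightarrow> (real \<Rightarrow> real) \<Rightarrow> bool" where
  "daubechies_wavelet N \<phi> \<psi> \<longleftrightarrow> (\<exists>h. daubechies_filter N h \<and>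
     \<phi> \<in> borel_measurable borel \<and>
     (\<forall>x. x \<notin> {1 - real N..real N} \<longrightarrow> \<phi> x = 0) \<and>
     (LBINT x. \<phi> x) = 1 \<and>
     (\<forall>x. \<phi> x = sqrt 2 * (\<Sum>k=1 - int N..int N. h k * \<phi> (2 * x - of_int k))) \<and>
     (\<forall>x. \<psi> x =
        sqrt 2 * (\<Sum>k=1 - int N..int N. (- 1) powi k * h (1 - k) * \<phi> (2 * x - of_int k))))"

text \<open>
  The Cohen--Daubechies--Vial edge functions. On the half line [0,\<infinity>) one keeps the translates
  of \<open>\<phi>\<close> and \<open>\<psi>\<close> by m \<open>\<ge>\<close> N and adds N edge scaling functions, obtained by orthonormalising the
  truncated polynomial combinations below, and N edge wavelets, which complete the
  orthogonal complement of the scaling space in the next finer one; these lie in the span of the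
  finer edge scaling functions and the finer translates m = N, ..., 3N - 2. The right edge is the
  mirror image, with \<open>\<phi>\<close> replaced by \<open>\<phi>(1 - x)\<close>, on (-\<infinity>,0]. The choice of orthonormal
  bases of the edge spaces is left free; orthonormality itself is imposed on the whole system
  in \<open>CDV_wavelet_basis\<close>.
\<close>

definition left_edge_scaling :: "nat \<Rightarrow> (real \<Rightarrow> real) \<Rightarrow> (nat \<Rightarrow> real \<Rightarrow> real) \<Rightarrow> bool" where
  "left_edge_scaling N \<phi> \<phi>L \<longleftrightarrow> (\<exists>a. \<forall>k<N. \<forall>x\<ge>0. \<phi>L k x =
     (\<Sum>l<N. a k l * (\<Sum>n<2 * N - 1. real (n choose l) * \<phi> (x + real n - real N + 1))))"

definition left_edge_wavelet ::
  "nat \<Rightarrow> (real \<Rightarrow> real) \<Rightarrow> (nat \<Rightarrow> real \<Rightarrow> real) \<Rightarrow> (nat \<Rightarrow> real \<Rightarrow> real) \<Rightarrow> bool" where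
  "left_edge_wavelet N \<phi> \<phi>L \<psi>L \<longleftrightarrow> (\<exists>b c. \<forall>k<N. \<forall>x\<ge>0. \<psi>L k x =
     (\<Sum>l<N. b k l * \<phi>L l (2 * x)) + (\<Sum>m\<in>{N..<3 * N - 1}. c k m * \<phi> (2 * x - real m)))"

definition CDV_edges ::
  "nat \<Rightarrow> (real \<Rightarrow> real) \<Rightarrow> (nat \<Rightarrow> real \<Rightarrow> real) \<Rightarrow> (nat \<Rightarrow> real \<Rightarrow> real) \<Rightarrow>
   (nat \<Rightarrow> real \<Rightarrow> real) \<Rightarrow> (nat \<Rightarrow> real \<Rightarrow> real) \<Rightarrow> bool" where
  "CDV_edges N \<phi> \<phi>L \<phi>R \<psi>L \<psi>R \<longleftrightarrow>
     left_edge_scaling N \<phi> \<phi>L \<and> left_edge_wavelet N \<phi> \<phi>L \<psi>L \<and>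
     left_edge_scaling N (\<lambda>x. \<phi> (1 - x)) (\<lambda>k x. \<phi>R k (- x)) \<and>
     left_edge_wavelet N (\<lambda>x. \<phi> (1 - x)) (\<lambda>k x. \<phi>R k (- x)) (\<lambda>k x. \<psi>R k (- x))"

text \<open>
  The \<open>2 ^ j\<close> functions at level j (for \<open>2 ^ j \<ge> 2 * N\<close>): N left edge functions, the dilated
  interior translates, N right edge functions.
\<close>

definition level_function ::
  "nat \<Rightarrow> (real \<Rightarrow> real) \<Rightarrow> (nat \<Rightarrow> real \<Rightarrow> real) \<Rightarrow> (nat \<Rightarrow> real \<Rightarrow> real) \<Rightarrow> nat \<Rightarrow> nat \<Rightarrow> real \<Rightarrow> real"
where
  "level_function N f fL fR j m x = 2 powr (real j / 2) *
     (if m < N then fL m (2 ^ j * x)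
      else if m < 2 ^ j - N then f (2 ^ j * x - real m)
      else fR (2 ^ j - 1 - m) (2 ^ j * (x - 1)))"

text \<open>
  Since the interior functions have support length 2N - 1, the scaling functions are taken at a
  coarsest level J with \<open>2 ^ J \<ge> 2 * N\<close>, and the wavelet levels are \<open>j \<ge> J\<close>. S is the order of
  smoothness of \<open>\<phi>\<close>, hence of all the functions on [0,1]; N is the number of vanishing moments.
  A Daubechies wavelet of class \<open>C^S\<close> always has more than S vanishing moments, so the
  condition \<open>S < N\<close> only makes this explicit. The basis characterises the Hoelder spaces of all
  orders t < S.
\<close>

definition CDV_wavelet_basis ::
  "nat \<Rightarrow> nat \<Rightarrow> (nat \<Rightarrow> real \<Rightarrow> real) \<Rightarrow> (nat \<Rightarrow> nat \<Rightarrow> real \<Rightarrow> real) \<Rightarrow> bool" where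
  "CDV_wavelet_basis S J phi psi \<longleftrightarrow> (\<exists>N \<phi> \<psi> \<phi>L \<phi>R \<psi>L \<psi>R.
     daubechies_wavelet N \<phi> \<psi> \<and> C_k_on_line S \<phi> \<and> S < N \<and>
     CDV_edges N \<phi> \<phi>L \<phi>R \<psi>L \<psi>R \<and> 2 * N \<le> 2 ^ J \<and>
     (\<forall>m<2 ^ J. \<forall>x\<in>{0..1}. phi m x = level_function N \<phi> \<phi>L \<phi>R J m x) \<and>
     (\<forall>j\<ge>J. \<forall>m<2 ^ j. \<forall>x\<in>{0..1}. psi j m x = level_function N \<psi> \<psi>L \<psi>R j m x) \<and>
     L2_orthonormal_basis ({..<2 ^ J} <+> (SIGMA j:{J..}. {..<2 ^ j}))
       (case_sum phi (\<lambda>(j, m). psi j m)))"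

section \<open>Hoelder balls and separation\<close>

definition wavelet_norm ::
  "nat \<Rightarrow> (nat \<Rightarrow> real \<Rightarrow> real) \<Rightarrow> (nat \<Rightarrow> nat \<Rightarrow> real \<Rightarrow> real) \<Rightarrow> real \<Rightarrow> (real \<Rightarrow> real) \<Rightarrow> ennreal"
where
  "wavelet_norm J phi psi t f = max
     (SUP m\<in>{..<2 ^ J}. ennreal \<bar>L2_inner (phi m) f\<bar>)
     (SUP (j, m)\<in>(SIGMA j:{J..}. {..<2 ^ j}).
        ennreal (2 powr (real j * (t + 1/2)) * \<bar>L2_inner (psi j m) f\<bar>))"

definition holder_ball ::
  "nat \<Rightarrow> (nat \<Rightarrow> real \<Rightarrow> real) \<Rightarrow> (nat \<Rightarrow> nat \<Rightarrow> real \<Rightarrow> real) \<Rightarrow> real \<Rightarrow> real \<Rightarrow> (real \<Rightarrow> real) set"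
where
  "holder_ball J phi psi B t =
     {f. continuous_on {0..1} f \<and> wavelet_norm J phi psi t f \<le> ennreal B}"

definition sup_norm :: "(real \<Rightarrow> real) \<Rightarrow> ennreal" where
  "sup_norm f = (SUP x\<in>{0..1}. ennreal \<bar>f x\<bar>)"

definition sup_dist :: "(real \<Rightarrow> real) \<Rightarrow> (real \<Rightarrow> real) set \<Rightarrow> ennreal" where
  "sup_dist f A = (INF g\<in>A. sup_norm (\<lambda>x. f x - g x))"

definition separated :: "(real \<Rightarrow> real) set \<Rightarrow> (real \<Rightarrow> real) set \<Rightarrow> real \<Rightarrow> (real \<Rightarrow> real) set" where
  "separated A A' \<rho> = {f \<in> A. ennreal \<rho> \<le> sup_dist f A'}"

definition rate :: "nat \<Rightarrow> real \<Rightarrow> real" where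
  "rate n t = (ln (real n) / real n) powr (t / (2 * t + 1))"

section \<open>Fixed design regression and confidence bands\<close>

abbreviation sample_space :: "nat \<Rightarrow> (nat \<Rightarrow> real) measure" where
  "sample_space n \<equiv> PiM {1..n} (\<lambda>_. borel)"

definition noise :: "real \<Rightarrow> nat \<Rightarrow> (nat \<Rightarrow> real) measure" where
  "noise \<sigma> n = PiM {1..n} (\<lambda>_. density lborel (\<lambda>x. ennreal (normal_density 0 \<sigma> x)))"

definition data_law :: "real \<Rightarrow> nat \<Rightarrow> (real \<Rightarrow> real) \<Rightarrow> (nat \<Rightarrow> real) measure" where
  "data_law \<sigma> n f = distr (noise \<sigma> n) (sample_space n)
     (\<lambda>\<epsilon>. \<lambda>i\<in>{1..n}. f (real i / real n) + \<epsilon> i)"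

text \<open>
  A band is given by its lower and upper end points as functions of the sample size, the
  data and the point of [0,1]. Sample sizes are \<open>n \<ge> 1\<close>.
\<close>

type_synonym endpoint = "nat \<Rightarrow> (nat \<Rightarrow> real) \<Rightarrow> real \<Rightarrow> real"

definition confidence_band :: "endpoint \<Rightarrow> endpoint \<Rightarrow> bool" where
  "confidence_band lo hi \<longleftrightarrow> (\<forall>n\<ge>1. \<forall>y\<in>{0..1}.
     (\<lambda>Y. lo n Y y) \<in> borel_measurable (sample_space n) \<and>
     (\<lambda>Y. hi n Y y) \<in> borel_measurable (sample_space n) \<and>
     (\<forall>Y\<in>space (sample_space n). lo n Y y \<le> hi n Y y))"

definition covering :: "endpoint \<Rightarrow> endpoint \<Rightarrow> nat \<Rightarrow> (real \<Rightarrow> real) \<Rightarrow> (nat \<Rightarrow> real) set" where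
  "covering lo hi n f =
     {Y \<in> space (sample_space n). \<forall>y\<in>{0..1}. f y \<in> {lo n Y y..hi n Y y}}"

definition diameter :: "endpoint \<Rightarrow> endpoint \<Rightarrow> nat \<Rightarrow> (nat \<Rightarrow> real) \<Rightarrow> ennreal" where
  "diameter lo hi n Y = (SUP y\<in>{0..1}. ennreal \<bar>hi n Y y - lo n Y y\<bar>)"

text \<open>
  Covering and diameter involve uncountably many points y, so their measurability does not follow
  from that of the end points. It is part of the two notions below, which speak of the
  probability of the former and the expectation of the latter.
\<close>

definition asymptotically_honest ::
  "real \<Rightarrow> endpoint \<Rightarrow> endpoint \<Rightarrow> real \<Rightarrow> (nat \<Rightarrow> (real \<Rightarrow> real) set) \<Rightarrow> bool" where
  "asymptotically_honest \<sigma> lo hi \<alpha> P \<longleftrightarrow>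
     (\<forall>n\<ge>1. \<forall>f\<in>P n. covering lo hi n f \<in> sets (sample_space n)) \<and>
     liminf (\<lambda>n. INF f\<in>P n. ereal (measure (data_law \<sigma> n f) (covering lo hi n f))) \<ge> ereal (1 - \<alpha>)"

definition adaptive ::
  "real \<Rightarrow> endpoint \<Rightarrow> endpoint \<Rightarrow> real \<Rightarrow> real \<Rightarrow>
   (real \<Rightarrow> real) set \<Rightarrow> (nat \<Rightarrow> (real \<Rightarrow> real) set) \<Rightarrow> bool" where
  "adaptive \<sigma> lo hi r s \<Sigma>s \<Sigma>r \<longleftrightarrow>
     (\<forall>n\<ge>1. diameter lo hi n \<in> borel_measurable (sample_space n)) \<and>
     (\<exists>L::real. \<forall>n\<ge>1.
        (SUP f\<in>\<Sigma>s. \<integral>\<^sup>+ Y. diameter lo hi n Y \<partial>data_law \<sigma> n f) \<le> ennreal (L * rate n s) \<and>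
        (SUP f\<in>\<Sigma>r n. \<integral>\<^sup>+ Y. diameter lo hi n Y \<partial>data_law \<sigma> n f) \<le> ennreal (L * rate n r))"

end

theory Submission
  imports Defs "HOL-Real_Asymp.Real_Asymp"
begin

text \<open>
  Both halves live at the resolution 2^j of order (n / log n)^(1/(2r+1)), at which the stochastic
  error sqrt (2^j log n / n) of an estimated wavelet series and the approximation error 2^(-jr) of a
  function in \<Sigma>(r) are both of order r_n(r).

  Necessity. If \<rho>_n / r_n(r) were not bounded away from 0, then for infinitely many n the separated
  class would contain all wavelets of level j, scaled to a height of order r_n(r): the wavelet
  coefficient of such a bump exceeds what \<Sigma>(s) permits, and pairing with the wavelet turns this
  excess into a distance of order r_n(r) to \<Sigma>(s) (\<open>bump_separation\<close>). Adaptivity makes the band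
  shorter than the height of a bump when the true function is 0, so the event that the band covers 0
  and is short excludes that it covers a bump. By honesty this event has probability at least
  1 - \<alpha> - o(1) under 0 and at most \<alpha> + o(1) under every bump. But polynomially many bumps have
  disjoint supports, while the energy of each at the design points is only a small multiple of log n;
  the uniform mixture of their laws is therefore asymptotically indistinguishable from the law of pure
  noise (\<open>mixture_indistinguishable\<close>). Hence 1 - \<alpha> \<le> \<alpha>, against \<alpha> < 1/2. The argument is
  assembled in \<open>separation_rate_necessary\<close>.

  Sufficiency. Empirical wavelet coefficients estimate the true ones up to the noise level
  sqrt (log n / n) and a discretisation bias, simultaneously at all levels below the resolution and
  outside an event of probability at most 8/n (\<open>coefficient_estimation\<close>). On the good event the
  truncated empirical series estimates every f in \<Sigma>(t) at rate r_n(t) in the supremum norm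
  (\<open>estimator_error\<close>). A test accepts smoothness s if no empirical coefficient exceeds the bound
  that \<Sigma>(s) imposes by more than the error allowance. On the good event it accepts every f in \<Sigma>(s);
  and if it accepts some f in \<Sigma>(r), clipping the coefficients of f produces an element of \<Sigma>(s) within
  a multiple of r_n(r) (\<open>near_smooth_if_accepts\<close>), so that a sufficiently separated f is rejected.
  The band centred at the estimator for the smoothness that the test selects, with a width that is a
  multiple of the corresponding rate, has the required properties (\<open>adaptive_band_exists\<close>).

  The wavelets enter only through orthonormality, completeness and the localisation estimates of the
  locale \<open>regular_basis\<close>, which \<open>CDV_regular_basis\<close> derives from the construction of the basis.
\<close>

section \<open>The Gaussian regression experiment\<close>

definition gauss :: "real \<Rightarrow> real \<Rightarrow> real measure" where
  "gauss \<sigma> \<mu> = density lborel (\<lambda>x. ennreal (normal_density \<mu> \<sigma> x))"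

lemma sets_gauss [simp, measurable_cong]: "sets (gauss \<sigma> \<mu>) = sets borel"
  and space_gauss [simp]: "space (gauss \<sigma> \<mu>) = UNIV"
  by (simp_all add: gauss_def)

lemma prob_space_gauss: "0 < \<sigma> \<Longrightarrow> prob_space (gauss \<sigma> \<mu>)"
  unfolding gauss_def by (rule prob_space_normal_density)

lemma gauss_density:
  assumes "0 < \<sigma>"
  shows "gauss \<sigma> \<mu> = density (gauss \<sigma> 0) (\<lambda>x. ennreal (exp (\<mu> * x / \<sigma>\<^sup>2 - \<mu>\<^sup>2 / (2 * \<sigma>\<^sup>2))))"
proof -
  have "normal_density \<mu> \<sigma> x =
      normal_density 0 \<sigma> x * exp (\<mu> * x / \<sigma>\<^sup>2 - \<mu>\<^sup>2 / (2 * \<sigma>\<^sup>2))" for x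
  proof -
    have "- (x - \<mu>)\<^sup>2 / (2 * \<sigma>\<^sup>2) = - x\<^sup>2 / (2 * \<sigma>\<^sup>2) + (\<mu> * x / \<sigma>\<^sup>2 - \<mu>\<^sup>2 / (2 * \<sigma>\<^sup>2))"
      using assms by (simp add: field_simps power2_eq_square)
    then show ?thesis by (simp add: normal_density_def exp_add [symmetric])
  qed
  then show ?thesis
    by (simp add: gauss_def density_density_eq ennreal_mult')
qed

lemma gauss_translate:
  assumes "0 < \<sigma>"
  shows "distr (gauss \<sigma> 0) borel (\<lambda>x. \<mu> + x) = gauss \<sigma> \<mu>"
proof -
  interpret prob_space "gauss \<sigma> 0" by (rule prob_space_gauss [OF assms])
  have "distributed (gauss \<sigma> 0) lborel (\<lambda>x. x) (normal_density 0 \<sigma>)"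
    unfolding distributed_def gauss_def by (auto simp: distr_id2)
  from normal_density_affine [OF this assms, of 1 \<mu>] have
    "distributed (gauss \<sigma> 0) lborel (\<lambda>x. \<mu> + x) (normal_density \<mu> \<sigma>)" by simp
  then have "distr (gauss \<sigma> 0) lborel (\<lambda>x. \<mu> + x) = gauss \<sigma> \<mu>"
    by (simp add: distributed_def gauss_def)
  moreover have "distr (gauss \<sigma> 0) lborel (\<lambda>x. \<mu> + x) = distr (gauss \<sigma> 0) borel (\<lambda>x. \<mu> + x)"
    by (rule distr_cong) auto
  ultimately show ?thesis by simp
qed

text \<open>
  Exponential tilting only translates a Gaussian law; the total mass of the translate is 1.
\<close>

lemma gauss_exp_moment:
  assumes "0 < \<sigma>"
  shows "(\<integral>\<^sup>+ x. ennreal (exp (a * x)) \<partial>gauss \<sigma> 0) = ennreal (exp (\<sigma>\<^sup>2 * a\<^sup>2 / 2))"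
proof -
  interpret prob_space "gauss \<sigma> (\<sigma>\<^sup>2 * a)" by (rule prob_space_gauss [OF assms])
  have "1 = emeasure (gauss \<sigma> (\<sigma>\<^sup>2 * a)) UNIV"
    using emeasure_space_1 by simp
  also have "\<dots> = (\<integral>\<^sup>+ x. ennreal (exp (\<sigma>\<^sup>2 * a * x / \<sigma>\<^sup>2 - (\<sigma>\<^sup>2 * a)\<^sup>2 / (2 * \<sigma>\<^sup>2))) \<partial>gauss \<sigma> 0)"
    by (subst gauss_density [OF assms]) (simp add: emeasure_density)
  also have "\<dots> = (\<integral>\<^sup>+ x. ennreal (exp (- (\<sigma>\<^sup>2 * a\<^sup>2 / 2))) * ennreal (exp (a * x)) \<partial>gauss \<sigma> 0)"
    using assms
    by (intro nn_integral_cong)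
      (simp add: ennreal_mult' [symmetric] exp_add [symmetric] field_simps power2_eq_square)
  also have "\<dots> = ennreal (exp (- (\<sigma>\<^sup>2 * a\<^sup>2 / 2))) * (\<integral>\<^sup>+ x. ennreal (exp (a * x)) \<partial>gauss \<sigma> 0)"
    by (rule nn_integral_cmult) auto
  finally have *: "1 = ennreal (exp (- (\<sigma>\<^sup>2 * a\<^sup>2 / 2))) * (\<integral>\<^sup>+ x. ennreal (exp (a * x)) \<partial>gauss \<sigma> 0)" .
  have "ennreal (exp (\<sigma>\<^sup>2 * a\<^sup>2 / 2)) = ennreal (exp (\<sigma>\<^sup>2 * a\<^sup>2 / 2)) *
     (ennreal (exp (- (\<sigma>\<^sup>2 * a\<^sup>2 / 2))) * (\<integral>\<^sup>+ x. ennreal (exp (a * x)) \<partial>gauss \<sigma> 0))"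
    using * by simp
  also have "\<dots> = ennreal (exp (\<sigma>\<^sup>2 * a\<^sup>2 / 2) * exp (- (\<sigma>\<^sup>2 * a\<^sup>2 / 2))) * (\<integral>\<^sup>+ x. ennreal (exp (a * x)) \<partial>gauss \<sigma> 0)"
    by (simp only: ennreal_mult' [OF exp_ge_zero] mult.assoc)
  finally show ?thesis by (simp add: exp_minus)
qed

lemma noise_eq: "noise \<sigma> n = PiM {1..n} (\<lambda>_. gauss \<sigma> 0)"
  by (simp add: noise_def gauss_def)

lemma sets_noise [simp, measurable_cong]: "sets (noise \<sigma> n) = sets (sample_space n)"
  unfolding noise_eq by (intro sets_PiM_cong) auto

lemma space_noise [simp]: "space (noise \<sigma> n) = space (sample_space n)"
  by (rule sets_eq_imp_space_eq) simp

lemma sets_data_law [simp, measurable_cong]: "sets (data_law \<sigma> n f) = sets (sample_space n)"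
  and space_data_law [simp]: "space (data_law \<sigma> n f) = space (sample_space n)"
  by (simp_all add: data_law_def)

lemma prob_space_noise: "0 < \<sigma> \<Longrightarrow> prob_space (noise \<sigma> n)"
  unfolding noise_eq by (intro prob_space_PiM prob_space_gauss)

lemma measurable_data [measurable]:
  "(\<lambda>\<epsilon>. \<lambda>i\<in>{1..n}. f (real i / real n) + \<epsilon> i) \<in> measurable (noise \<sigma> n) (sample_space n)"
  by measurable

lemma prob_space_data_law: "0 < \<sigma> \<Longrightarrow> prob_space (data_law \<sigma> n f)"
  unfolding data_law_def by (intro prob_space.prob_space_distr prob_space_noise) measurable

lemma data_law_eq_PiM:
  assumes "0 < \<sigma>"
  shows "data_law \<sigma> n f = PiM {1..n} (\<lambda>i. gauss \<sigma> (f (real i / real n)))"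
proof -
  interpret N: product_prob_space "\<lambda>i. gauss \<sigma> (f (real i / real n))" "{1..n}"
    by (intro product_prob_spaceI prob_space_gauss assms)
  interpret M: product_prob_space "\<lambda>_::nat. gauss \<sigma> 0" "{1..n}"
    by (intro product_prob_spaceI prob_space_gauss assms)
  let ?T = "\<lambda>\<epsilon>. \<lambda>i\<in>{1..n}. f (real i / real n) + \<epsilon> i"
  show ?thesis
  proof (rule N.PiM_eqI)
    show "sets (data_law \<sigma> n f) = sets (PiM {1..n} (\<lambda>i. gauss \<sigma> (f (real i / real n))))"
      unfolding sets_data_law by (intro sets_PiM_cong) auto
    fix A assume A: "\<And>i. i \<in> {1..n} \<Longrightarrow> A i \<in> sets (gauss \<sigma> (f (real i / real n)))"
    then have A': "A i \<in> sets borel" if "i \<in> {1..n}" for i using that by auto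
    have "emeasure (data_law \<sigma> n f) (Pi\<^sub>E {1..n} A) =
        emeasure (noise \<sigma> n) (?T -` Pi\<^sub>E {1..n} A \<inter> space (noise \<sigma> n))"
      unfolding data_law_def
      by (intro emeasure_distr measurable_data sets_PiM_I_finite A') auto
    also have "?T -` Pi\<^sub>E {1..n} A \<inter> space (noise \<sigma> n) =
        Pi\<^sub>E {1..n} (\<lambda>i. (\<lambda>x. f (real i / real n) + x) -` A i)"
      by (auto simp: space_PiM PiE_def Pi_def extensional_def)
    also have "emeasure (noise \<sigma> n) \<dots> =
        (\<Prod>i\<in>{1..n}. emeasure (gauss \<sigma> 0) ((\<lambda>x. f (real i / real n) + x) -` A i))"
      unfolding noise_eq
    proof (rule M.emeasure_PiM)
      fix i assume "i \<in> {1..n}"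
      from A' [OF this] show "(\<lambda>x. f (real i / real n) + x) -` A i \<in> sets (gauss \<sigma> 0)"
        using measurable_sets [of "\<lambda>x. f (real i / real n) + x" borel borel "A i"] by simp
    qed auto
    also have "\<dots> = (\<Prod>i\<in>{1..n}. emeasure (gauss \<sigma> (f (real i / real n))) (A i))"
      using A' by (intro prod.cong refl, subst gauss_translate [OF assms, symmetric])
        (subst emeasure_distr; simp)
    finally show "emeasure (data_law \<sigma> n f) (Pi\<^sub>E {1..n} A) =
      (\<Prod>i\<in>{1..n}. emeasure (gauss \<sigma> (f (real i / real n))) (A i))" .
  qed auto
qed

text \<open>
  The density of the data law at f with respect to the law of pure noise.
\<close>

definition likelihood :: "real \<Rightarrow> nat \<Rightarrow> (real \<Rightarrow> real) \<Rightarrow> (nat \<Rightarrow> real) \<Rightarrow> real" where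
  "likelihood \<sigma> n f Y =
     exp (\<Sum>i=1..n. f (real i / real n) * Y i / \<sigma>\<^sup>2 - (f (real i / real n))\<^sup>2 / (2 * \<sigma>\<^sup>2))"

lemma likelihood_measurable [measurable]:
  "likelihood \<sigma> n f \<in> borel_measurable (sample_space n)"
  unfolding likelihood_def by measurable

lemma noise_nn_integral_prod:
  assumes "0 < \<sigma>" "\<And>i. i \<in> {1..n} \<Longrightarrow> g i \<in> borel_measurable borel"
  shows "(\<integral>\<^sup>+ \<epsilon>. (\<Prod>i=1..n. g i (\<epsilon> i)) \<partial>noise \<sigma> n) = (\<Prod>i=1..n. \<integral>\<^sup>+ x. g i x \<partial>gauss \<sigma> 0)"
proof -
  interpret M: product_prob_space "\<lambda>_::nat. gauss \<sigma> 0" "{1..n}"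
    by (intro product_prob_spaceI prob_space_gauss assms)
  show ?thesis
    unfolding noise_eq using assms(2) by (intro M.product_nn_integral_prod) auto
qed

text \<open>
  Both sides are finite products, so it suffices to compare them on boxes, where the claim reduces to
  the one-dimensional translation formula. Probabilities under different regression functions thereby
  become integrals over the same noise.
\<close>

lemma data_law_density:
  assumes "0 < \<sigma>"
  shows "data_law \<sigma> n f = density (noise \<sigma> n) (\<lambda>Y. ennreal (likelihood \<sigma> n f Y))"
proof -
  interpret N: product_prob_space "\<lambda>i. gauss \<sigma> (f (real i / real n))" "{1..n}"
    by (intro product_prob_spaceI prob_space_gauss assms)
  let ?g = "\<lambda>i x. exp (f (real i / real n) * x / \<sigma>\<^sup>2 - (f (real i / real n))\<^sup>2 / (2 * \<sigma>\<^sup>2))"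
  have "density (noise \<sigma> n) (\<lambda>Y. ennreal (likelihood \<sigma> n f Y)) =
      PiM {1..n} (\<lambda>i. gauss \<sigma> (f (real i / real n)))"
  proof (rule N.PiM_eqI)
    show "sets (density (noise \<sigma> n) (\<lambda>Y. ennreal (likelihood \<sigma> n f Y))) =
        sets (PiM {1..n} (\<lambda>i. gauss \<sigma> (f (real i / real n))))"
      unfolding sets_density sets_noise by (intro sets_PiM_cong) auto
    fix A assume A: "\<And>i. i \<in> {1..n} \<Longrightarrow> A i \<in> sets (gauss \<sigma> (f (real i / real n)))"
    then have A': "A i \<in> sets borel" if "i \<in> {1..n}" for i using that by auto
    have "Pi\<^sub>E {1..n} A \<in> sets (noise \<sigma> n)"
      unfolding sets_noise by (intro sets_PiM_I_finite A') auto
    then have "emeasure (density (noise \<sigma> n) (\<lambda>Y. ennreal (likelihood \<sigma> n f Y))) (Pi\<^sub>E {1..n} A) =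
       (\<integral>\<^sup>+ Y. ennreal (likelihood \<sigma> n f Y) * indicator (Pi\<^sub>E {1..n} A) Y \<partial>noise \<sigma> n)"
      by (intro emeasure_density) auto
    also have "\<dots> = (\<integral>\<^sup>+ Y. (\<Prod>i=1..n. ennreal (?g i (Y i)) * indicator (A i) (Y i)) \<partial>noise \<sigma> n)"
    proof (rule nn_integral_cong)
      fix Y assume "Y \<in> space (noise \<sigma> n)"
      then have *: "Y \<in> extensional {1..n}" by (auto simp: space_PiM PiE_def)
      have "indicator (Pi\<^sub>E {1..n} A) Y = (\<Prod>i=1..n. indicator (A i) (Y i) :: ennreal)"
      proof (cases "Y \<in> Pi\<^sub>E {1..n} A")
        case False
        with * obtain i where "i \<in> {1..n}" "Y i \<notin> A i" by (auto simp: PiE_iff)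
        then have "(\<Prod>i=1..n. indicator (A i) (Y i) :: ennreal) = 0"
          by (intro prod_zero) (auto intro!: bexI [of _ i])
        with False show ?thesis by simp
      qed (auto simp: PiE_def Pi_def intro!: prod.neutral)
      then show "ennreal (likelihood \<sigma> n f Y) * indicator (Pi\<^sub>E {1..n} A) Y =
          (\<Prod>i=1..n. ennreal (?g i (Y i)) * indicator (A i) (Y i))"
        by (simp add: likelihood_def exp_sum prod_ennreal prod.distrib)
    qed
    also have "\<dots> = (\<Prod>i=1..n. \<integral>\<^sup>+ x. ennreal (?g i x) * indicator (A i) x \<partial>gauss \<sigma> 0)"
      using A' by (intro noise_nn_integral_prod assms) auto
    also have "\<dots> = (\<Prod>i\<in>{1..n}. emeasure (gauss \<sigma> (f (real i / real n))) (A i))"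
      using A' by (intro prod.cong refl, subst gauss_density [OF assms, of "f _"])
        (subst emeasure_density; simp)
    finally show "emeasure (density (noise \<sigma> n) (\<lambda>Y. ennreal (likelihood \<sigma> n f Y))) (Pi\<^sub>E {1..n} A)
      = (\<Prod>i\<in>{1..n}. emeasure (gauss \<sigma> (f (real i / real n))) (A i))" .
  qed auto
  then show ?thesis by (simp add: data_law_eq_PiM [OF assms])
qed

lemma data_law_zero: "0 < \<sigma> \<Longrightarrow> data_law \<sigma> n (\<lambda>_. 0) = noise \<sigma> n"
  by (simp add: data_law_eq_PiM noise_eq)

lemma noise_exp_moment:
  assumes "0 < \<sigma>"
  shows "(\<integral>\<^sup>+ \<epsilon>. ennreal (exp (\<Sum>i=1..n. c i * \<epsilon> i)) \<partial>noise \<sigma> n) =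
    ennreal (exp (\<sigma>\<^sup>2 / 2 * (\<Sum>i=1..n. (c i)\<^sup>2)))"
proof -
  have "(\<integral>\<^sup>+ \<epsilon>. ennreal (exp (\<Sum>i=1..n. c i * \<epsilon> i)) \<partial>noise \<sigma> n) =
      (\<integral>\<^sup>+ \<epsilon>. (\<Prod>i=1..n. ennreal (exp (c i * \<epsilon> i))) \<partial>noise \<sigma> n)"
    by (simp add: exp_sum prod_ennreal)
  also have "\<dots> = (\<Prod>i=1..n. ennreal (exp (\<sigma>\<^sup>2 * (c i)\<^sup>2 / 2)))"
    by (subst noise_nn_integral_prod [OF assms]) (auto simp: gauss_exp_moment [OF assms])
  also have "\<dots> = ennreal (exp (\<sigma>\<^sup>2 / 2 * (\<Sum>i=1..n. (c i)\<^sup>2)))"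
    by (simp add: prod_ennreal exp_sum [symmetric] sum_distrib_left)
  finally show ?thesis .
qed

text \<open>
  The exponential Markov inequality with the optimal exponent.
\<close>

lemma noise_upper_tail:
  assumes "0 < \<sigma>" and V: "(\<Sum>i=1..n. (c i)\<^sup>2) \<le> V" "0 < V" and x: "0 < x"
  shows "measure (noise \<sigma> n) {\<epsilon> \<in> space (noise \<sigma> n). x \<le> (\<Sum>i=1..n. c i * \<epsilon> i)}
    \<le> exp (- x\<^sup>2 / (2 * \<sigma>\<^sup>2 * V))"
proof -
  interpret prob_space "noise \<sigma> n" by (rule prob_space_noise [OF assms(1)])
  \<comment> \<open>the minimiser of \<sigma>^2 V lam^2 / 2 - lam x\<close>
  define lam where "lam = x / (\<sigma>\<^sup>2 * V)"
  have lam: "0 < lam" using assms by (simp add: lam_def)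
  let ?A = "{\<epsilon> \<in> space (noise \<sigma> n). x \<le> (\<Sum>i=1..n. c i * \<epsilon> i)}"
  have A: "?A \<in> sets (noise \<sigma> n)" by measurable
  have "emeasure (noise \<sigma> n) ?A = (\<integral>\<^sup>+ \<epsilon>. indicator ?A \<epsilon> \<partial>noise \<sigma> n)"
    using A by simp
  also have "\<dots> \<le> (\<integral>\<^sup>+ \<epsilon>. ennreal (exp (- lam * x)) * ennreal (exp (\<Sum>i=1..n. (lam * c i) * \<epsilon> i)) \<partial>noise \<sigma> n)"
  proof (rule nn_integral_mono)
    fix \<epsilon> assume "\<epsilon> \<in> space (noise \<sigma> n)"
    show "indicator ?A \<epsilon> \<le> ennreal (exp (- lam * x)) * ennreal (exp (\<Sum>i=1..n. (lam * c i) * \<epsilon> i))"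
    proof (cases "\<epsilon> \<in> ?A")
      case True
      then have "0 \<le> lam * ((\<Sum>i=1..n. c i * \<epsilon> i) - x)" using lam by simp
      also have "\<dots> = - lam * x + (\<Sum>i=1..n. (lam * c i) * \<epsilon> i)"
        by (simp add: sum_distrib_left algebra_simps)
      finally have "1 \<le> exp (- lam * x + (\<Sum>i=1..n. (lam * c i) * \<epsilon> i))" by simp
      then show ?thesis using True
        by (simp add: ennreal_mult' [symmetric] exp_add [symmetric])
    qed simp
  qed
  also have "\<dots> = ennreal (exp (- lam * x)) * ennreal (exp (\<sigma>\<^sup>2 / 2 * (\<Sum>i=1..n. (lam * c i)\<^sup>2)))"
    by (subst nn_integral_cmult) (auto simp only: noise_exp_moment [OF assms(1)], measurable)
  also have "\<dots> = ennreal (exp (- lam * x + \<sigma>\<^sup>2 / 2 * lam\<^sup>2 * (\<Sum>i=1..n. (c i)\<^sup>2)))"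
    by (simp add: ennreal_mult' [symmetric] exp_add [symmetric] power_mult_distrib sum_distrib_left algebra_simps)
  also have "\<dots> \<le> ennreal (exp (- lam * x + \<sigma>\<^sup>2 / 2 * lam\<^sup>2 * V))"
    using V by (intro ennreal_leI) (simp add: mult_left_mono)
  also have "- lam * x + \<sigma>\<^sup>2 / 2 * lam\<^sup>2 * V = - x\<^sup>2 / (2 * \<sigma>\<^sup>2 * V)"
    using assms by (simp add: lam_def field_simps power2_eq_square)
  finally show ?thesis by (simp add: emeasure_eq_measure)
qed

lemma noise_tail:
  assumes "0 < \<sigma>" and V: "(\<Sum>i=1..n. (c i)\<^sup>2) \<le> V" "0 < V" and x: "0 < x"
  shows "measure (noise \<sigma> n) {\<epsilon> \<in> space (noise \<sigma> n). x \<le> \<bar>\<Sum>i=1..n. c i * \<epsilon> i\<bar>}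
    \<le> 2 * exp (- x\<^sup>2 / (2 * \<sigma>\<^sup>2 * V))"
proof -
  interpret prob_space "noise \<sigma> n" by (rule prob_space_noise [OF assms(1)])
  let ?A = "{\<epsilon> \<in> space (noise \<sigma> n). x \<le> (\<Sum>i=1..n. c i * \<epsilon> i)}"
  let ?B = "{\<epsilon> \<in> space (noise \<sigma> n). x \<le> (\<Sum>i=1..n. - c i * \<epsilon> i)}"
  have "{\<epsilon> \<in> space (noise \<sigma> n). x \<le> \<bar>\<Sum>i=1..n. c i * \<epsilon> i\<bar>} = ?A \<union> ?B"
    by (auto simp: sum_negf abs_if)
  moreover have "prob (?A \<union> ?B) \<le> prob ?A + prob ?B"
    by (intro measure_Un_le) measurable
  moreover have "prob ?A \<le> exp (- x\<^sup>2 / (2 * \<sigma>\<^sup>2 * V))"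
    by (rule noise_upper_tail) fact+
  moreover have "prob ?B \<le> exp (- x\<^sup>2 / (2 * \<sigma>\<^sup>2 * V))"
    using V by (intro noise_upper_tail assms) auto
  ultimately show ?thesis by simp
qed

section \<open>Indistinguishability of a mixture from pure noise\<close>

lemma nn_integral_likelihood_indicator:
  assumes "0 < \<sigma>" "U \<in> sets (sample_space n)"
  shows "(\<integral>\<^sup>+ Y. ennreal (likelihood \<sigma> n f Y) * indicator U Y \<partial>noise \<sigma> n) = 
    emeasure (data_law \<sigma> n f) U"
  using assms by (simp add: data_law_density emeasure_density)

lemma nn_integral_likelihood:
  assumes "0 < \<sigma>"
  shows "(\<integral>\<^sup>+ Y. ennreal (likelihood \<sigma> n f Y) \<partial>noise \<sigma> n) = 1"
proof -
  interpret prob_space "data_law \<sigma> n f" by (rule prob_space_data_law [OF assms])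
  have "(\<integral>\<^sup>+ Y. ennreal (likelihood \<sigma> n f Y) \<partial>noise \<sigma> n) =
     (\<integral>\<^sup>+ Y. ennreal (likelihood \<sigma> n f Y) * indicator (space (sample_space n)) Y \<partial>noise \<sigma> n)"
    by (intro nn_integral_cong) simp
  also have "\<dots> = emeasure (data_law \<sigma> n f) (space (data_law \<sigma> n f))"
    by (subst nn_integral_likelihood_indicator [OF assms]) auto
  finally show ?thesis by (simp only: emeasure_space_1)
qed

text \<open>
  The exponents add up to a linear function of the noise; the squares in its exponential moment cancel
  against the normalising constants, and only the cross term survives.
\<close>

lemma nn_integral_likelihood_mult:
  assumes "0 < \<sigma>"
  shows "(\<integral>\<^sup>+ Y. ennreal (likelihood \<sigma> n f Y * likelihood \<sigma> n g Y) \<partial>noise \<sigma> n) =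
    ennreal (exp ((\<Sum>i=1..n. f (real i / real n) * g (real i / real n)) / \<sigma>\<^sup>2))"
proof -
  define F G where "F i = f (real i / real n)" and "G i = g (real i / real n)" for i
  define A where "A = (\<Sum>i=1..n. ((F i)\<^sup>2 + (G i)\<^sup>2) / (2 * \<sigma>\<^sup>2))"
  have "(\<integral>\<^sup>+ Y. ennreal (likelihood \<sigma> n f Y * likelihood \<sigma> n g Y) \<partial>noise \<sigma> n) =
     (\<integral>\<^sup>+ Y. ennreal (exp (- A)) * ennreal (exp (\<Sum>i=1..n. ((F i + G i) / \<sigma>\<^sup>2) * Y i)) \<partial>noise \<sigma> n)"
    unfolding likelihood_def A_def F_def [symmetric] G_def [symmetric]
    by (intro nn_integral_cong)
      (simp add: ennreal_mult' [symmetric] exp_add [symmetric] sum.distrib sum_subtractf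
         add_divide_distrib distrib_right)
  also have "\<dots> = ennreal (exp (- A)) *
      ennreal (exp (\<sigma>\<^sup>2 / 2 * (\<Sum>i=1..n. ((F i + G i) / \<sigma>\<^sup>2)\<^sup>2)))"
    by (subst nn_integral_cmult) (auto simp only: noise_exp_moment [OF assms(1)], measurable)
  also have "\<dots> = ennreal (exp (- A + \<sigma>\<^sup>2 / 2 * (\<Sum>i=1..n. ((F i + G i) / \<sigma>\<^sup>2)\<^sup>2)))"
    by (simp add: ennreal_mult' [symmetric] exp_add [symmetric])
  also have "- A + \<sigma>\<^sup>2 / 2 * (\<Sum>i=1..n. ((F i + G i) / \<sigma>\<^sup>2)\<^sup>2) = (\<Sum>i=1..n. F i * G i / \<sigma>\<^sup>2)"
    unfolding A_def sum_distrib_left sum_negf [symmetric] sum.distrib [symmetric]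
    using assms by (intro sum.cong refl) (simp add: field_simps power2_eq_square)
  finally show ?thesis
    by (simp add: F_def G_def sum_divide_distrib)
qed

text \<open>
  The second moment method. Likelihood ratios of functions that do not meet at the design points are
  uncorrelated, so the average Lbar of the M ratios has variance at most exp (V / \<sigma>^2) / M. The bound
  follows from |Lbar - 1| \<le> \<delta> / 2 + (Lbar - 1)^2 / (2 \<delta>).
\<close>

lemma mixture_indistinguishable:
  assumes "0 < \<sigma>" "0 < \<delta>" "0 < M"
    and disj: "\<And>k l i. k < M \<Longrightarrow> l < M \<Longrightarrow> k \<noteq> l \<Longrightarrow> i \<in> {1..n} \<Longrightarrow>
        F k (real i / real n) * F l (real i / real n) = 0"
    and V: "\<And>k. k < M \<Longrightarrow> (\<Sum>i=1..n. (F k (real i / real n))\<^sup>2) \<le> V"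
    and U: "U \<in> sets (sample_space n)"
    and q: "\<And>k. k < M \<Longrightarrow> measure (data_law \<sigma> n (F k)) U \<le> q"
  shows "measure (noise \<sigma> n) U \<le> q + \<delta> / 2 + exp (V / \<sigma>\<^sup>2) / real M / (2 * \<delta>)"
proof -
  interpret N: prob_space "noise \<sigma> n" by (rule prob_space_noise [OF assms(1)])
  note [measurable] = U
  define L where "L k = likelihood \<sigma> n (F k)" for k
  have [measurable]: "L k \<in> borel_measurable (sample_space n)" for k
    unfolding L_def by (rule likelihood_measurable)
  have L0: "0 \<le> L k Y" for k Y by (simp add: L_def likelihood_def)
  define Lbar where "Lbar Y = (\<Sum>k<M. L k Y) / real M" for Y
  have [measurable]: "Lbar \<in> borel_measurable (sample_space n)"
    unfolding Lbar_def by measurable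
  have Lbar0: "0 \<le> Lbar Y" for Y by (simp add: Lbar_def sum_nonneg L0)
  have int1: "(\<integral>\<^sup>+ Y. ennreal (Lbar Y) \<partial>noise \<sigma> n) = 1"
  proof -
    have "(\<integral>\<^sup>+ Y. ennreal (Lbar Y) \<partial>noise \<sigma> n) =
        (\<integral>\<^sup>+ Y. ennreal (1 / real M) * (\<Sum>k<M. ennreal (L k Y)) \<partial>noise \<sigma> n)"
      using L0 by (intro nn_integral_cong)
        (simp add: Lbar_def sum_ennreal ennreal_mult' [symmetric])
    also have "\<dots> = ennreal (1 / real M) * (\<Sum>k<M. \<integral>\<^sup>+ Y. ennreal (L k Y) \<partial>noise \<sigma> n)"
      by (subst nn_integral_cmult, measurable, subst nn_integral_sum, auto)
    also have "\<dots> = ennreal (1 / real M) * ennreal (real M)"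
      using assms by (simp add: L_def nn_integral_likelihood ennreal_of_nat_eq_real_of_nat)
    also have "\<dots> = 1" using assms(3) by (simp add: ennreal_mult' [symmetric])
    finally show ?thesis .
  qed
  have intU: "(\<integral>\<^sup>+ Y. ennreal (Lbar Y * indicator U Y) \<partial>noise \<sigma> n) \<le> ennreal q"
  proof -
    have "(\<integral>\<^sup>+ Y. ennreal (Lbar Y * indicator U Y) \<partial>noise \<sigma> n) =
        (\<integral>\<^sup>+ Y. ennreal (1 / real M) * (\<Sum>k<M. ennreal (L k Y) * indicator U Y) \<partial>noise \<sigma> n)"
      using L0 by (intro nn_integral_cong)
        (auto simp: Lbar_def sum_ennreal ennreal_mult' [symmetric] indicator_def)
    also have "\<dots> = ennreal (1 / real M) * (\<Sum>k<M. \<integral>\<^sup>+ Y. ennreal (L k Y) * indicator U Y \<partial>noise \<sigma> n)"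
      by (subst nn_integral_cmult, measurable, subst nn_integral_sum, auto)
    also have "\<dots> = ennreal (1 / real M) * (\<Sum>k<M. emeasure (data_law \<sigma> n (F k)) U)"
      using assms by (simp add: L_def nn_integral_likelihood_indicator)
    also have "\<dots> \<le> ennreal (1 / real M) * (\<Sum>k<M. ennreal q)"
    proof (intro mult_left_mono sum_mono)
      fix k assume "k \<in> {..<M}"
      interpret D: prob_space "data_law \<sigma> n (F k)" by (rule prob_space_data_law [OF assms(1)])
      show "emeasure (data_law \<sigma> n (F k)) U \<le> ennreal q"
        using q [of k] \<open>k \<in> _\<close> by (simp add: D.emeasure_eq_measure ennreal_leI)
    qed auto
    also have "\<dots> = ennreal q"
    proof -
      have "ennreal (1 / real M) * (\<Sum>k<M. ennreal q) = ennreal (1 / real M) * ennreal (real M) * ennreal q"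
        by (simp add: ennreal_of_nat_eq_real_of_nat mult.assoc)
      also have "ennreal (1 / real M) * ennreal (real M) = 1"
        using assms(3) by (simp add: ennreal_mult' [symmetric])
      finally show ?thesis by simp
    qed
    finally show ?thesis .
  qed
  have int2: "(\<integral>\<^sup>+ Y. ennreal ((Lbar Y)\<^sup>2) \<partial>noise \<sigma> n) \<le> ennreal (1 + exp (V / \<sigma>\<^sup>2) / real M)"
  proof -
    have "(\<integral>\<^sup>+ Y. ennreal ((Lbar Y)\<^sup>2) \<partial>noise \<sigma> n) =
        (\<integral>\<^sup>+ Y. ennreal (1 / (real M)\<^sup>2) * (\<Sum>k<M. \<Sum>l<M. ennreal (L k Y * L l Y)) \<partial>noise \<sigma> n)"
      using L0 by (intro nn_integral_cong)
        (simp add: Lbar_def sum_ennreal ennreal_mult' [symmetric] power2_eq_square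
          sum_product sum_nonneg)
    also have "\<dots> = ennreal (1 / (real M)\<^sup>2) *
        (\<Sum>k<M. \<Sum>l<M. \<integral>\<^sup>+ Y. ennreal (L k Y * L l Y) \<partial>noise \<sigma> n)"
      by (subst nn_integral_cmult, measurable, subst nn_integral_sum, measurable,
          subst nn_integral_sum, auto)
    also have "\<dots> \<le> ennreal (1 / (real M)\<^sup>2) *
        (\<Sum>k<M. \<Sum>l<M. ennreal (1 + (if k = l then exp (V / \<sigma>\<^sup>2) else 0)))"
    proof (intro mult_left_mono sum_mono)
      fix k l assume kl: "k \<in> {..<M}" "l \<in> {..<M}"
      let ?S = "\<Sum>i=1..n. F k (real i / real n) * F l (real i / real n)"
      have "exp (?S / \<sigma>\<^sup>2) \<le> 1 + (if k = l then exp (V / \<sigma>\<^sup>2) else 0)"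
      proof (cases "k = l")
        case True
        then have "?S \<le> V" using V [of k] kl by (simp add: power2_eq_square)
        then have "exp (?S / \<sigma>\<^sup>2) \<le> exp (V / \<sigma>\<^sup>2)" by (simp add: divide_right_mono)
        then show ?thesis using True by (simp add: add_increasing)
      next
        case False
        then have "?S = 0" using disj kl by (intro sum.neutral) auto
        then show ?thesis using False by simp
      qed
      then show "(\<integral>\<^sup>+ Y. ennreal (L k Y * L l Y) \<partial>noise \<sigma> n)
          \<le> ennreal (1 + (if k = l then exp (V / \<sigma>\<^sup>2) else 0))"
        unfolding L_def nn_integral_likelihood_mult [OF assms(1)] by (rule ennreal_leI)
    qed auto
    also have "\<dots> = ennreal (1 / (real M)\<^sup>2 *
        (\<Sum>k<M. \<Sum>l<M. 1 + (if k = l then exp (V / \<sigma>\<^sup>2) else 0)))"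
      by (subst ennreal_mult) (auto simp: sum_nonneg sum_ennreal simp del: ennreal_plus)
    also have "(\<Sum>k<M. \<Sum>l<M. 1 + (if k = l then exp (V / \<sigma>\<^sup>2) else 0)) =
        (real M)\<^sup>2 + real M * exp (V / \<sigma>\<^sup>2)"
      by (simp add: sum.distrib power2_eq_square distrib_left)
    also have "1 / (real M)\<^sup>2 * \<dots> = 1 + exp (V / \<sigma>\<^sup>2) / real M"
      using assms(3) by (simp add: field_simps power2_eq_square)
    finally show ?thesis .
  qed
  \<comment> \<open>Adding Lbar / \<delta> on both sides keeps all integrands nonnegative, so that the inequality can
    be integrated in the extended nonnegative reals.\<close>
  have pw: "indicator U Y + Lbar Y / \<delta> \<le> Lbar Y * indicator U Y + \<delta> / 2 + ((Lbar Y)\<^sup>2 + 1) / (2 * \<delta>)"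
    for Y
  proof -
    have "0 \<le> (\<delta> - (1 - Lbar Y))\<^sup>2 / (2 * \<delta>)" "0 \<le> \<delta> / 2 + (1 - Lbar Y)\<^sup>2 / (2 * \<delta>)"
      using assms(2) by auto
    moreover have "(\<delta> - (1 - Lbar Y))\<^sup>2 / (2 * \<delta>) = \<delta> / 2 + (1 - Lbar Y)\<^sup>2 / (2 * \<delta>) - (1 - Lbar Y)"
      using assms(2) by (simp add: field_simps power2_eq_square)
    moreover have "(1 - Lbar Y)\<^sup>2 / (2 * \<delta>) = ((Lbar Y)\<^sup>2 + 1) / (2 * \<delta>) - Lbar Y / \<delta>"
      using assms(2) by (simp add: field_simps power2_eq_square)
    ultimately show ?thesis by (auto simp: indicator_def)
  qed
  have "ennreal (N.prob U + 1 / \<delta>) = (\<integral>\<^sup>+ Y. ennreal (indicator U Y + Lbar Y / \<delta>) \<partial>noise \<sigma> n)"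
  proof -
    have "(\<integral>\<^sup>+ Y. ennreal (indicator U Y + Lbar Y / \<delta>) \<partial>noise \<sigma> n) =
        (\<integral>\<^sup>+ Y. indicator U Y + ennreal (1 / \<delta>) * ennreal (Lbar Y) \<partial>noise \<sigma> n)"
      using Lbar0 assms(2) by (intro nn_integral_cong)
        (auto simp: ennreal_plus [symmetric] ennreal_mult' [symmetric] ennreal_indicator [symmetric]
            simp del: ennreal_plus)
    also have "\<dots> = emeasure (noise \<sigma> n) U + ennreal (1 / \<delta>) * 1"
      by (subst nn_integral_add, measurable, subst nn_integral_cmult) (auto simp: int1 U [simplified])
    finally show ?thesis using assms(2) by (simp add: N.emeasure_eq_measure)
  qed
  also have "\<dots> \<le> (\<integral>\<^sup>+ Y. ennreal (Lbar Y * indicator U Y) +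
      (ennreal (\<delta> / 2 + 1 / (2 * \<delta>)) + ennreal (1 / (2 * \<delta>)) * ennreal ((Lbar Y)\<^sup>2)) \<partial>noise \<sigma> n)"
  proof (rule nn_integral_mono)
    fix Y
    have "ennreal (Lbar Y * indicator U Y) +
        (ennreal (\<delta> / 2 + 1 / (2 * \<delta>)) + ennreal (1 / (2 * \<delta>)) * ennreal ((Lbar Y)\<^sup>2)) =
       ennreal (Lbar Y * indicator U Y + ((\<delta> / 2 + 1 / (2 * \<delta>)) + 1 / (2 * \<delta>) * (Lbar Y)\<^sup>2))"
      using Lbar0 [of Y] assms(2)
      by (subst ennreal_mult' [symmetric], simp, subst ennreal_plus [symmetric], simp, simp,
          subst ennreal_plus [symmetric]) auto
    moreover have "indicator U Y + Lbar Y / \<delta> \<le>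
        Lbar Y * indicator U Y + ((\<delta> / 2 + 1 / (2 * \<delta>)) + 1 / (2 * \<delta>) * (Lbar Y)\<^sup>2)"
      using pw [of Y] by (simp add: add_divide_distrib algebra_simps)
    ultimately show "ennreal (indicator U Y + Lbar Y / \<delta>) \<le> ennreal (Lbar Y * indicator U Y) +
      (ennreal (\<delta> / 2 + 1 / (2 * \<delta>)) + ennreal (1 / (2 * \<delta>)) * ennreal ((Lbar Y)\<^sup>2))"
      using ennreal_leI by metis
  qed
  also have "\<dots> = (\<integral>\<^sup>+ Y. ennreal (Lbar Y * indicator U Y) \<partial>noise \<sigma> n) +
      (ennreal (\<delta> / 2 + 1 / (2 * \<delta>)) + ennreal (1 / (2 * \<delta>)) * (\<integral>\<^sup>+ Y. ennreal ((Lbar Y)\<^sup>2) \<partial>noise \<sigma> n))"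
    by (subst nn_integral_add, measurable, subst nn_integral_add, measurable,
        subst nn_integral_cmult, measurable, simp add: N.emeasure_space_1 [simplified])
  also have "\<dots> \<le> ennreal q +
      (ennreal (\<delta> / 2 + 1 / (2 * \<delta>)) + ennreal (1 / (2 * \<delta>)) * ennreal (1 + exp (V / \<sigma>\<^sup>2) / real M))"
    using intU int2 by (intro add_mono mult_left_mono) auto
  also have "\<dots> = ennreal (q + (\<delta> / 2 + 1 / (2 * \<delta>) + 1 / (2 * \<delta>) * (1 + exp (V / \<sigma>\<^sup>2) / real M)))"
  proof -
    have "0 \<le> q" using q [of 0] assms(3) by (meson measure_nonneg order_trans)
    then show ?thesis using assms(2)
      by (subst ennreal_mult' [symmetric], simp, subst ennreal_plus [symmetric], simp, simp add: add_nonneg_nonneg,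
          subst ennreal_plus [symmetric]) (auto intro!: add_nonneg_nonneg mult_nonneg_nonneg)
  qed
  finally have "N.prob U + 1 / \<delta> \<le> q + (\<delta> / 2 + 1 / (2 * \<delta>) + 1 / (2 * \<delta>) * (1 + exp (V / \<sigma>\<^sup>2) / real M))"
    using q [of 0] assms(2,3)
    by (subst (asm) ennreal_le_iff)
      (auto intro!: add_nonneg_nonneg mult_nonneg_nonneg intro: order_trans [OF measure_nonneg])
  moreover have "1 / \<delta> = 1 / (2 * \<delta>) + 1 / (2 * \<delta>)" using assms(2) by simp
  moreover have "1 / (2 * \<delta>) * (1 + exp (V / \<sigma>\<^sup>2) / real M) =
      1 / (2 * \<delta>) + exp (V / \<sigma>\<^sup>2) / real M / (2 * \<delta>)"
    by (simp add: add_divide_distrib)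
  ultimately show ?thesis by linarith
qed

section \<open>Localisation of the interval wavelets\<close>

text \<open>
  A single constant bounds the size, the extent of the support and the Lipschitz modulus. It is
  relative to a set because the edge functions are tame on a half line only.
\<close>

definition tame :: "real set \<Rightarrow> real \<Rightarrow> (real \<Rightarrow> real) \<Rightarrow> bool" where
  "tame A C g \<longleftrightarrow> (\<forall>x\<in>A. \<bar>g x\<bar> \<le> C \<and> (g x \<noteq> 0 \<longrightarrow> \<bar>x\<bar> \<le> C) \<and>
     (\<forall>y\<in>A. \<bar>g x - g y\<bar> \<le> C * \<bar>x - y\<bar>))"

lemma tame_mono: "tame A C g \<Longrightarrow> C \<le> D \<Longrightarrow> tame A D g"
  unfolding tame_def by (meson abs_ge_zero mult_right_mono order_trans)

lemma tame_cong: "tame A C f \<Longrightarrow> (\<And>x. x \<in> A \<Longrightarrow> g x = f x) \<Longrightarrow> tame A C g"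
  unfolding tame_def by simp

lemma tame_sum:
  assumes "finite I" "\<And>i. i \<in> I \<Longrightarrow> \<exists>C. tame A C (g i)"
  shows "\<exists>C. tame A C (\<lambda>x. \<Sum>i\<in>I. c i * g i x)"
proof -
  obtain C where C: "tame A (C i) (g i)" if "i \<in> I" for i
    using assms(2) by metis
  define D where "D = (\<Sum>i\<in>I. (1 + \<bar>c i\<bar>) * \<bar>C i\<bar>)"
  have D1: "(\<Sum>i\<in>I. \<bar>c i\<bar> * \<bar>C i\<bar>) \<le> D"
    unfolding D_def by (intro sum_mono) (simp add: distrib_right)
  have D2: "\<bar>C i\<bar> \<le> D" if "i \<in> I" for i
  proof -
    have "\<bar>C i\<bar> \<le> (1 + \<bar>c i\<bar>) * \<bar>C i\<bar>" by (simp add: distrib_right)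
    also have "\<dots> \<le> D" unfolding D_def
      using assms(1) that by (intro member_le_sum) auto
    finally show ?thesis .
  qed
  show ?thesis
    unfolding tame_def
  proof (intro exI [of _ D] ballI conjI impI)
    fix x assume x: "x \<in> A"
    have "\<bar>\<Sum>i\<in>I. c i * g i x\<bar> \<le> (\<Sum>i\<in>I. \<bar>c i\<bar> * \<bar>C i\<bar>)"
    proof (intro order_trans [OF sum_abs] sum_mono)
      fix i assume i: "i \<in> I"
      have "\<bar>g i x\<bar> \<le> \<bar>C i\<bar>" using C [OF i, unfolded tame_def, rule_format, OF x] by linarith
      then show "\<bar>c i * g i x\<bar> \<le> \<bar>c i\<bar> * \<bar>C i\<bar>" by (simp add: abs_mult mult_left_mono)
    qed
    with D1 show "\<bar>\<Sum>i\<in>I. c i * g i x\<bar> \<le> D" by simp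
    { assume "(\<Sum>i\<in>I. c i * g i x) \<noteq> 0"
      then obtain i where i: "i \<in> I" "c i * g i x \<noteq> 0"
        by (rule sum.not_neutral_contains_not_neutral)
      then have "\<bar>x\<bar> \<le> C i"
        using C [OF i(1), unfolded tame_def, rule_format, OF x] by simp
      with D2 [OF i(1)] show "\<bar>x\<bar> \<le> D" by simp }
    fix y assume y: "y \<in> A"
    have "\<bar>(\<Sum>i\<in>I. c i * g i x) - (\<Sum>i\<in>I. c i * g i y)\<bar> = \<bar>\<Sum>i\<in>I. c i * (g i x - g i y)\<bar>"
      by (simp add: sum_subtractf right_diff_distrib)
    also have "\<dots> \<le> (\<Sum>i\<in>I. \<bar>c i\<bar> * (\<bar>C i\<bar> * \<bar>x - y\<bar>))"
    proof (intro order_trans [OF sum_abs] sum_mono)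
      fix i assume i: "i \<in> I"
      have "\<bar>g i x - g i y\<bar> \<le> C i * \<bar>x - y\<bar>"
        using C [OF i, unfolded tame_def, rule_format, OF x] y by blast
      also have "\<dots> \<le> \<bar>C i\<bar> * \<bar>x - y\<bar>" by (intro mult_right_mono) auto
      finally show "\<bar>c i * (g i x - g i y)\<bar> \<le> \<bar>c i\<bar> * (\<bar>C i\<bar> * \<bar>x - y\<bar>)"
        by (simp add: abs_mult mult_left_mono)
    qed
    also have "\<dots> = (\<Sum>i\<in>I. \<bar>c i\<bar> * \<bar>C i\<bar>) * \<bar>x - y\<bar>"
      by (simp add: sum_distrib_right mult.assoc)
    also have "\<dots> \<le> D * \<bar>x - y\<bar>" using D1 by (intro mult_right_mono) auto
    finally show "\<bar>(\<Sum>i\<in>I. c i * g i x) - (\<Sum>i\<in>I. c i * g i y)\<bar> \<le> D * \<bar>x - y\<bar>" .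
  qed
qed

lemma tame_add:
  assumes "\<exists>C. tame A C f" "\<exists>C. tame A C g"
  shows "\<exists>C. tame A C (\<lambda>x. f x + g x)"
proof -
  have "\<exists>C. tame A C (\<lambda>x. \<Sum>b\<in>{True, False}. 1 * (if b then f else g) x)"
    using assms by (intro tame_sum) auto
  then show ?thesis by simp
qed

lemma tame_affine:
  assumes "\<exists>C. tame A C g" "a \<noteq> 0" "\<And>x. x \<in> A' \<Longrightarrow> a * x + b \<in> A"
  shows "\<exists>C. tame A' C (\<lambda>x. g (a * x + b))"
proof -
  from assms(1) obtain C where C: "tame A C g" by blast
  define D where "D = \<bar>C\<bar> + \<bar>C\<bar> * \<bar>a\<bar> + (\<bar>C\<bar> + \<bar>b\<bar>) / \<bar>a\<bar>"
  have D: "\<bar>C\<bar> \<le> D" "\<bar>C\<bar> * \<bar>a\<bar> \<le> D" "(\<bar>C\<bar> + \<bar>b\<bar>) / \<bar>a\<bar> \<le> D" by (auto simp: D_def)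
  show ?thesis
    unfolding tame_def
  proof (intro exI [of _ D] ballI conjI impI)
    fix x assume x: "x \<in> A'"
    from C assms(3) [OF x] show "\<bar>g (a * x + b)\<bar> \<le> D" using D(1) by (auto simp: tame_def)
    { assume "g (a * x + b) \<noteq> 0"
      with C assms(3) [OF x] have "\<bar>a * x + b\<bar> \<le> \<bar>C\<bar>" by (auto simp: tame_def)
      then have "\<bar>a * x\<bar> \<le> \<bar>C\<bar> + \<bar>b\<bar>" by linarith
      then have "\<bar>x\<bar> \<le> (\<bar>C\<bar> + \<bar>b\<bar>) / \<bar>a\<bar>" using assms(2) by (simp add: field_simps abs_mult)
      with D(3) show "\<bar>x\<bar> \<le> D" by simp }
    fix y assume y: "y \<in> A'"
    have "\<bar>g (a * x + b) - g (a * y + b)\<bar> \<le> C * \<bar>(a * x + b) - (a * y + b)\<bar>"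
      using C assms(3) [OF x] assms(3) [OF y] unfolding tame_def by blast
    also have "(a * x + b) - (a * y + b) = a * (x - y)" by (simp add: algebra_simps)
    also have "C * \<bar>a * (x - y)\<bar> \<le> \<bar>C\<bar> * \<bar>a\<bar> * \<bar>x - y\<bar>"
      by (simp add: abs_mult mult.assoc mult_right_mono)
    also have "\<dots> \<le> D * \<bar>x - y\<bar>" using D(2) by (intro mult_right_mono) auto
    finally show "\<bar>g (a * x + b) - g (a * y + b)\<bar> \<le> D * \<bar>x - y\<bar>" .
  qed
qed

text \<open>
  The derivative is continuous and vanishes off the compact support, hence is bounded.
\<close>

lemma tame_C1:
  assumes C: "C_k_on_line S \<phi>" "0 < S" and supp: "\<And>x. x \<notin> {a..b} \<Longrightarrow> \<phi> x = 0"
  shows "\<exists>C. tame UNIV C \<phi>"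
proof -
  have diff: "\<phi> differentiable (at x)" for x
    using C unfolding C_k_on_line_def by (metis funpow_0)
  have cont: "continuous_on UNIV (deriv \<phi>)"
  proof (cases "S = 1")
    case True
    with C show ?thesis by (simp add: C_k_on_line_def)
  next
    case False
    with C(2) have "1 < S" by simp
    with C(1) have "(deriv ^^ 1) \<phi> differentiable (at x)" for x
      unfolding C_k_on_line_def by blast
    then show ?thesis
      by (auto intro!: continuous_at_imp_continuous_on differentiable_imp_continuous_within)
  qed
  have der: "(\<phi> has_real_derivative deriv \<phi> x) (at x)" for x
    using diff [of x] by (simp add: DERIV_deriv_iff_real_differentiable)
  have zero: "deriv \<phi> x = 0" if x: "x \<notin> {a..b}" for x
  proof -
    have "((\<lambda>_. 0) has_real_derivative 0) (at x)" by simp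
    then have "(\<phi> has_real_derivative 0) (at x)"
      by (rule has_field_derivative_transform_within_open [of _ _ _ "- {a..b}"])
        (use supp x in auto)
    then show ?thesis by (rule DERIV_imp_deriv)
  qed
  have "bounded (deriv \<phi> ` {a..b})"
    by (intro compact_imp_bounded compact_continuous_image continuous_on_subset [OF cont]) auto
  moreover have "bounded (\<phi> ` {a..b})"
    by (intro compact_imp_bounded compact_continuous_image)
      (auto intro!: continuous_at_imp_continuous_on differentiable_imp_continuous_within diff)
  ultimately obtain C1 C2 where C12: "\<And>x. x \<in> {a..b} \<Longrightarrow> \<bar>deriv \<phi> x\<bar> \<le> C1"
    "\<And>x. x \<in> {a..b} \<Longrightarrow> \<bar>\<phi> x\<bar> \<le> C2"
    unfolding bounded_iff by (metis imageI real_norm_def)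
  define D where "D = \<bar>C1\<bar> + \<bar>C2\<bar> + \<bar>a\<bar> + \<bar>b\<bar>"
  have D1: "\<bar>deriv \<phi> x\<bar> \<le> D" for x
    using C12(1) [of x] zero [of x] by (cases "x \<in> {a..b}") (auto simp: D_def)
  have D2: "\<bar>\<phi> x\<bar> \<le> D" for x
    using C12(2) [of x] supp [of x] by (cases "x \<in> {a..b}") (auto simp: D_def)
  have D3: "\<bar>x\<bar> \<le> D" if "\<phi> x \<noteq> 0" for x
  proof -
    have "x \<in> {a..b}" using that supp by blast
    then show ?thesis by (auto simp: D_def)
  qed
  have "\<bar>\<phi> x - \<phi> y\<bar> \<le> D * \<bar>x - y\<bar>" for x y
    using field_differentiable_bound [of UNIV \<phi> "deriv \<phi>" D x y] der D1
    by (simp add: dist_norm)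
  with D2 D3 show ?thesis unfolding tame_def by blast
qed

lemma tame_common_constant:
  assumes "finite I" "\<And>i. i \<in> I \<Longrightarrow> \<exists>C. tame A C (g i)"
  shows "\<exists>C\<ge>0. \<forall>i\<in>I. tame A C (g i)"
proof -
  obtain C where C: "tame A (C i) (g i)" if "i \<in> I" for i
    using assms(2) by metis
  have "tame A (\<Sum>i\<in>I. \<bar>C i\<bar>) (g i)" if "i \<in> I" for i
  proof (rule tame_mono [OF C [OF that]])
    have "\<bar>C i\<bar> \<le> (\<Sum>i\<in>I. \<bar>C i\<bar>)" by (rule member_le_sum) (use assms(1) that in auto)
    then show "C i \<le> (\<Sum>i\<in>I. \<bar>C i\<bar>)" by simp
  qed
  moreover have "0 \<le> (\<Sum>i\<in>I. \<bar>C i\<bar>)" by (simp add: sum_nonneg)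
  ultimately show ?thesis by blast
qed

lemma tame_left_edge_scaling:
  assumes "left_edge_scaling N \<phi> \<phi>L" "\<exists>C. tame UNIV C \<phi>" "k < N"
  shows "\<exists>C. tame {0..} C (\<phi>L k)"
proof -
  from assms(1) obtain a where a: "\<And>x. 0 \<le> x \<Longrightarrow> \<phi>L k x =
     (\<Sum>l<N. a k l * (\<Sum>n<2 * N - 1. real (n choose l) * \<phi> (x + real n - real N + 1)))"
    using assms(3) unfolding left_edge_scaling_def by blast
  have shift: "\<exists>C. tame {0..} C (\<lambda>x. \<phi> (x + real n - real N + 1))" for n
    using tame_affine [OF assms(2), of 1 "{0..}" "real n - real N + 1"] by (simp add: algebra_simps)
  have "\<exists>C. tame {0..} C (\<lambda>x. \<Sum>l<N. a k l * (\<Sum>n<2 * N - 1. real (n choose l) * \<phi> (x + real n - real N + 1)))"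
    by (intro tame_sum shift) auto
  then show ?thesis using tame_cong a by (metis (no_types, lifting) atLeast_iff)
qed

lemma tame_left_edge_wavelet:
  assumes "left_edge_wavelet N \<phi> \<phi>L \<psi>L" "\<exists>C. tame UNIV C \<phi>"
    "\<And>l. l < N \<Longrightarrow> \<exists>C. tame {0..} C (\<phi>L l)" "k < N"
  shows "\<exists>C. tame {0..} C (\<psi>L k)"
proof -
  from assms(1) obtain b c where bc: "\<And>x. 0 \<le> x \<Longrightarrow> \<psi>L k x =
     (\<Sum>l<N. b k l * \<phi>L l (2 * x)) + (\<Sum>m\<in>{N..<3 * N - 1}. c k m * \<phi> (2 * x - real m))"
    using assms(4) unfolding left_edge_wavelet_def by blast
  have 1: "\<exists>C. tame {0..} C (\<lambda>x. \<phi>L l (2 * x))" if "l < N" for l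
    using tame_affine [OF assms(3) [OF that], of 2 "{0..}" 0] by simp
  have 2: "\<exists>C. tame {0..} C (\<lambda>x. \<phi> (2 * x - real m))" for m
    using tame_affine [OF assms(2), of 2 "{0..}" "- real m"] by simp
  have "\<exists>C. tame {0..} C (\<lambda>x. (\<Sum>l<N. b k l * \<phi>L l (2 * x)) +
      (\<Sum>m\<in>{N..<3 * N - 1}. c k m * \<phi> (2 * x - real m)))"
    by (intro tame_add tame_sum 1 2) auto
  then show ?thesis using tame_cong bc by (metis (no_types, lifting) atLeast_iff)
qed

lemma tame_reflect:
  assumes "\<exists>C. tame {0..} C (\<lambda>x. g (- x))"
  shows "\<exists>C. tame {..0} C g"
  using tame_affine [OF assms, of "-1" "{..0}" 0] by simp

text \<open>
  Edge functions are attached to an end of the interval rather than to the position m, but the two are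
  at most N grid steps apart; this is why the support radius grows by N.
\<close>

lemma level_function_regular:
  assumes f: "tame UNIV K f" and fL: "\<forall>k<N. tame {0..} K (fL k)"
    and fR: "\<forall>k<N. tame {..0} K (fR k)"
    and j: "2 * N \<le> 2 ^ j" and m: "m < 2 ^ j" and x: "x \<in> {0..1}"
  shows "\<bar>level_function N f fL fR j m x\<bar> \<le> K * 2 powr (real j / 2)"
    and "y \<in> {0..1} \<Longrightarrow> \<bar>level_function N f fL fR j m x - level_function N f fL fR j m y\<bar>
      \<le> K * 2 powr (real j / 2) * 2 ^ j * \<bar>x - y\<bar>"
    and "level_function N f fL fR j m x \<noteq> 0 \<Longrightarrow> \<bar>2 ^ j * x - real m\<bar> \<le> K + real N"
proof -
  \<comment> \<open>every level function is an affine rescaling of one of finitely many tame profiles\<close>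
  have ex: "\<exists>g A d. tame A K g \<and> (\<forall>x\<in>{0..1}. 2 ^ j * x - d \<in> A) \<and> \<bar>real m - d\<bar> \<le> real N \<and>
     (\<forall>x. level_function N f fL fR j m x = 2 powr (real j / 2) * g (2 ^ j * x - d))"
  proof -
    consider "m < N" | "N \<le> m" "m < 2 ^ j - N" | "N \<le> m" "2 ^ j - N \<le> m" by linarith
    then show ?thesis
    proof cases
      case 1
      then show ?thesis
        by (intro exI [of _ "fL m"] exI [of _ "{0..}"] exI [of _ 0])
          (auto simp: level_function_def fL)
    next
      case 2
      then show ?thesis
        by (intro exI [of _ f] exI [of _ UNIV] exI [of _ "real m"])
          (auto simp: level_function_def f)
    next
      case 3
      have "real m - 2 ^ j \<ge> - real N" "real m - 2 ^ j \<le> 0"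
      proof -
        have "2 ^ j \<le> m + N" using 3 by linarith
        then have "real (2 ^ j) \<le> real (m + N)" by (simp only: of_nat_le_iff)
        then show "real m - 2 ^ j \<ge> - real N" by simp
        have "real m \<le> real (2 ^ j)" using m by (simp only: of_nat_le_iff)
        then show "real m - 2 ^ j \<le> 0" by simp
      qed
      then have d: "\<bar>real m - 2 ^ j\<bar> \<le> real N" by linarith
      have less: "2 ^ j - 1 - m < N" using 3 m by linarith
      have "level_function N f fL fR j m x =
          2 powr (real j / 2) * fR (2 ^ j - 1 - m) (2 ^ j * x - 2 ^ j)" for x
        using 3 by (auto simp: level_function_def algebra_simps)
      moreover have "2 ^ j * x - 2 ^ j \<in> {..0}" if "x \<in> {0..1::real}" for x :: real
        using that by simp
      ultimately show ?thesis using d fR less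
        by (intro exI [of _ "fR (2 ^ j - 1 - m)"] exI [of _ "{..0}"] exI [of _ "2 ^ j"]) auto
    qed
  qed
  then obtain g A d where g: "tame A K g" "\<And>x. x \<in> {0..1} \<Longrightarrow> 2 ^ j * x - d \<in> A"
    "\<bar>real m - d\<bar> \<le> real N"
    "\<And>x. level_function N f fL fR j m x = 2 powr (real j / 2) * g (2 ^ j * x - d)"
    by blast
  note gx = g(1) [unfolded tame_def, rule_format, OF g(2) [OF x]]
  show "\<bar>level_function N f fL fR j m x\<bar> \<le> K * 2 powr (real j / 2)"
    using gx by (simp add: g(4) abs_mult)
  show "\<bar>level_function N f fL fR j m x - level_function N f fL fR j m y\<bar>
      \<le> K * 2 powr (real j / 2) * 2 ^ j * \<bar>x - y\<bar>" if y: "y \<in> {0..1}"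
  proof -
    have "\<bar>g (2 ^ j * x - d) - g (2 ^ j * y - d)\<bar> \<le> K * \<bar>(2 ^ j * x - d) - (2 ^ j * y - d)\<bar>"
      using gx g(2) [OF y] by blast
    also have "(2 ^ j * x - d) - (2 ^ j * y - d) = 2 ^ j * (x - y)" by (simp add: algebra_simps)
    finally have "\<bar>g (2 ^ j * x - d) - g (2 ^ j * y - d)\<bar> \<le> K * 2 ^ j * \<bar>x - y\<bar>"
      by (simp add: abs_mult)
    then have "2 powr (real j / 2) * \<bar>g (2 ^ j * x - d) - g (2 ^ j * y - d)\<bar> \<le>
        2 powr (real j / 2) * (K * 2 ^ j * \<bar>x - y\<bar>)"
      by (intro mult_left_mono) auto
    then show ?thesis
      by (simp add: g(4) abs_mult mult_ac flip: right_diff_distrib)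
  qed
  assume "level_function N f fL fR j m x \<noteq> 0"
  then have "\<bar>2 ^ j * x - d\<bar> \<le> K" using gx by (simp add: g(4))
  with g(3) show "\<bar>2 ^ j * x - real m\<bar> \<le> K + real N" by linarith
qed

type_synonym index = "nat + nat \<times> nat"

definition indices :: "nat \<Rightarrow> index set" where
  "indices J = {..<2 ^ J} <+> (SIGMA j:{J..}. {..<2 ^ j})"

text \<open>
  Scaling functions are counted as functions of level J, so that they obey the same localisation
  estimates as the wavelets.
\<close>

definition lev :: "nat \<Rightarrow> index \<Rightarrow> nat" where
  "lev J = case_sum (\<lambda>_. J) fst"

definition pos :: "index \<Rightarrow> nat" where
  "pos = case_sum id snd"

definition basis_fun :: "(nat \<Rightarrow> real \<Rightarrow> real) \<Rightarrow> (nat \<Rightarrow> nat \<Rightarrow> real \<Rightarrow> real) \<Rightarrow> index \<Rightarrow> real \<Rightarrow> real" where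
  "basis_fun phi psi = case_sum phi (\<lambda>(j, m). psi j m)"

text \<open>
  A basis function of level l has size 2^(l/2) and width 2^(-l), and its slope is at most the ratio of
  the two.
\<close>

locale regular_basis =
  fixes J :: nat and phi :: "nat \<Rightarrow> real \<Rightarrow> real" and psi :: "nat \<Rightarrow> nat \<Rightarrow> real \<Rightarrow> real"
    and K :: real
  assumes K_ge_1: "1 \<le> K"
    and onb: "L2_orthonormal_basis (indices J) (basis_fun phi psi)"
    and basis_bound: "i \<in> indices J \<Longrightarrow> x \<in> {0..1} \<Longrightarrow>
      \<bar>basis_fun phi psi i x\<bar> \<le> K * 2 powr (real (lev J i) / 2)"
    and basis_lipschitz: "i \<in> indices J \<Longrightarrow> x \<in> {0..1} \<Longrightarrow> y \<in> {0..1} \<Longrightarrow>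
      \<bar>basis_fun phi psi i x - basis_fun phi psi i y\<bar>
        \<le> K * 2 powr (real (lev J i) / 2) * 2 ^ lev J i * \<bar>x - y\<bar>"
    and basis_support: "i \<in> indices J \<Longrightarrow> x \<in> {0..1} \<Longrightarrow> basis_fun phi psi i x \<noteq> 0 \<Longrightarrow>
      \<bar>2 ^ lev J i * x - real (pos i)\<bar> \<le> K"

text \<open>
  All functions of the system are dilated translates of finitely many profiles: the wavelet, the
  scaling function and the edge functions. Each profile is a finite combination of affine images of
  the scaling function, so it inherits tameness from it.
\<close>

theorem CDV_regular_basis:
  assumes "CDV_wavelet_basis S J phi psi" "0 < S"
  shows "\<exists>K. regular_basis J phi psi K"
proof -
  from assms(1) obtain N \<phi> \<psi> \<phi>L \<phi>R \<psi>L \<psi>R where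
    daub: "daubechies_wavelet N \<phi> \<psi>" and CS: "C_k_on_line S \<phi>"
    and edges: "CDV_edges N \<phi> \<phi>L \<phi>R \<psi>L \<psi>R" and NJ: "2 * N \<le> 2 ^ J"
    and phi: "\<forall>m<2 ^ J. \<forall>x\<in>{0..1}. phi m x = level_function N \<phi> \<phi>L \<phi>R J m x"
    and psi: "\<forall>j\<ge>J. \<forall>m<2 ^ j. \<forall>x\<in>{0..1}. psi j m x = level_function N \<psi> \<psi>L \<psi>R j m x"
    and onb: "L2_orthonormal_basis ({..<2 ^ J} <+> (SIGMA j:{J..}. {..<2 ^ j}))
       (case_sum phi (\<lambda>(j, m). psi j m))"
    unfolding CDV_wavelet_basis_def by blast
  from daub obtain h where supp: "\<And>x. x \<notin> {1 - real N..real N} \<Longrightarrow> \<phi> x = 0"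
    and \<psi>: "\<And>x. \<psi> x = sqrt 2 *
      (\<Sum>k=1 - int N..int N. (- 1) powi k * h (1 - k) * \<phi> (2 * x - of_int k))"
    unfolding daubechies_wavelet_def by blast
  have t\<phi>: "\<exists>C. tame UNIV C \<phi>" by (rule tame_C1 [OF CS assms(2) supp])
  have t\<psi>: "\<exists>C. tame UNIV C \<psi>"
  proof -
    have 1: "\<exists>C. tame UNIV C (\<lambda>x. \<phi> (2 * x - of_int k))" for k
      using tame_affine [OF t\<phi>, of 2 UNIV "- of_int k"] by simp
    have "\<exists>C. tame UNIV C (\<lambda>x. \<Sum>k=1 - int N..int N. (sqrt 2 * ((- 1) powi k * h (1 - k))) * \<phi> (2 * x - of_int k))"
      by (intro tame_sum 1) auto
    moreover have "\<psi> = (\<lambda>x. \<Sum>k=1 - int N..int N. (sqrt 2 * ((- 1) powi k * h (1 - k))) * \<phi> (2 * x - of_int k))"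
      by (auto simp: \<psi> sum_distrib_left mult.assoc)
    ultimately show ?thesis by simp
  qed
  have t\<phi>': "\<exists>C. tame UNIV C (\<lambda>x. \<phi> (1 - x))"
    using tame_affine [OF t\<phi>, of "-1" UNIV 1] by simp
  from edges have e: "left_edge_scaling N \<phi> \<phi>L" "left_edge_wavelet N \<phi> \<phi>L \<psi>L"
     "left_edge_scaling N (\<lambda>x. \<phi> (1 - x)) (\<lambda>k x. \<phi>R k (- x))"
     "left_edge_wavelet N (\<lambda>x. \<phi> (1 - x)) (\<lambda>k x. \<phi>R k (- x)) (\<lambda>k x. \<psi>R k (- x))"
    by (auto simp: CDV_edges_def)
  have t\<phi>L: "\<exists>C. tame {0..} C (\<phi>L k)" if "k < N" for k
    by (rule tame_left_edge_scaling [OF e(1) t\<phi> that])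
  have t\<psi>L: "\<exists>C. tame {0..} C (\<psi>L k)" if "k < N" for k
    by (rule tame_left_edge_wavelet [OF e(2) t\<phi> t\<phi>L that])
  have t\<phi>R': "\<exists>C. tame {0..} C (\<lambda>x. \<phi>R k (- x))" if "k < N" for k
    by (rule tame_left_edge_scaling [OF e(3) t\<phi>' that])
  have t\<psi>R': "\<exists>C. tame {0..} C (\<lambda>x. \<psi>R k (- x))" if "k < N" for k
    by (rule tame_left_edge_wavelet [OF e(4) t\<phi>' t\<phi>R' that])
  obtain C1 where C1: "0 \<le> C1" "\<forall>f\<in>{\<phi>, \<psi>}. tame UNIV C1 f"
    using tame_common_constant [of "{\<phi>, \<psi>}" UNIV "\<lambda>f. f"] t\<phi> t\<psi> by auto
  obtain C2 where C2: "0 \<le> C2" "\<forall>k\<in>{..<N}. tame {0..} C2 (\<phi>L k)"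
    using tame_common_constant [of "{..<N}" "{0..}" \<phi>L] t\<phi>L by auto
  obtain C3 where C3: "0 \<le> C3" "\<forall>k\<in>{..<N}. tame {0..} C3 (\<psi>L k)"
    using tame_common_constant [of "{..<N}" "{0..}" \<psi>L] t\<psi>L by auto
  obtain C4 where C4: "0 \<le> C4" "\<forall>k\<in>{..<N}. tame {..0} C4 (\<phi>R k)"
    using tame_common_constant [of "{..<N}" "{..0}" \<phi>R] tame_reflect [OF t\<phi>R'] by auto
  obtain C5 where C5: "0 \<le> C5" "\<forall>k\<in>{..<N}. tame {..0} C5 (\<psi>R k)"
    using tame_common_constant [of "{..<N}" "{..0}" \<psi>R] tame_reflect [OF t\<psi>R'] by auto
  define K0 where "K0 = 1 + C1 + C2 + C3 + C4 + C5"
  have le: "C1 \<le> K0" "C2 \<le> K0" "C3 \<le> K0" "C4 \<le> K0" "C5 \<le> K0"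
    using C1(1) C2(1) C3(1) C4(1) C5(1) by (auto simp: K0_def)
  have T: "tame UNIV K0 \<phi>" "tame UNIV K0 \<psi>"
    "\<And>k. k < N \<Longrightarrow> tame {0..} K0 (\<phi>L k)" "\<And>k. k < N \<Longrightarrow> tame {0..} K0 (\<psi>L k)"
    "\<And>k. k < N \<Longrightarrow> tame {..0} K0 (\<phi>R k)" "\<And>k. k < N \<Longrightarrow> tame {..0} K0 (\<psi>R k)"
    using C1(2) C2(2) C3(2) C4(2) C5(2) le by (auto intro: tame_mono)
  have K0: "1 \<le> K0" using C1(1) C2(1) C3(1) C4(1) C5(1) by (simp add: K0_def)
  define K where "K = K0 + real N"
  have K: "1 \<le> K" "K0 \<le> K" using K0 by (auto simp: K_def)
  have K1: "K0 * 2 powr (real j / 2) \<le> K * 2 powr (real j / 2)" for j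
    using K by (intro mult_right_mono) auto
  have K2: "K0 * 2 powr (real j / 2) * 2 ^ j * \<bar>x - y\<bar> \<le> K * 2 powr (real j / 2) * 2 ^ j * \<bar>x - y\<bar>"
    for j and x y :: real
    using K by (intro mult_right_mono) auto
  have big: "2 * N \<le> 2 ^ j" if "J \<le> j" for j
    using NJ power_increasing [OF that, of "2::nat"] by linarith
  have "\<exists>f fL fR. tame UNIV K0 f \<and> (\<forall>k<N. tame {0..} K0 (fL k)) \<and> (\<forall>k<N. tame {..0} K0 (fR k)) \<and>
      2 * N \<le> 2 ^ lev J i \<and> pos i < 2 ^ lev J i \<and>
      (\<forall>x\<in>{0..1}. basis_fun phi psi i x = level_function N f fL fR (lev J i) (pos i) x)"
    if "i \<in> indices J" for i
  proof (cases i)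
    case (Inl m)
    then show ?thesis using that T NJ phi
      by (intro exI [of _ \<phi>] exI [of _ \<phi>L] exI [of _ \<phi>R])
        (auto simp: indices_def lev_def pos_def basis_fun_def)
  next
    case (Inr p)
    then show ?thesis using that T big psi
      by (intro exI [of _ \<psi>] exI [of _ \<psi>L] exI [of _ \<psi>R])
        (auto simp: indices_def lev_def pos_def basis_fun_def)
  qed
  then have ex: "\<exists>f fL fR. tame UNIV K0 f \<and> (\<forall>k<N. tame {0..} K0 (fL k)) \<and> (\<forall>k<N. tame {..0} K0 (fR k)) \<and>
      2 * N \<le> 2 ^ lev J i \<and> pos i < 2 ^ lev J i \<and>
      (\<forall>x\<in>{0..1}. basis_fun phi psi i x = level_function N f fL fR (lev J i) (pos i) x)"
    if "i \<in> indices J" for i using that by blast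
  have "regular_basis J phi psi K"
  proof
    show "1 \<le> K" by fact
    show "L2_orthonormal_basis (indices J) (basis_fun phi psi)"
      using onb by (simp add: indices_def basis_fun_def)
  next
    fix i x assume i: "i \<in> indices J" and x: "x \<in> {0..1::real}"
    from ex [OF i] obtain f fL fR where f: "tame UNIV K0 f" "\<forall>k<N. tame {0..} K0 (fL k)"
      "\<forall>k<N. tame {..0} K0 (fR k)" and ij: "2 * N \<le> 2 ^ lev J i" "pos i < 2 ^ lev J i"
      and eq: "\<And>x. x \<in> {0..1} \<Longrightarrow> basis_fun phi psi i x = level_function N f fL fR (lev J i) (pos i) x"
      by blast
    note R = level_function_regular [OF f ij x, folded eq [OF x]]
    show "\<bar>basis_fun phi psi i x\<bar> \<le> K * 2 powr (real (lev J i) / 2)"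
      using R(1) K1 by (rule order_trans)
    show "\<bar>basis_fun phi psi i x - basis_fun phi psi i y\<bar>
        \<le> K * 2 powr (real (lev J i) / 2) * 2 ^ lev J i * \<bar>x - y\<bar>" if y: "y \<in> {0..1}" for y
      using R(2) [OF y, folded eq [OF y]] K2 by (rule order_trans)
    assume "basis_fun phi psi i x \<noteq> 0"
    from R(3) [OF this] show "\<bar>2 ^ lev J i * x - real (pos i)\<bar> \<le> K" by (simp add: K_def)
  qed
  then show ?thesis ..
qed

section \<open>Wavelet series of smooth functions\<close>

lemma card_nat_near_le:
  assumes "0 \<le> R"
  shows "finite {m::nat. \<bar>a - real m\<bar> \<le> R}" "real (card {m::nat. \<bar>a - real m\<bar> \<le> R}) \<le> 2 * R + 1"
proof -
  have sub: "int ` {m::nat. \<bar>a - real m\<bar> \<le> R} \<subseteq> {\<lceil>a - R\<rceil>..\<lfloor>a + R\<rfloor>}"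
    by (auto simp: ceiling_le_iff le_floor_iff abs_le_iff algebra_simps)
  then show "finite {m::nat. \<bar>a - real m\<bar> \<le> R}"
    by (metis finite_imageD finite_subset finite_atLeastAtMost_int inj_on_of_nat)
  have "card {m::nat. \<bar>a - real m\<bar> \<le> R} = card (int ` {m::nat. \<bar>a - real m\<bar> \<le> R})"
    by (simp add: card_image)
  also have "\<dots> \<le> card {\<lceil>a - R\<rceil>..\<lfloor>a + R\<rfloor>}" by (rule card_mono [OF _ sub]) simp
  also have "\<dots> = nat (\<lfloor>a + R\<rfloor> + 1 - \<lceil>a - R\<rceil>)" by simp
  finally have 1: "card {m::nat. \<bar>a - real m\<bar> \<le> R} \<le> nat (\<lfloor>a + R\<rfloor> + 1 - \<lceil>a - R\<rceil>)" .
  have "real (nat (\<lfloor>a + R\<rfloor> + 1 - \<lceil>a - R\<rceil>)) \<le> 2 * R + 1"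
  proof (cases "\<lfloor>a + R\<rfloor> + 1 - \<lceil>a - R\<rceil> \<le> 0")
    case False
    then have "real (nat (\<lfloor>a + R\<rfloor> + 1 - \<lceil>a - R\<rceil>)) = real_of_int \<lfloor>a + R\<rfloor> + 1 - real_of_int \<lceil>a - R\<rceil>"
      by simp
    also have "\<dots> \<le> (a + R) + 1 - (a - R)"
      using of_int_floor_le [of "a + R"] le_of_int_ceiling [of "a - R"] by linarith
    finally show ?thesis by simp
  qed (use assms in simp)
  with 1 show "real (card {m::nat. \<bar>a - real m\<bar> \<le> R}) \<le> 2 * R + 1" by linarith
qed

lemma set_integral_continuous:
  fixes f :: "real \<Rightarrow> real"
  assumes "continuous_on {0..1} f"
  shows "(LBINT x:{0..1}. f x) = integral {0..1} f"
  by (rule set_borel_integral_eq_integral(2)) (rule borel_integrable_atLeastAtMost' [OF assms])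

lemma L2_inner_continuous:
  assumes "continuous_on {0..1} f" "continuous_on {0..1} g"
  shows "L2_inner f g = integral {0..1} (\<lambda>x. f x * g x)"
  unfolding L2_inner_def by (rule set_integral_continuous) (intro continuous_intros assms)

lemma L2_inner_diff:
  assumes "continuous_on {0..1} f" "continuous_on {0..1} g" "continuous_on {0..1} h"
  shows "L2_inner f (\<lambda>x. g x - h x) = L2_inner f g - L2_inner f h"
proof -
  have "L2_inner f (\<lambda>x. g x - h x) = integral {0..1} (\<lambda>x. f x * g x - f x * h x)"
    using assms by (subst L2_inner_continuous) (auto intro!: continuous_intros simp: right_diff_distrib)
  also have "\<dots> = integral {0..1} (\<lambda>x. f x * g x) - integral {0..1} (\<lambda>x. f x * h x)"
    using assms by (intro integral_diff integrable_continuous_interval continuous_intros)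
  finally show ?thesis using assms by (simp add: L2_inner_continuous)
qed

lemma L2_inner_sum:
  assumes "finite F" "continuous_on {0..1} f" "\<And>i. i \<in> F \<Longrightarrow> continuous_on {0..1} (g i)"
  shows "L2_inner f (\<lambda>x. \<Sum>i\<in>F. c i * g i x) = (\<Sum>i\<in>F. c i * L2_inner f (g i))"
proof -
  have "L2_inner f (\<lambda>x. \<Sum>i\<in>F. c i * g i x) = integral {0..1} (\<lambda>x. \<Sum>i\<in>F. c i * (f x * g i x))"
    using assms by (subst L2_inner_continuous)
      (auto intro!: continuous_intros simp: sum_distrib_left algebra_simps)
  also have "\<dots> = (\<Sum>i\<in>F. integral {0..1} (\<lambda>x. c i * (f x * g i x)))"
    using assms by (intro integral_sum integrable_continuous_interval continuous_intros) auto
  also have "\<dots> = (\<Sum>i\<in>F. c i * L2_inner f (g i))"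
    using assms by (intro sum.cong refl) (simp add: L2_inner_continuous)
  finally show ?thesis .
qed

lemma L2_inner_commute: "L2_inner f g = L2_inner g f"
  by (simp add: L2_inner_def mult.commute)

lemma finite_level: "finite {i \<in> indices J. lev J i = l}"
  and card_level: "card {i \<in> indices J. lev J i = l} \<le> 2 * 2 ^ l"
proof -
  have sub: "{i \<in> indices J. lev J i = l} \<subseteq> Inl ` {..<2 ^ l} \<union> (\<lambda>m. Inr (l, m)) ` {..<2 ^ l}"
    by (auto simp: indices_def lev_def)
  then show "finite {i \<in> indices J. lev J i = l}" by (rule finite_subset) auto
  have "card {i \<in> indices J. lev J i = l} \<le>
      card ((Inl ` {..<2 ^ l} :: index set) \<union> (\<lambda>m. Inr (l, m)) ` {..<2 ^ l})"
    by (rule card_mono [OF _ sub]) auto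
  also have "\<dots> \<le> card ((Inl ` {..<2 ^ l} :: index set)) + card ((\<lambda>m. Inr (l, m)) ` {..<2 ^ l} :: index set)"
    by (rule card_Un_le)
  also have "\<dots> \<le> 2 ^ l + 2 ^ l"
    by (intro add_mono order_trans [OF card_image_le]) auto
  finally show "card {i \<in> indices J. lev J i = l} \<le> 2 * 2 ^ l" by simp
qed

definition indices_between :: "nat \<Rightarrow> nat \<Rightarrow> nat \<Rightarrow> index set" where
  "indices_between J p q = {i \<in> indices J. p \<le> lev J i \<and> lev J i < q}"

lemma indices_between_eq: "indices_between J p q = (\<Union>l\<in>{p..<q}. {i \<in> indices J. lev J i = l})"
  by (auto simp: indices_between_def)

lemma finite_indices_between [simp]: "finite (indices_between J p q)"
  unfolding indices_between_eq by (intro finite_UN_I finite_level) auto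

lemma sum_indices_between:
  "(\<Sum>i\<in>indices_between J p q. f i) = (\<Sum>l=p..<q. \<Sum>i\<in>{i \<in> indices J. lev J i = l}. f i)"
  unfolding indices_between_eq by (subst sum.UNION_disjoint) (auto simp: finite_level)

text \<open>
  The bound does not depend on the upper end of the sum and so passes to the limit.
\<close>

lemma geometric_tail:
  fixes t :: real
  assumes "0 < t"
  shows "(\<Sum>l=p..<q. 2 powr (- (real l * t))) \<le> 2 powr (- (real p * t)) / (1 - 2 powr (- t))"
proof (cases "p \<le> q")
  case True
  have less: "(2::real) powr (- t) < 1" using powr_less_mono [of "- t" 0 2] assms by simp
  have "(\<Sum>l=p..<q. 2 powr (- (real l * t))) = (\<Sum>l=0 + p..<(q - p) + p. (2 powr (- t)) ^ l)"
    using True by (intro sum.cong) (auto simp: powr_realpow [symmetric] powr_powr mult.commute)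
  also have "\<dots> = (2 powr (- t)) ^ p * (\<Sum>l=0..<q - p. (2 powr (- t)) ^ l)"
    by (subst sum.shift_bounds_nat_ivl) (simp add: power_add sum_distrib_left mult.commute)
  also have "\<dots> \<le> (2 powr (- t)) ^ p * (1 / (1 - 2 powr (- t)))"
  proof (rule mult_left_mono)
    have "(\<Sum>l=0..<q - p. (2 powr (- t)) ^ l) = (1 - (2 powr (- t)) ^ (q - p)) / (1 - 2 powr (- t))"
      using less assms by (simp add: atLeast0LessThan sum_gp_strict)
    also have "\<dots> \<le> 1 / (1 - 2 powr (- t))"
      using less by (intro divide_right_mono) auto
    finally show "(\<Sum>l=0..<q - p. (2 powr (- t)) ^ l) \<le> 1 / (1 - 2 powr (- t))" .
  qed simp
  also have "(2 powr (- t)) ^ p = 2 powr (- (real p * t))"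
    by (simp add: powr_realpow [symmetric] powr_powr mult.commute)
  finally show ?thesis by simp
next
  case False
  have "(2::real) powr (- t) < 1" using powr_less_mono [of "- t" 0 2] assms by simp
  with False show ?thesis by simp
qed

context regular_basis
begin

abbreviation "I \<equiv> indices J"
abbreviation "e \<equiv> basis_fun phi psi"
abbreviation "\<l> \<equiv> lev J"

definition coef :: "(real \<Rightarrow> real) \<Rightarrow> index \<Rightarrow> real" where
  "coef f i = L2_inner (e i) f"

lemma continuous_e: "i \<in> I \<Longrightarrow> continuous_on {0..1} (e i)"
proof -
  assume i: "i \<in> I"
  show ?thesis
    by (rule lipschitz_on_continuous_on [where L = "K * 2 powr (real (\<l> i) / 2) * 2 ^ \<l> i"],
        rule lipschitz_onI)
      (use basis_lipschitz [OF i] K_ge_1 in \<open>auto simp: dist_real_def\<close>)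
qed

lemma coef_e: "i \<in> I \<Longrightarrow> k \<in> I \<Longrightarrow> coef (e k) i = (if i = k then 1 else 0)"
  using onb by (simp add: coef_def L2_orthonormal_basis_def)

lemma coef_sum:
  assumes "finite F" "F \<subseteq> I" "i \<in> I"
  shows "coef (\<lambda>x. \<Sum>k\<in>F. c k * e k x) i = (if i \<in> F then c i else 0)"
proof -
  have "coef (\<lambda>x. \<Sum>k\<in>F. c k * e k x) i = (\<Sum>k\<in>F. c k * coef (e k) i)"
    unfolding coef_def using assms by (intro L2_inner_sum continuous_e) auto
  also have "\<dots> = (\<Sum>k\<in>F. if k = i then c i else 0)"
    using assms by (intro sum.cong refl) (auto simp: coef_e)
  finally show ?thesis using assms(1) by simp
qed

lemma coef_diff:
  "i \<in> I \<Longrightarrow> continuous_on {0..1} f \<Longrightarrow> continuous_on {0..1} g \<Longrightarrow>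
    coef (\<lambda>x. f x - g x) i = coef f i - coef g i"
  unfolding coef_def by (intro L2_inner_diff continuous_e)

lemma continuous_partial: "F \<subseteq> I \<Longrightarrow> continuous_on {0..1} (\<lambda>x. \<Sum>k\<in>F. c k * e k x)"
  by (intro continuous_intros continuous_e) auto

text \<open>
  Supports have radius at most K in units of the grid of their level, so boundedly many of them meet
  at a point.
\<close>

lemma active_count:
  assumes "x \<in> {0..1}"
  shows "real (card {i \<in> I. \<l> i = l \<and> e i x \<noteq> 0}) \<le> 6 * K"
proof -
  let ?A = "{m::nat. \<bar>2 ^ l * x - real m\<bar> \<le> K}"
  note A = card_nat_near_le [of K "2 ^ l * x"]
  have fin: "finite ?A" using A K_ge_1 by simp
  have "{i \<in> I. \<l> i = l \<and> e i x \<noteq> 0} \<subseteq> Inl ` ?A \<union> (\<lambda>m. Inr (l, m)) ` ?A"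
    using basis_support [OF _ assms] by (force simp: indices_def lev_def pos_def)
  then have "card {i \<in> I. \<l> i = l \<and> e i x \<noteq> 0} \<le> card (Inl ` ?A \<union> (\<lambda>m. Inr (l, m)) ` ?A :: index set)"
    using fin by (intro card_mono) auto
  also have "\<dots> \<le> card (Inl ` ?A :: index set) + card ((\<lambda>m. Inr (l, m)) ` ?A :: index set)"
    by (rule card_Un_le)
  also have "\<dots> \<le> card ?A + card ?A"
    using fin by (intro add_mono card_image_le)
  finally have "real (card {i \<in> I. \<l> i = l \<and> e i x \<noteq> 0}) \<le> 2 * real (card ?A)" by linarith
  also have "\<dots> \<le> 2 * (2 * K + 1)" using A K_ge_1 by simp
  also have "\<dots> \<le> 6 * K" using K_ge_1 by simp
  finally show ?thesis .
qed

lemma level_abs_sum_le: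
  assumes "x \<in> {0..1}"
  shows "(\<Sum>i\<in>{i \<in> I. \<l> i = l}. \<bar>e i x\<bar>) \<le> 6 * K\<^sup>2 * 2 powr (real l / 2)"
proof -
  have "(\<Sum>i\<in>{i \<in> I. \<l> i = l}. \<bar>e i x\<bar>) = (\<Sum>i\<in>{i \<in> I. \<l> i = l \<and> e i x \<noteq> 0}. \<bar>e i x\<bar>)"
    by (rule sum.mono_neutral_right) (auto simp: finite_level)
  also have "\<dots> \<le> (\<Sum>i\<in>{i \<in> I. \<l> i = l \<and> e i x \<noteq> 0}. K * 2 powr (real l / 2))"
    using basis_bound assms by (intro sum_mono) auto
  also have "\<dots> = real (card {i \<in> I. \<l> i = l \<and> e i x \<noteq> 0}) * (K * 2 powr (real l / 2))" by simp
  also have "\<dots> \<le> 6 * K * (K * 2 powr (real l / 2))"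
    using active_count [OF assms] K_ge_1 by (intro mult_right_mono) auto
  finally show ?thesis by (simp add: power2_eq_square mult.assoc)
qed

text \<open>
  Bounded overlap reduces the supremum norm of each level to a bound on its coefficients, multiplied
  by 2^(l/2).
\<close>

lemma level_sum_bound:
  assumes "x \<in> {0..1}" and a: "\<And>i. i \<in> I \<Longrightarrow> p \<le> \<l> i \<Longrightarrow> \<l> i < q \<Longrightarrow> \<bar>a i\<bar> \<le> A (\<l> i)"
    and A0: "\<And>l. 0 \<le> A l"
  shows "\<bar>\<Sum>i\<in>indices_between J p q. a i * e i x\<bar> \<le> 6 * K\<^sup>2 * (\<Sum>l=p..<q. A l * 2 powr (real l / 2))"
proof -
  have "\<bar>\<Sum>i\<in>indices_between J p q. a i * e i x\<bar> \<le> (\<Sum>i\<in>indices_between J p q. \<bar>a i\<bar> * \<bar>e i x\<bar>)"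
    by (rule order_trans [OF sum_abs]) (simp add: abs_mult)
  also have "\<dots> = (\<Sum>l=p..<q. \<Sum>i\<in>{i \<in> I. \<l> i = l}. \<bar>a i\<bar> * \<bar>e i x\<bar>)"
    by (rule sum_indices_between)
  also have "\<dots> \<le> (\<Sum>l=p..<q. A l * (6 * K\<^sup>2 * 2 powr (real l / 2)))"
  proof (rule sum_mono)
    fix l assume l: "l \<in> {p..<q}"
    have "(\<Sum>i\<in>{i \<in> I. \<l> i = l}. \<bar>a i\<bar> * \<bar>e i x\<bar>) \<le> (\<Sum>i\<in>{i \<in> I. \<l> i = l}. A l * \<bar>e i x\<bar>)"
      using a l by (intro sum_mono mult_right_mono) auto
    also have "\<dots> = A l * (\<Sum>i\<in>{i \<in> I. \<l> i = l}. \<bar>e i x\<bar>)" by (simp add: sum_distrib_left)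
    also have "\<dots> \<le> A l * (6 * K\<^sup>2 * 2 powr (real l / 2))"
      using A0 level_abs_sum_le [OF assms(1)] by (intro mult_left_mono) auto
    finally show "(\<Sum>i\<in>{i \<in> I. \<l> i = l}. \<bar>a i\<bar> * \<bar>e i x\<bar>) \<le> A l * (6 * K\<^sup>2 * 2 powr (real l / 2))" .
  qed
  also have "\<dots> = 6 * K\<^sup>2 * (\<Sum>l=p..<q. A l * 2 powr (real l / 2))"
    by (simp add: sum_distrib_left mult_ac)
  finally show ?thesis .
qed


text \<open>
  A function h that is orthogonal to the basis is orthogonal to its own approximants p, so the
  integral of h^2 is at most that of (h - p)^2, which is arbitrarily small.
\<close>

lemma zero_if_coef_zero:
  assumes h: "continuous_on {0..1} h" and zero: "\<And>i. i \<in> I \<Longrightarrow> coef h i = 0" and x: "x \<in> {0..1}"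
  shows "h x = 0"
proof -
  have "in_L2 h"
  proof -
    have "set_integrable lborel {0..1} h" "set_integrable lborel {0..1} (\<lambda>x. (h x)\<^sup>2)"
      by (auto intro!: borel_integrable_atLeastAtMost' continuous_intros h)
    then show ?thesis by (auto simp: in_L2_def set_borel_measurable_def set_integrable_def)
  qed
  have small: "integral {0..1} (\<lambda>x. (h x)\<^sup>2) < \<epsilon>" if "0 < \<epsilon>" for \<epsilon>
  proof -
    from onb \<open>in_L2 h\<close> that obtain F c where F: "finite F" "F \<subseteq> I"
      and less: "(LBINT x:{0..1}. (h x - (\<Sum>i\<in>F. c i * e i x))\<^sup>2) < \<epsilon>"
      unfolding L2_orthonormal_basis_def by blast
    define p where "p x = (\<Sum>i\<in>F. c i * e i x)" for x
    have p: "continuous_on {0..1} p" unfolding p_def using F by (rule_tac continuous_partial)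
    have int: "(\<lambda>x. u x * v x) integrable_on {0..1}"
      if "continuous_on {0..1} u" "continuous_on {0..1} v" for u v :: "real \<Rightarrow> real"
      by (intro integrable_continuous_interval continuous_intros that)
    have "integral {0..1} (\<lambda>x. h x * p x) = L2_inner h p"
      using h p by (simp add: L2_inner_continuous)
    also have "\<dots> = (\<Sum>i\<in>F. c i * L2_inner h (e i))"
      unfolding p_def using F h by (intro L2_inner_sum continuous_e) auto
    also have "\<dots> = 0"
      using zero F by (intro sum.neutral) (auto simp: coef_def L2_inner_commute)
    finally have hp: "integral {0..1} (\<lambda>x. h x * p x) = 0" .
    have "integral {0..1} (\<lambda>x. (h x - p x)\<^sup>2) =
        integral {0..1} (\<lambda>x. (h x * h x - 2 * (h x * p x)) + p x * p x)"
      by (simp add: power2_eq_square algebra_simps)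
    also have "\<dots> = integral {0..1} (\<lambda>x. h x * h x - 2 * (h x * p x)) + integral {0..1} (\<lambda>x. p x * p x)"
      by (intro integral_add integrable_diff integrable_on_mult_right int h p)
    also have "integral {0..1} (\<lambda>x. h x * h x - 2 * (h x * p x)) =
        integral {0..1} (\<lambda>x. h x * h x) - integral {0..1} (\<lambda>x. 2 * (h x * p x))"
      by (intro integral_diff integrable_on_mult_right int h p)
    also have "integral {0..1} (\<lambda>x. 2 * (h x * p x)) = 0" by (simp add: hp)
    finally have "integral {0..1} (\<lambda>x. (h x - p x)\<^sup>2) =
        integral {0..1} (\<lambda>x. h x * h x) + integral {0..1} (\<lambda>x. p x * p x)" by simp
    moreover have "0 \<le> integral {0..1} (\<lambda>x. p x * p x)"
      by (intro integral_nonneg int p) auto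
    moreover have "integral {0..1} (\<lambda>x. (h x - p x)\<^sup>2) < \<epsilon>"
      using less unfolding p_def [symmetric]
      by (subst (asm) set_integral_continuous) (auto intro!: continuous_intros h p)
    ultimately show ?thesis by (simp add: power2_eq_square)
  qed
  have int: "(\<lambda>x. (h x)\<^sup>2) integrable_on {0..1}"
    by (intro integrable_continuous_interval continuous_intros h)
  have "0 \<le> integral {0..1} (\<lambda>x. (h x)\<^sup>2)" by (intro integral_nonneg int) auto
  with small [of "integral {0..1} (\<lambda>x. (h x)\<^sup>2)"] have "integral {0..1} (\<lambda>x. (h x)\<^sup>2) = 0"
    by fastforce
  with int have "((\<lambda>x. (h x)\<^sup>2) has_integral 0) (cbox 0 1)"
    by (metis cbox_interval integrable_integral)
  from has_integral_0_cbox_imp_0 [OF _ _ this] have "(h x)\<^sup>2 = 0"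
    using x by (auto intro!: continuous_intros h)
  then show ?thesis by simp
qed

text \<open>
  The L1 norm of a basis function of level l is at most its size times its width, of order 2^(-l/2).
  Read contrapositively, a large coefficient forces a large supremum norm.
\<close>

lemma coef_bound:
  assumes i: "i \<in> I" and h: "continuous_on {0..1} h" and H: "\<And>x. x \<in> {0..1} \<Longrightarrow> \<bar>h x\<bar> \<le> H"
  shows "\<bar>coef h i\<bar> \<le> 2 * K\<^sup>2 * H * 2 powr (- (real (\<l> i) / 2))"
proof -
  define l where "l = \<l> i"
  define c d where "c = (real (pos i) - K) / 2 ^ l" and "d = (real (pos i) + K) / 2 ^ l"
  have cd: "c \<le> d" using K_ge_1 by (simp add: c_def d_def divide_right_mono)
  have H0: "0 \<le> H" using H [of 0] by auto
  define M where "M = K * 2 powr (real l / 2) * H"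
  have M0: "0 \<le> M" using H0 K_ge_1 by (simp add: M_def)
  have pw: "norm (e i x * h x) \<le> M * indicator {c..d} x" if x: "x \<in> {0..1}" for x
  proof (cases "e i x = 0")
    case False
    from basis_support [OF i x this] have "x \<in> {c..d}"
      by (auto simp: c_def d_def l_def [symmetric] field_simps abs_le_iff)
    moreover have "\<bar>e i x\<bar> * \<bar>h x\<bar> \<le> M"
      unfolding M_def l_def using basis_bound [OF i x] H [OF x] by (intro mult_mono) auto
    ultimately show ?thesis by (simp add: abs_mult)
  qed (use M0 in simp)
  have indint: "((\<lambda>x. M * indicator {c..d} x) has_integral M * (d - c)) UNIV"
  proof (rule has_integral_mult_right)
    have "((\<lambda>x. 1::real) has_integral (d - c)) {c..d}"
      using has_integral_const_real [of "1::real" c d] cd by simp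
    then show "(indicator {c..d} has_integral d - c) UNIV"
      by (subst (asm) has_integral_restrict_UNIV [symmetric]) (simp add: indicator_def [abs_def] of_bool_def)
  qed
  have int01: "(\<lambda>x. M * indicator {c..d} x) integrable_on {0..1}"
    by (rule integrable_on_subinterval [of _ "UNIV", where 'a = real]) (use indint in \<open>auto simp: integrable_on_def\<close>)
  have "\<bar>coef h i\<bar> = norm (integral {0..1} (\<lambda>x. e i x * h x))"
    unfolding coef_def using i h by (subst L2_inner_continuous) (auto intro: continuous_e)
  also have "\<dots> \<le> integral {0..1} (\<lambda>x. M * indicator {c..d} x)"
    using pw by (intro integral_norm_bound_integral integrable_continuous_interval continuous_intros
       continuous_e h i int01) auto
  also have "\<dots> \<le> integral UNIV (\<lambda>x. M * indicator {c..d} x)"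
    using indint M0 by (intro integral_subset_le int01) (auto simp: integrable_on_def)
  also have "\<dots> = M * (d - c)" using indint by (rule integral_unique)
  also have "\<dots> = 2 * K\<^sup>2 * H * (2 powr (real l / 2) / 2 ^ l)"
    by (simp add: M_def c_def d_def field_simps power2_eq_square)
  also have "(2::real) powr (real l / 2) / 2 ^ l = 2 powr (- (real l / 2))"
    by (simp add: powr_realpow [symmetric] powr_diff [symmetric])
  finally show ?thesis by (simp add: l_def)
qed


definition partial :: "(real \<Rightarrow> real) \<Rightarrow> nat \<Rightarrow> real \<Rightarrow> real" where
  "partial f j x = (\<Sum>i\<in>indices_between J 0 j. coef f i * e i x)"

text \<open>
  The decay of coefficients that characterises \<Sigma>(t), with one constant W for wavelets and scaling
  functions.
\<close>

definition smooth :: "real \<Rightarrow> real \<Rightarrow> (real \<Rightarrow> real) \<Rightarrow> bool" where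
  "smooth W t f \<longleftrightarrow> continuous_on {0..1} f \<and>
     (\<forall>i\<in>I. \<bar>coef f i\<bar> \<le> W * 2 powr (- (real (\<l> i) * (t + 1 / 2))))"

lemma indices_between_subset: "indices_between J p q \<subseteq> I"
  by (auto simp: indices_between_def)

lemma level_weight: "2 powr (- (real l * (t + 1 / 2))) * 2 powr (real l / 2) = (2::real) powr (- (real l * t))"
  by (simp add: powr_add [symmetric] algebra_simps)

lemma tail_sum_bound:
  assumes t: "0 < t" and W: "0 \<le> W" and x: "x \<in> {0..1}"
    and a: "\<And>i. i \<in> I \<Longrightarrow> p \<le> \<l> i \<Longrightarrow> \<bar>a i\<bar> \<le> W * 2 powr (- (real (\<l> i) * (t + 1 / 2)))"
  shows "\<bar>\<Sum>i\<in>indices_between J p q. a i * e i x\<bar> \<le> 6 * K\<^sup>2 * W / (1 - 2 powr (- t)) * 2 powr (- (real p * t))"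
proof -
  have "\<bar>\<Sum>i\<in>indices_between J p q. a i * e i x\<bar> \<le>
      6 * K\<^sup>2 * (\<Sum>l=p..<q. W * 2 powr (- (real l * (t + 1 / 2))) * 2 powr (real l / 2))"
    using a W by (intro level_sum_bound x) auto
  also have "\<dots> = 6 * K\<^sup>2 * W * (\<Sum>l=p..<q. 2 powr (- (real l * t)))"
    by (simp only: mult.assoc level_weight sum_distrib_left)
  also have "\<dots> \<le> 6 * K\<^sup>2 * W * (2 powr (- (real p * t)) / (1 - 2 powr (- t)))"
    using W by (intro mult_left_mono geometric_tail t) auto
  finally show ?thesis by simp
qed

lemma partial_diff:
  assumes "p \<le> q"
  shows "partial f q x - partial f p x = (\<Sum>i\<in>indices_between J p q. coef f i * e i x)"
proof -
  have "indices_between J 0 q = indices_between J 0 p \<union> indices_between J p q"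
    using assms by (auto simp: indices_between_def)
  moreover have "indices_between J 0 p \<inter> indices_between J p q = {}"
    by (auto simp: indices_between_def)
  ultimately show ?thesis by (simp add: partial_def sum.union_disjoint)
qed

lemma continuous_partial': "continuous_on {0..1} (partial f j)"
  unfolding partial_def by (intro continuous_partial indices_between_subset)

text \<open>
  The partial sums form a uniform Cauchy sequence. Their limit is continuous and has the same
  coefficients as f, hence equals f by completeness; the geometric tail then gives the error.
\<close>

lemma wavelet_approximation:
  assumes f: "smooth W t f" and t: "0 < t" and W: "0 \<le> W" and x: "x \<in> {0..1}"
  shows "\<bar>f x - partial f p x\<bar> \<le> 6 * K\<^sup>2 * W / (1 - 2 powr (- t)) * 2 powr (- (real p * t))"
proof -
  define D where "D = 6 * K\<^sup>2 * W / (1 - 2 powr (- t))"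
  have less: "(2::real) powr (- t) < 1" using powr_less_mono [of "- t" 0 2] t by simp
  have D0: "0 \<le> D" using less W by (simp add: D_def)
  have cauchy: "\<bar>partial f q x - partial f p x\<bar> \<le> D * 2 powr (- (real p * t))"
    if "p \<le> q" "x \<in> {0..1}" for p q x
    unfolding D_def partial_diff [OF that(1)]
    using f by (intro tail_sum_bound t W that) (auto simp: smooth_def)
  have null: "(\<lambda>p. D * 2 powr (- (real p * t))) \<longlonglongrightarrow> 0"
  proof -
    have "(\<lambda>p. (2 powr (- t)) ^ p) \<longlonglongrightarrow> (0::real)" using less by (intro LIMSEQ_power_zero) simp
    then have "(\<lambda>p. D * (2 powr (- t)) ^ p) \<longlonglongrightarrow> D * 0" by (intro tendsto_mult tendsto_const)
    then show ?thesis by (simp add: powr_realpow [symmetric] powr_powr mult.commute)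
  qed
  have "uniformly_convergent_on {0..1} (\<lambda>j x. partial f j x)"
  proof (rule Cauchy_uniformly_convergent, rule uniformly_Cauchy_onI')
    fix \<epsilon> :: real assume "0 < \<epsilon>"
    with null have "\<forall>\<^sub>F p in sequentially. D * 2 powr (- (real p * t)) < \<epsilon>" by (rule order_tendstoD)
    then obtain P where P: "\<And>p. P \<le> p \<Longrightarrow> D * 2 powr (- (real p * t)) < \<epsilon>"
      by (auto simp: eventually_sequentially)
    show "\<exists>M. \<forall>x\<in>{0..1}. \<forall>m\<ge>M. \<forall>n>m. dist (partial f m x) (partial f n x) < \<epsilon>"
    proof (intro exI [of _ P] ballI allI impI)
      fix x m n assume "x \<in> {0..1::real}" "P \<le> m" "m < n"
      then show "dist (partial f m x) (partial f n x) < \<epsilon>"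
        using cauchy [of m n x] P [of m] by (simp add: dist_real_def abs_minus_commute)
    qed
  qed
  then obtain g where g: "uniform_limit {0..1} (partial f) g sequentially"
    by (auto simp: uniformly_convergent_on_def)
  have contg: "continuous_on {0..1} g"
    by (rule uniform_limit_theorem [OF _ g]) (auto intro: continuous_partial' always_eventually)
  have lim: "(\<lambda>q. partial f q x) \<longlonglongrightarrow> g x" if "x \<in> {0..1}" for x
    using tendsto_uniform_limitI [OF g that] .
  have near: "\<bar>g x - partial f p x\<bar> \<le> D * 2 powr (- (real p * t))" if x: "x \<in> {0..1}" for p x
  proof (rule tendsto_upperbound)
    show "(\<lambda>q. \<bar>partial f q x - partial f p x\<bar>) \<longlonglongrightarrow> \<bar>g x - partial f p x\<bar>"
      by (intro tendsto_intros lim x)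
    show "\<forall>\<^sub>F q in sequentially. \<bar>partial f q x - partial f p x\<bar> \<le> D * 2 powr (- (real p * t))"
      using cauchy [OF _ x] by (auto simp: eventually_sequentially)
  qed simp
  have contf: "continuous_on {0..1} f" using f by (simp add: smooth_def)
  have "coef (\<lambda>x. f x - g x) i = 0" if i: "i \<in> I" for i
  proof -
    let ?Q = "2 * K\<^sup>2 * 2 powr (- (real (\<l> i) / 2))"
    have "\<bar>coef g i - coef f i\<bar> \<le> ?Q * (D * 2 powr (- (real q * t)))" if q: "\<l> i < q" for q
    proof -
      have "coef (partial f q) i = coef f i"
        unfolding partial_def
        by (subst coef_sum [OF finite_indices_between indices_between_subset i])
          (use i q in \<open>simp add: indices_between_def\<close>)
      then have "coef g i - coef f i = coef (\<lambda>x. g x - partial f q x) i"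
        using i by (simp add: coef_diff contg continuous_partial')
      also have "\<bar>\<dots>\<bar> \<le> 2 * K\<^sup>2 * (D * 2 powr (- (real q * t))) * 2 powr (- (real (\<l> i) / 2))"
        using near by (intro coef_bound i continuous_intros contg continuous_partial') auto
      finally show ?thesis by (simp add: mult_ac)
    qed
    then have "\<forall>\<^sub>F q in sequentially. \<bar>coef g i - coef f i\<bar> \<le> ?Q * (D * 2 powr (- (real q * t)))"
      unfolding eventually_sequentially by (metis Suc_le_lessD)
    moreover have "(\<lambda>q. ?Q * (D * 2 powr (- (real q * t)))) \<longlonglongrightarrow> ?Q * 0"
      by (intro tendsto_mult null tendsto_const)
    ultimately have "\<bar>coef g i - coef f i\<bar> \<le> ?Q * 0"
      by (intro tendsto_lowerbound) auto
    then show ?thesis using i by (simp add: coef_diff contf contg)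
  qed
  from zero_if_coef_zero [OF _ this x] have "f x = g x"
    by (auto intro: continuous_intros contf contg)
  with near [OF x] show ?thesis by (simp add: D_def)
qed

lemma smooth_bounded:
  assumes "smooth W t f" "0 < t" "0 \<le> W" "x \<in> {0..1}"
  shows "\<bar>f x\<bar> \<le> 6 * K\<^sup>2 * W / (1 - 2 powr (- t))"
proof -
  have "indices_between J 0 0 = {}" by (auto simp: indices_between_def)
  then show ?thesis using wavelet_approximation [OF assms, of 0] by (simp add: partial_def)
qed

lemma min_le_powr:
  fixes z u :: real
  assumes "0 \<le> z" "0 < u" "u \<le> 1"
  shows "min 1 z \<le> z powr u"
proof (cases "z \<ge> 1")
  case True
  then show ?thesis using assms by (simp add: ge_one_powr_ge_zero)
next
  case False
  then show ?thesis using assms powr_mono' [of u 1 z] by (cases "z = 0") auto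
qed

text \<open>
  Interpolation between the bound on the size and the Lipschitz bound.
\<close>

lemma basis_holder:
  assumes i: "i \<in> I" and x: "x \<in> {0..1}" and y: "y \<in> {0..1}" and u: "0 < u" "u \<le> 1"
  shows "\<bar>e i x - e i y\<bar> \<le> 2 * K * 2 powr (real (\<l> i) * (u + 1 / 2)) * \<bar>x - y\<bar> powr u"
proof -
  define A where "A = 2 * K * 2 powr (real (\<l> i) / 2)"
  define z where "z = 2 ^ \<l> i * \<bar>x - y\<bar>"
  have A: "0 \<le> A" using K_ge_1 by (simp add: A_def)
  have "\<bar>e i x - e i y\<bar> \<le> A * 1"
    using basis_bound [OF i x] basis_bound [OF i y] by (simp add: A_def)
  moreover have "\<bar>e i x - e i y\<bar> \<le> A * z"
  proof -
    have "\<bar>e i x - e i y\<bar> \<le> K * 2 powr (real (\<l> i) / 2) * z"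
      using basis_lipschitz [OF i x y] by (simp add: z_def mult.assoc)
    also have "\<dots> \<le> A * z" using K_ge_1 by (intro mult_right_mono) (auto simp: A_def z_def)
    finally show ?thesis .
  qed
  ultimately have "\<bar>e i x - e i y\<bar> \<le> A * min 1 z" by (simp add: min_def)
  also have "\<dots> \<le> A * z powr u"
    using A by (intro mult_left_mono min_le_powr u) (auto simp: z_def)
  also have "z powr u = 2 powr (real (\<l> i) * u) * \<bar>x - y\<bar> powr u"
    by (simp add: z_def powr_mult powr_realpow [symmetric] powr_powr)
  also have "A * \<dots> = 2 * K * 2 powr (real (\<l> i) * (u + 1 / 2)) * \<bar>x - y\<bar> powr u"
    by (simp add: A_def powr_add distrib_left mult_ac)
  finally show ?thesis .
qed

text \<open>
  The Hoelder modulus of a basis function of level l costs a factor 2^(lu), which the decay 2^(-lt)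
  absorbs because u < t.
\<close>

lemma smooth_holder:
  assumes f: "smooth W t f" and u: "0 < u" "u \<le> 1" "u < t" and W: "0 \<le> W"
    and x: "x \<in> {0..1}" and y: "y \<in> {0..1}"
  shows "\<bar>f x - f y\<bar> \<le> 24 * K\<^sup>2 * W / (1 - 2 powr (- (t - u))) * \<bar>x - y\<bar> powr u"
proof -
  define D where "D = 24 * K\<^sup>2 * W * \<bar>x - y\<bar> powr u"
  have t: "0 < t" using u by simp
  have D0: "0 \<le> D" using W by (simp add: D_def)
  have part: "\<bar>partial f p x - partial f p y\<bar> \<le> D / (1 - 2 powr (- (t - u)))" for p
  proof -
    have "\<bar>partial f p x - partial f p y\<bar> = \<bar>\<Sum>i\<in>indices_between J 0 p. coef f i * (e i x - e i y)\<bar>"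
      by (simp add: partial_def sum_subtractf right_diff_distrib)
    also have "\<dots> \<le> (\<Sum>i\<in>indices_between J 0 p. \<bar>coef f i\<bar> * \<bar>e i x - e i y\<bar>)"
      by (rule order_trans [OF sum_abs]) (simp add: abs_mult)
    also have "\<dots> = (\<Sum>l=0..<p. \<Sum>i\<in>{i \<in> I. \<l> i = l}. \<bar>coef f i\<bar> * \<bar>e i x - e i y\<bar>)"
      by (rule sum_indices_between)
    also have "\<dots> \<le> (\<Sum>l=0..<p. D * 2 powr (- (real l * (t - u))))"
    proof (rule sum_mono)
      fix l
      let ?X = "{i \<in> I. \<l> i = l \<and> e i x \<noteq> 0}" and ?Y = "{i \<in> I. \<l> i = l \<and> e i y \<noteq> 0}"
      let ?c = "W * 2 powr (- (real l * (t + 1 / 2))) * (2 * K * 2 powr (real l * (u + 1 / 2)) * \<bar>x - y\<bar> powr u)"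
      have fin: "finite ?X" "finite ?Y" by (auto intro: finite_subset [OF _ finite_level])
      have "(\<Sum>i\<in>{i \<in> I. \<l> i = l}. \<bar>coef f i\<bar> * \<bar>e i x - e i y\<bar>) =
          (\<Sum>i\<in>?X \<union> ?Y. \<bar>coef f i\<bar> * \<bar>e i x - e i y\<bar>)"
        by (rule sum.mono_neutral_right) (auto simp: finite_level)
      also have "\<dots> \<le> (\<Sum>i\<in>?X \<union> ?Y. ?c)"
      proof (rule sum_mono)
        fix i assume "i \<in> ?X \<union> ?Y"
        then have i: "i \<in> I" "\<l> i = l" by auto
        then have "\<bar>coef f i\<bar> \<le> W * 2 powr (- (real l * (t + 1 / 2)))" using f by (auto simp: smooth_def)
        moreover have "\<bar>e i x - e i y\<bar> \<le> 2 * K * 2 powr (real l * (u + 1 / 2)) * \<bar>x - y\<bar> powr u"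
          using basis_holder [OF i(1) x y u(1,2)] i(2) by simp
        ultimately show "\<bar>coef f i\<bar> * \<bar>e i x - e i y\<bar> \<le> ?c"
          using W by (intro mult_mono) auto
      qed
      also have "\<dots> = real (card (?X \<union> ?Y)) * ?c" by simp
      also have "\<dots> \<le> (12 * K) * ?c"
      proof (rule mult_right_mono)
        have "real (card (?X \<union> ?Y)) \<le> real (card ?X) + real (card ?Y)"
          using card_Un_le [of ?X ?Y] by linarith
        then show "real (card (?X \<union> ?Y)) \<le> 12 * K"
          using active_count [OF x, of l] active_count [OF y, of l] by linarith
        show "0 \<le> ?c" using W K_ge_1 by simp
      qed
      also have "\<dots> = D * (2 powr (- (real l * (t + 1 / 2))) * 2 powr (real l * (u + 1 / 2)))"
        by (simp add: D_def power2_eq_square mult_ac)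
      also have "2 powr (- (real l * (t + 1 / 2))) * 2 powr (real l * (u + 1 / 2)) = 2 powr (- (real l * (t - u)))"
        by (simp add: powr_add [symmetric] algebra_simps)
      finally show "(\<Sum>i\<in>{i \<in> I. \<l> i = l}. \<bar>coef f i\<bar> * \<bar>e i x - e i y\<bar>) \<le> D * 2 powr (- (real l * (t - u)))" .
    qed
    also have "\<dots> = D * (\<Sum>l=0..<p. 2 powr (- (real l * (t - u))))" by (simp add: sum_distrib_left)
    also have "\<dots> \<le> D * (2 powr (- (real 0 * (t - u))) / (1 - 2 powr (- (t - u))))"
      using u D0 by (intro mult_left_mono geometric_tail) auto
    finally show ?thesis by simp
  qed
  have conv: "(\<lambda>p. partial f p z) \<longlonglongrightarrow> f z" if z: "z \<in> {0..1}" for z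
  proof -
    have "(2::real) powr (- t) < 1" using powr_less_mono [of "- t" 0 2] t by simp
    then have "(\<lambda>p. (2 powr (- t)) ^ p) \<longlonglongrightarrow> (0::real)" by (intro LIMSEQ_power_zero) simp
    then have "(\<lambda>p. 6 * K\<^sup>2 * W / (1 - 2 powr (- t)) * (2 powr (- t)) ^ p) \<longlonglongrightarrow> 6 * K\<^sup>2 * W / (1 - 2 powr (- t)) * 0"
      by (intro tendsto_mult tendsto_const)
    then have "(\<lambda>p. 6 * K\<^sup>2 * W / (1 - 2 powr (- t)) * 2 powr (- (real p * t))) \<longlonglongrightarrow> 0"
      by (simp add: powr_realpow [symmetric] powr_powr mult.commute)
    then have "(\<lambda>p. f z - partial f p z) \<longlonglongrightarrow> 0"
      by (rule Lim_null_comparison [rotated])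
        (use wavelet_approximation [OF f t W z] in \<open>auto intro: always_eventually\<close>)
    then have "(\<lambda>p. f z - (f z - partial f p z)) \<longlonglongrightarrow> f z - 0" by (intro tendsto_diff tendsto_const)
    then show ?thesis by simp
  qed
  have "(\<lambda>p. \<bar>partial f p x - partial f p y\<bar>) \<longlonglongrightarrow> \<bar>f x - f y\<bar>"
    by (intro tendsto_intros conv x y)
  then have "\<bar>f x - f y\<bar> \<le> D / (1 - 2 powr (- (t - u)))"
    by (rule tendsto_upperbound) (use part in auto)
  then show ?thesis by (simp add: D_def)
qed

end

section \<open>Discretisation at the design points\<close>

context regular_basis
begin

lemma active_design_count:
  assumes "1 \<le> n" "0 \<le> R"
  shows "real (card {k \<in> {1..n}. \<bar>2 ^ \<l> i * (real k / real n) - real (pos i)\<bar> \<le> R})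
     \<le> 2 * R * (real n / 2 ^ \<l> i) + 1"
proof -
  define q where "q = real n / 2 ^ \<l> i"
  have q: "0 < q" using assms by (simp add: q_def)
  have "{k \<in> {1..n}. \<bar>2 ^ \<l> i * (real k / real n) - real (pos i)\<bar> \<le> R} \<subseteq>
      {k. \<bar>real (pos i) * q - real k\<bar> \<le> R * q}"
  proof clarify
    fix k assume k: "\<bar>2 ^ \<l> i * (real k / real n) - real (pos i)\<bar> \<le> R"
    have "real (pos i) * q - real k = (real (pos i) - 2 ^ \<l> i * (real k / real n)) * q"
      using assms by (simp add: q_def left_diff_distrib diff_divide_distrib)
    then have "\<bar>real (pos i) * q - real k\<bar> = \<bar>(real (pos i) - 2 ^ \<l> i * (real k / real n)) * q\<bar>"
      by (rule arg_cong)
    also have "\<dots> = \<bar>2 ^ \<l> i * (real k / real n) - real (pos i)\<bar> * q"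
      using q by (simp add: abs_mult abs_minus_commute)
    also have "\<dots> \<le> R * q" using k q by (intro mult_right_mono) auto
    finally show "\<bar>real (pos i) * q - real k\<bar> \<le> R * q" .
  qed
  then have "card {k \<in> {1..n}. \<bar>2 ^ \<l> i * (real k / real n) - real (pos i)\<bar> \<le> R} \<le>
      card {k. \<bar>real (pos i) * q - real k\<bar> \<le> R * q}"
    using q assms by (intro card_mono card_nat_near_le) auto
  also have "real \<dots> \<le> 2 * (R * q) + 1"
    using q assms by (intro card_nat_near_le) auto
  finally show ?thesis by (simp add: q_def mult.assoc)
qed

text \<open>
  About n 2^(-l) design points lie in the support of a function of level l, and its square is of order
  2^l there.
\<close>

lemma design_square_sum:
  assumes i: "i \<in> I" and n: "1 \<le> n" "2 ^ \<l> i \<le> n"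
  shows "(\<Sum>k=1..n. (e i (real k / real n))\<^sup>2) \<le> 3 * K ^ 3 * real n"
proof -
  define l where "l = \<l> i"
  let ?A = "{k \<in> {1..n}. \<bar>2 ^ \<l> i * (real k / real n) - real (pos i)\<bar> \<le> K}"
  have "(\<Sum>k=1..n. (e i (real k / real n))\<^sup>2) = (\<Sum>k\<in>?A. (e i (real k / real n))\<^sup>2)"
  proof (rule sum.mono_neutral_right)
    show "\<forall>k\<in>{1..n} - ?A. (e i (real k / real n))\<^sup>2 = 0"
    proof
      fix k assume k: "k \<in> {1..n} - ?A"
      then have "real k / real n \<in> {0..1}" by auto
      with k basis_support [OF i this] show "(e i (real k / real n))\<^sup>2 = 0" by auto
    qed
  qed auto
  also have "\<dots> \<le> (\<Sum>k\<in>?A. (K * 2 powr (real l / 2))\<^sup>2)"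
  proof (rule sum_mono)
    fix k assume "k \<in> ?A"
    then have "\<bar>e i (real k / real n)\<bar> \<le> K * 2 powr (real l / 2)"
      unfolding l_def by (intro basis_bound i) auto
    then show "(e i (real k / real n))\<^sup>2 \<le> (K * 2 powr (real l / 2))\<^sup>2"
      by (metis power2_abs power_mono abs_ge_zero)
  qed
  also have "\<dots> = real (card ?A) * (K\<^sup>2 * 2 ^ l)"
    by (simp add: power_mult_distrib powr_realpow [symmetric] powr_powr power2_eq_square powr_add [symmetric])
  also have "\<dots> \<le> (2 * K * (real n / 2 ^ l) + 1) * (K\<^sup>2 * 2 ^ l)"
    using active_design_count [OF n(1), of K i] K_ge_1 by (intro mult_right_mono) (auto simp: l_def)
  also have "\<dots> = 2 * K ^ 3 * real n + K\<^sup>2 * 2 ^ l"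
    by (simp add: field_simps power2_eq_square power3_eq_cube)
  also have "\<dots> \<le> 2 * K ^ 3 * real n + K ^ 3 * real n"
  proof -
    have "(2::real) ^ l \<le> real n" using n(2) unfolding l_def by (metis of_nat_le_iff of_nat_numeral of_nat_power)
    moreover have "K\<^sup>2 \<le> K ^ 3" using K_ge_1 by (intro power_increasing) auto
    ultimately have "K\<^sup>2 * 2 ^ l \<le> K ^ 3 * real n"
      using K_ge_1 by (intro mult_mono) auto
    then show ?thesis by (rule add_left_mono)
  qed
  finally show ?thesis by (simp add: algebra_simps)
qed

lemma integral_cells:
  fixes g :: "real \<Rightarrow> real"
  assumes g: "continuous_on {0..1} g" and "1 \<le> n" "m \<le> n"
  shows "integral {0..real m / real n} g = (\<Sum>k=1..m. integral {(real k - 1) / real n..real k / real n} g)"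
  using \<open>m \<le> n\<close>
proof (induction m)
  case (Suc m)
  have le: "real (Suc m) / real n \<le> 1" using Suc.prems assms(2) by simp
  then have "g integrable_on {0..real (Suc m) / real n}"
    by (intro integrable_continuous_real continuous_on_subset [OF g]) auto
  then have "integral {0..real m / real n} g + integral {real m / real n..real (Suc m) / real n} g =
      integral {0..real (Suc m) / real n} g"
    by (intro Henstock_Kurzweil_Integration.integral_combine) (auto simp: divide_right_mono)
  then show ?case using Suc by simp
qed simp

definition empirical_coef :: "nat \<Rightarrow> (nat \<Rightarrow> real) \<Rightarrow> index \<Rightarrow> real" where
  "empirical_coef n Y i = (\<Sum>k=1..n. e i (real k / real n) * Y k) / real n"

text \<open>
  On each of the about n 2^(-l) cells of length 1/n that meet the support, the oscillation of the
  product is due either to the basis function, whose Lipschitz constant is of order 2^(3l/2), or to f,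
  which is only Hoelder continuous. These are the two terms of the bound.
\<close>

lemma riemann_error:
  assumes i: "i \<in> I" and n: "1 \<le> n" "2 ^ \<l> i \<le> n"
    and f: "continuous_on {0..1} f" and F: "\<And>x. x \<in> {0..1} \<Longrightarrow> \<bar>f x\<bar> \<le> F"
    and D: "\<And>x y. x \<in> {0..1} \<Longrightarrow> y \<in> {0..1} \<Longrightarrow> \<bar>f x - f y\<bar> \<le> D * \<bar>x - y\<bar> powr u"
    and u: "0 < u" and D0: "0 \<le> D"
  shows "\<bar>empirical_coef n (\<lambda>k. f (real k / real n)) i - coef f i\<bar> \<le>
     5 * K\<^sup>2 * (F * 2 powr (real (\<l> i) / 2) / real n + D * real n powr (- u) * 2 powr (- (real (\<l> i) / 2)))"
proof -
  define l where "l = \<l> i"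
  define g where "g x = e i x * f x" for x
  have g: "continuous_on {0..1} g" unfolding g_def by (intro continuous_intros continuous_e i f)
  have F0: "0 \<le> F" using F [of 0] by auto
  define M where "M = K * 2 powr (real l / 2) * (F * 2 ^ l / real n + D * real n powr (- u))"
  have M0: "0 \<le> M" using F0 D0 K_ge_1 by (simp add: M_def)
  let ?A = "{k \<in> {1..n}. \<bar>2 ^ \<l> i * (real k / real n) - real (pos i)\<bar> \<le> K + 1}"
  let ?C = "\<lambda>k::nat. {(real k - 1) / real n..real k / real n}"
  have sub: "?C k \<subseteq> {0..1}" "real k / real n \<in> {0..1}" if "k \<in> {1..n}" for k
    using that n by (auto simp: field_simps)
  have 2: "(2::real) ^ l \<le> real n" using n(2) unfolding l_def by (metis of_nat_le_iff of_nat_numeral of_nat_power)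
  have cell: "\<bar>g (real k / real n) / real n - integral (?C k) g\<bar> \<le> (if k \<in> ?A then M / real n else 0)"
    if k: "k \<in> {1..n}" for k
  proof -
    have const: "((\<lambda>_. c) has_integral c / real n) (?C k)" for c :: real
      using has_integral_const_real [of c "(real k - 1) / real n" "real k / real n"] n
      by (simp add: field_simps)
    have "(g has_integral integral (?C k) g) (?C k)"
      by (intro integrable_integral integrable_continuous_interval continuous_on_subset [OF g] sub k)
    with const [of "g (real k / real n)"] have diff: "((\<lambda>y. g (real k / real n) - g y) has_integral
        (g (real k / real n) / real n - integral (?C k) g)) (?C k)"
      by (rule has_integral_diff)
    have pw: "norm (g (real k / real n) - g y) \<le> (if k \<in> ?A then M else 0)" if y: "y \<in> ?C k" for y
    proof -
      let ?x = "real k / real n"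
      have xy: "\<bar>?x - y\<bar> \<le> 1 / real n" using y by (auto simp: diff_divide_distrib abs_le_iff)
      have x01: "?x \<in> {0..1}" and y01: "y \<in> {0..1}" using sub [OF k] y by blast+
      show ?thesis
      proof (cases "k \<in> ?A")
        case True
        have "\<bar>g ?x - g y\<bar> = \<bar>(e i ?x - e i y) * f y + e i ?x * (f ?x - f y)\<bar>"
          by (simp add: g_def algebra_simps)
        also have "\<dots> \<le> \<bar>e i ?x - e i y\<bar> * \<bar>f y\<bar> + \<bar>e i ?x\<bar> * \<bar>f ?x - f y\<bar>"
          by (metis abs_mult abs_triangle_ineq)
        also have "\<dots> \<le> (K * 2 powr (real l / 2) * 2 ^ l * (1 / real n)) * F +
            (K * 2 powr (real l / 2)) * (D * real n powr (- u))"
        proof (intro add_mono mult_mono)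
          show "\<bar>e i ?x - e i y\<bar> \<le> K * 2 powr (real l / 2) * 2 ^ l * (1 / real n)"
            unfolding l_def using K_ge_1 xy
            by (intro order_trans [OF basis_lipschitz [OF i x01 y01]] mult_left_mono) auto
          show "\<bar>f ?x - f y\<bar> \<le> D * real n powr (- u)"
          proof -
            have "\<bar>f ?x - f y\<bar> \<le> D * \<bar>?x - y\<bar> powr u" by (rule D [OF x01 y01])
            also have "\<dots> \<le> D * (1 / real n) powr u"
              using xy u D0 by (intro mult_left_mono powr_mono2) auto
            also have "(1 / real n) powr u = real n powr (- u)"
              using n by (simp add: powr_minus powr_divide inverse_eq_divide)
            finally show ?thesis .
          qed
        qed (use K_ge_1 F [OF y01] basis_bound [OF i x01] D0 in \<open>auto simp: l_def\<close>)
        also have "\<dots> = M" by (simp add: M_def field_simps)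
        finally show ?thesis using True by simp
      next
        case False
        then have far: "K + 1 < \<bar>2 ^ \<l> i * ?x - real (pos i)\<bar>" using k by auto
        have "\<bar>2 ^ \<l> i * ?x - 2 ^ \<l> i * y\<bar> = 2 ^ l * \<bar>?x - y\<bar>"
          unfolding l_def right_diff_distrib [symmetric] by (simp add: abs_mult)
        also have "\<dots> \<le> 2 ^ l * (1 / real n)" by (rule mult_left_mono [OF xy]) simp
        also have "\<dots> \<le> 1" using 2 n by (simp add: field_simps)
        finally have "K < \<bar>2 ^ \<l> i * y - real (pos i)\<bar>" using far by linarith
        with far have "e i ?x = 0" "e i y = 0"
          using basis_support [OF i x01] basis_support [OF i y01] by linarith+
        then show ?thesis using False by (auto simp: g_def)
      qed
    qed
    have "norm (integral (?C k) (\<lambda>y. g (real k / real n) - g y)) \<le>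
        integral (?C k) (\<lambda>_. if k \<in> ?A then M else 0)"
      using diff const pw by (intro Henstock_Kurzweil_Integration.integral_norm_bound_integral)
        (auto simp: integrable_on_def)
    also have "integral (?C k) (\<lambda>y. g (real k / real n) - g y) =
        g (real k / real n) / real n - integral (?C k) g"
      using diff by (rule integral_unique)
    also have "integral (?C k) (\<lambda>_. if k \<in> ?A then M else 0) = (if k \<in> ?A then M else 0) / real n"
      using const by (rule integral_unique)
    finally show ?thesis
      by (cases "k \<in> ?A") (simp_all only: if_True if_False real_norm_def div_0)
  qed
  have "coef f i = integral {0..1} g"
    unfolding coef_def g_def by (intro L2_inner_continuous continuous_e i f)
  also have "\<dots> = (\<Sum>k=1..n. integral (?C k) g)"
    using integral_cells [OF g n(1), of n] n by simp
  finally have "empirical_coef n (\<lambda>k. f (real k / real n)) i - coef f i =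
      (\<Sum>k=1..n. g (real k / real n) / real n - integral (?C k) g)"
    by (simp add: empirical_coef_def g_def sum_subtractf sum_divide_distrib)
  then have "\<bar>empirical_coef n (\<lambda>k. f (real k / real n)) i - coef f i\<bar> =
      \<bar>\<Sum>k=1..n. g (real k / real n) / real n - integral (?C k) g\<bar>"
    by (rule arg_cong)
  also have "\<dots> \<le> (\<Sum>k=1..n. if k \<in> ?A then M / real n else 0)"
    using cell by (intro order_trans [OF sum_abs] sum_mono) auto
  also have "\<dots> = (\<Sum>k\<in>?A. M / real n)"
  proof -
    have eq: "{1..n} \<inter> ?A = ?A" by blast
    have "(\<Sum>k\<in>{1..n} \<inter> ?A. M / real n) = (\<Sum>k=1..n. if k \<in> ?A then M / real n else 0)"
      by (rule sum.inter_restrict) simp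
    then show ?thesis unfolding eq by (rule sym)
  qed
  also have "\<dots> = real (card ?A) * (M / real n)" by simp
  also have "\<dots> \<le> (5 * K * (real n / 2 ^ l)) * (M / real n)"
  proof (rule mult_right_mono)
    have "2 * (K + 1) * q + 1 \<le> 5 * K * q" if "1 \<le> q" for q :: real
    proof -
      have "1 * q \<le> K * q" using that K_ge_1 by (intro mult_right_mono) auto
      with that show ?thesis unfolding distrib_left distrib_right mult.assoc by linarith
    qed
    moreover have "1 \<le> real n / 2 ^ l" using 2 by simp
    ultimately have "2 * (K + 1) * (real n / 2 ^ l) + 1 \<le> 5 * K * (real n / 2 ^ l)" by blast
    then show "real (card ?A) \<le> 5 * K * (real n / 2 ^ l)"
      using active_design_count [OF n(1), of "K + 1" i] K_ge_1 by (simp add: l_def)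
    show "0 \<le> M / real n" using M0 by simp
  qed
  also have "\<dots> = 5 * K * M / 2 ^ l" using n by simp
  also have "\<dots> = 5 * K\<^sup>2 * (F * 2 powr (real l / 2) / real n +
      D * real n powr (- u) * (2 powr (real l / 2) / 2 ^ l))"
    by (simp add: M_def field_simps power2_eq_square)
  also have "(2::real) powr (real l / 2) / 2 ^ l = 2 powr (- (real l / 2))"
    by (simp add: powr_realpow [symmetric] powr_diff [symmetric])
  finally show ?thesis by (simp add: l_def)
qed

text \<open>
  The bound that membership in the ball imposes on each coefficient.
\<close>

definition threshold :: "real \<Rightarrow> real \<Rightarrow> index \<Rightarrow> real" where
  "threshold B t = case_sum (\<lambda>_. B) (\<lambda>(j, m). B * 2 powr (- (real j * (t + 1 / 2))))"

lemma holder_ball_iff: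
  assumes "0 \<le> B"
  shows "f \<in> holder_ball J phi psi B t \<longleftrightarrow>
    continuous_on {0..1} f \<and> (\<forall>i\<in>I. \<bar>coef f i\<bar> \<le> threshold B t i)"
proof -
  have 1: "2 powr a * c \<le> B \<longleftrightarrow> c \<le> B * 2 powr (- a)" for a c :: real
    by (simp add: powr_minus field_simps)
  have "wavelet_norm J phi psi t f \<le> ennreal B \<longleftrightarrow>
      (\<forall>m<2 ^ J. \<bar>L2_inner (phi m) f\<bar> \<le> B) \<and>
      (\<forall>j\<ge>J. \<forall>m<2 ^ j. 2 powr (real j * (t + 1/2)) * \<bar>L2_inner (psi j m) f\<bar> \<le> B)"
    using assms by (auto simp: wavelet_norm_def SUP_le_iff)
  also have "\<dots> \<longleftrightarrow> (\<forall>i\<in>I. \<bar>coef f i\<bar> \<le> threshold B t i)"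
    unfolding 1 by (force simp: indices_def coef_def threshold_def basis_fun_def)
  finally show ?thesis by (simp add: holder_ball_def)
qed

lemma threshold_nonneg: "0 \<le> B \<Longrightarrow> 0 \<le> threshold B t i"
  by (auto simp: threshold_def split: sum.split)

lemma threshold_le:
  assumes "0 \<le> B" "0 \<le> t" "i \<in> I"
  shows "threshold B t i \<le> B * 2 powr (real J * (t + 1 / 2)) * 2 powr (- (real (\<l> i) * (t + 1 / 2)))"
proof (cases i)
  case (Inl m)
  then show ?thesis by (simp add: threshold_def lev_def powr_add [symmetric] mult.assoc)
next
  case (Inr p)
  have "1 * 2 powr (- (real (\<l> i) * (t + 1 / 2))) \<le>
      2 powr (real J * (t + 1 / 2)) * 2 powr (- (real (\<l> i) * (t + 1 / 2)))"
    using assms by (intro mult_right_mono ge_one_powr_ge_zero) auto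
  then show ?thesis using Inr assms
    by (auto simp: threshold_def lev_def mult.assoc intro!: mult_left_mono split: prod.split)
qed

lemma holder_ball_smooth:
  assumes "0 \<le> B" "0 \<le> t" "f \<in> holder_ball J phi psi B t"
  shows "smooth (B * 2 powr (real J * (t + 1 / 2))) t f"
  using assms threshold_le [OF assms(1,2)] unfolding smooth_def
  by (auto simp: holder_ball_iff intro: order_trans)

lemma holder_ball_mono:
  assumes "0 \<le> B" "r \<le> s" 
  shows "holder_ball J phi psi B s \<subseteq> holder_ball J phi psi B r"
proof -
  have "threshold B s i \<le> threshold B r i" for i
    using assms by (auto simp: threshold_def split: sum.split intro!: mult_left_mono powr_mono)
  then show ?thesis using assms(1) by (force simp: holder_ball_iff intro: order_trans)
qed

end

section \<open>Rates and resolution levels\<close>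

text \<open>
  The reciprocal of the bandwidth that balances bias against noise for smoothness t; the resolution
  rounds it up to a power of 2.
\<close>

definition inverse_bandwidth :: "nat \<Rightarrow> real \<Rightarrow> real" where
  "inverse_bandwidth n t = (real n / ln (real n)) powr (1 / (2 * t + 1))"

definition resolution :: "nat \<Rightarrow> real \<Rightarrow> nat" where
  "resolution n t = nat \<lceil>log 2 (inverse_bandwidth n t)\<rceil>"

lemma ln_ge_1: "3 \<le> n \<Longrightarrow> 1 \<le> ln (real n)"
  using exp_le by (subst ln_ge_iff) auto

lemma ln_less_self: "3 \<le> n \<Longrightarrow> ln (real n) < real n"
  using ln_le_minus_one [of "real n"] by linarith

lemma inverse_bandwidth_ge_1:
  assumes "3 \<le> n" "0 < t"
  shows "1 \<le> inverse_bandwidth n t"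
  unfolding inverse_bandwidth_def
  using ln_ge_1 [OF assms(1)] less_imp_le [OF ln_less_self [OF assms(1)]] assms
  by (intro ge_one_powr_ge_zero) auto

lemma ln_over_n_eq:
  assumes "3 \<le> n" "0 < t"
  shows "ln (real n) / real n = inverse_bandwidth n t powr (- (2 * t + 1))"
proof -
  have "1 / (2 * t + 1) * (- (2 * t + 1)) = - 1" using assms by (simp add: field_simps)
  then have "inverse_bandwidth n t powr (- (2 * t + 1)) = (real n / ln (real n)) powr (- 1)"
    by (simp only: inverse_bandwidth_def powr_powr)
  also have "\<dots> = ln (real n) / real n"
    using ln_ge_1 [OF assms(1)] assms by (simp add: powr_minus)
  finally show ?thesis ..
qed

lemma rate_eq:
  assumes "3 \<le> n" "0 < t"
  shows "rate n t = inverse_bandwidth n t powr (- t)"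
proof -
  have "- (2 * t + 1) * (t / (2 * t + 1)) = - t" using assms by (simp add: field_simps)
  then show ?thesis by (simp only: rate_def ln_over_n_eq [OF assms] powr_powr)
qed

lemma resolution_bounds:
  assumes "3 \<le> n" "0 < t"
  shows "inverse_bandwidth n t \<le> 2 ^ resolution n t" "2 ^ resolution n t \<le> 2 * inverse_bandwidth n t"
proof -
  define a where "a = inverse_bandwidth n t"
  have a: "1 \<le> a" unfolding a_def by (rule inverse_bandwidth_ge_1 [OF assms])
  have "0 \<le> log 2 a" using a by (simp add: zero_le_log_cancel_iff)
  then have eq: "real (resolution n t) = real_of_int \<lceil>log 2 a\<rceil>"
    by (simp add: resolution_def a_def)
  have "a = 2 powr (log 2 a)" using a by simp
  also have "\<dots> \<le> 2 powr (real (resolution n t))" unfolding eq by (intro powr_mono) auto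
  finally show "inverse_bandwidth n t \<le> 2 ^ resolution n t" by (simp add: a_def powr_realpow)
  have "2 powr (real (resolution n t)) \<le> 2 powr (1 + log 2 a)"
    unfolding eq by (intro powr_mono) linarith+
  also have "\<dots> = 2 * a" using a by (simp add: powr_add)
  finally show "2 ^ resolution n t \<le> 2 * inverse_bandwidth n t" by (simp add: a_def powr_realpow)
qed

lemma rate_pos: "3 \<le> n \<Longrightarrow> 0 < t \<Longrightarrow> 0 < rate n t"
  using inverse_bandwidth_ge_1 [of n t] by (simp add: rate_eq)

lemma resolution_powr_le_rate:
  assumes "3 \<le> n" "0 < t"
  shows "2 powr (- (real (resolution n t) * t)) \<le> rate n t"
proof -
  have "2 powr (- (real (resolution n t) * t)) = (2 ^ resolution n t) powr (- t)"
    by (simp add: powr_realpow [symmetric] powr_powr)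
  also have "\<dots> \<le> rate n t"
    unfolding rate_eq [OF assms] using inverse_bandwidth_ge_1 [OF assms] resolution_bounds [OF assms] assms
    by (intro powr_mono2') auto
  finally show ?thesis .
qed

lemma rate_le_resolution_powr:
  assumes "3 \<le> n" "0 < t"
  shows "rate n t \<le> 2 powr t * 2 powr (- (real (resolution n t) * t))"
proof -
  have "2 powr (- t) * rate n t = (2 * inverse_bandwidth n t) powr (- t)"
    using inverse_bandwidth_ge_1 [OF assms] by (simp add: rate_eq [OF assms] powr_mult)
  also have "\<dots> \<le> (2 ^ resolution n t) powr (- t)"
    using resolution_bounds [OF assms] assms by (intro powr_mono2') auto
  also have "\<dots> = 2 powr (- (real (resolution n t) * t))"
    by (simp add: powr_realpow [symmetric] powr_powr)
  finally show ?thesis by (simp add: powr_minus field_simps)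
qed

lemma stochastic_le_rate:
  assumes "3 \<le> n" "0 < t"
  shows "sqrt (ln (real n) / real n) * 2 powr (real (resolution n t) / 2) \<le> sqrt 2 * rate n t"
proof -
  define a where "a = inverse_bandwidth n t"
  have a: "1 \<le> a" unfolding a_def by (rule inverse_bandwidth_ge_1 [OF assms])
  have "2 powr (real (resolution n t) / 2) = sqrt (2 ^ resolution n t)"
    by (simp add: powr_half_sqrt [symmetric] powr_realpow [symmetric] powr_powr)
  also have "\<dots> \<le> sqrt (2 * a)" using resolution_bounds [OF assms] by (simp add: a_def)
  also have "\<dots> = sqrt 2 * a powr (1 / 2)" using a by (simp add: powr_half_sqrt real_sqrt_mult)
  finally have 1: "2 powr (real (resolution n t) / 2) \<le> sqrt 2 * a powr (1 / 2)" .
  have "- (2 * t + 1) * (1 / 2) = - (t + 1 / 2)" by (simp add: field_simps)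
  moreover have "sqrt (a powr (- (2 * t + 1))) = (a powr (- (2 * t + 1))) powr (1 / 2)"
    by (simp add: powr_half_sqrt)
  ultimately have "sqrt (ln (real n) / real n) = a powr (- (t + 1 / 2))"
    by (simp only: ln_over_n_eq [OF assms] a_def powr_powr)
  then have "sqrt (ln (real n) / real n) * 2 powr (real (resolution n t) / 2)
      \<le> a powr (- (t + 1 / 2)) * (sqrt 2 * a powr (1 / 2))"
    using 1 by (simp add: mult_left_mono)
  also have "\<dots> = sqrt 2 * (a powr (- (t + 1 / 2)) * a powr (1 / 2))" by simp
  also have "a powr (- (t + 1 / 2)) * a powr (1 / 2) = a powr (- t)"
    by (simp only: powr_add [symmetric]) simp
  finally show ?thesis by (simp add: rate_eq [OF assms] a_def)
qed

lemma resolution_over_n_le_rate: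
  assumes "3 \<le> n" "0 < t"
  shows "2 ^ resolution n t / real n \<le> 2 * rate n t"
proof -
  define a where "a = inverse_bandwidth n t"
  have a: "1 \<le> a" unfolding a_def by (rule inverse_bandwidth_ge_1 [OF assms])
  have "2 ^ resolution n t / real n \<le> 2 * a * (ln (real n) / real n)"
  proof -
    have "2 ^ resolution n t * 1 \<le> (2 * a) * ln (real n)"
      using resolution_bounds [OF assms] ln_ge_1 [OF assms(1)] a by (intro mult_mono) (auto simp: a_def)
    then show ?thesis by (simp add: divide_right_mono)
  qed
  also have "\<dots> = 2 * (a powr 1 * a powr (- (2 * t + 1)))"
    unfolding ln_over_n_eq [OF assms] a_def [symmetric] using a by simp
  also have "a powr 1 * a powr (- (2 * t + 1)) = a powr (- (2 * t))"
    by (simp only: powr_add [symmetric]) simp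
  also have "a powr (- (2 * t)) \<le> a powr (- t)" using a assms by (intro powr_mono) auto
  finally show ?thesis by (simp add: rate_eq [OF assms] a_def)
qed

lemma inverse_bandwidth_le:
  assumes "3 \<le> n" "0 < t"
  shows "inverse_bandwidth n t \<le> real n"
proof -
  have 1: "1 \<le> real n / ln (real n)" using ln_ge_1 [OF assms(1)] ln_less_self [OF assms(1)] by simp
  have "inverse_bandwidth n t \<le> (real n / ln (real n)) powr 1"
    unfolding inverse_bandwidth_def using 1 assms by (intro powr_mono) auto
  also have "\<dots> = real n / ln (real n)" using 1 ln_ge_1 [OF assms(1)] by simp
  also have "\<dots> \<le> real n" using ln_ge_1 [OF assms(1)] mult_left_mono [of 1 "ln (real n)" "real n"] by (simp add: field_simps)
  finally show ?thesis .
qed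

lemma level_le_n:
  assumes "3 \<le> n" "0 < t" "l < resolution n t"
  shows "2 ^ l \<le> n"
proof -
  have "2 * (2::real) ^ l = 2 ^ Suc l" by simp
  also have "\<dots> \<le> 2 ^ resolution n t" using assms(3) by (intro power_increasing) auto
  also have "\<dots> \<le> 2 * real n"
    using resolution_bounds(2) [OF assms(1,2)] inverse_bandwidth_le [OF assms(1,2)] by simp
  finally have "real (2 ^ l) \<le> real n" by simp
  then show ?thesis by (simp only: of_nat_le_iff)
qed

lemma resolution_le_ln:
  assumes "3 \<le> n" "0 < t"
  shows "real (resolution n t) \<le> 3 * ln (real n)"
proof -
  have "2 powr (real (resolution n t)) \<le> 2 * real n"
    using resolution_bounds(2) [OF assms] inverse_bandwidth_le [OF assms] by (simp add: powr_realpow)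
  then have "ln (2 powr (real (resolution n t))) \<le> ln (2 * real n)"
    using assms by (subst ln_le_cancel_iff) auto
  then have "real (resolution n t) * ln 2 \<le> ln 2 + ln (real n)"
    using assms by (simp add: ln_mult)
  moreover have "2 / 3 \<le> ln (2::real)" by (rule ln2_ge_two_thirds)
  moreover have "ln 2 \<le> (1::real)" using ln_le_minus_one [of 2] by simp
  moreover have "real (resolution n t) * (2 / 3) \<le> real (resolution n t) * ln 2"
    using \<open>2 / 3 \<le> ln 2\<close> by (intro mult_left_mono) auto
  ultimately show ?thesis using ln_ge_1 [OF assms(1)] by linarith
qed

lemma exponent_bounds: "0 < t \<Longrightarrow> 0 < t / (2 * t + 1) \<and> t / (2 * t + 1) < 1 / 2 \<and> t / (2 * t + 1) < (t::real)"
  by (auto simp: field_simps add_pos_pos)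

text \<open>
  A Hoelder exponent strictly above the exponent of the rate leaves a power of n to spare, which beats
  the logarithm contributed by the number of levels.
\<close>

lemma ln_powr_le_rate:
  assumes "3 \<le> n" "0 < t" and u: "t / (2 * t + 1) < u"
  shows "ln (real n) * real n powr (- u) \<le> rate n t / (u - t / (2 * t + 1))"
proof -
  define v where "v = t / (2 * t + 1)"
  have v: "0 < v" "v < u" using exponent_bounds [OF assms(2)] u by (auto simp: v_def)
  have "ln (real n) \<le> real n powr (u - v) / (u - v)"
    using v assms by (intro ln_powr_bound) auto
  then have "ln (real n) * real n powr (- u) \<le> real n powr (u - v) / (u - v) * real n powr (- u)"
    by (intro mult_right_mono) auto
  also have "\<dots> = real n powr (- v) / (u - v)"
    by (simp add: powr_add [symmetric])
  also have "real n powr (- v) \<le> rate n t"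
  proof -
    have "real n powr (- v) = (1 / real n) powr v"
      using assms by (simp add: powr_divide powr_minus inverse_eq_divide)
    also have "\<dots> \<le> (ln (real n) / real n) powr v"
      using v ln_ge_1 [OF assms(1)] by (intro powr_mono2 divide_right_mono) auto
    finally show ?thesis by (simp add: rate_def v_def)
  qed
  finally show ?thesis using v by (simp add: v_def divide_right_mono)
qed

lemma rate_le_1: "3 \<le> n \<Longrightarrow> 0 < t \<Longrightarrow> rate n t \<le> 1"
  using ln_ge_1 [of n] less_imp_le [OF ln_less_self [of n]] exponent_bounds [of t]
  by (auto simp: rate_def intro!: powr_le1)

lemma rate_antimono:
  assumes "3 \<le> n" "0 < r" "r \<le> s"
  shows "rate n s \<le> rate n r"
proof -
  have "r / (2 * r + 1) \<le> s / (2 * s + 1)" using assms by (simp add: field_simps)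
  then show ?thesis unfolding rate_def using ln_ge_1 [OF assms(1)] ln_less_self [OF assms(1)]
    by (intro powr_mono') auto
qed

lemma inverse_le_rate:
  assumes "3 \<le> n" "0 < t"
  shows "1 / real n \<le> rate n t"
proof -
  have "1 / real n \<le> ln (real n) / real n" using ln_ge_1 [OF assms(1)] by (simp add: divide_right_mono)
  also have "\<dots> = (ln (real n) / real n) powr 1" using ln_ge_1 [OF assms(1)] by simp
  also have "\<dots> \<le> rate n t"
    unfolding rate_def using ln_ge_1 [OF assms(1)] ln_less_self [OF assms(1)] exponent_bounds [OF assms(2)]
    by (intro powr_mono') auto
  finally show ?thesis .
qed

text \<open>
  The exponent of the rate increases strictly with the smoothness.
\<close>

lemma rate_ratio_tendsto_0:
  assumes "0 < r" "r < s"
  shows "(\<lambda>n. rate n s / rate n r) \<longlonglongrightarrow> 0"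
proof -
  define d where "d = s / (2 * s + 1) - r / (2 * r + 1)"
  have d: "0 < d" using assms by (simp add: d_def field_simps add_pos_pos)
  have "(\<lambda>n. ln (real n) / real n) \<longlonglongrightarrow> 0" by real_asymp
  then have "(\<lambda>n. (ln (real n) / real n) powr d) \<longlonglongrightarrow> 0 powr d"
    using d by (intro tendsto_powr') (auto intro!: eventually_sequentiallyI [of 1])
  then show ?thesis using d by (simp add: rate_def d_def powr_diff)
qed

lemma sum_half_powers: "(\<Sum>l<j. 2 powr (real l / 2)) \<le> 3 * 2 powr (real j / 2)"
proof (induction j)
  case (Suc j)
  have "4 / 3 \<le> sqrt 2" by (rule real_le_rsqrt) (simp add: power2_eq_square)
  then have "4 * 2 powr (real j / 2) \<le> 3 * sqrt 2 * 2 powr (real j / 2)" by (intro mult_right_mono) auto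
  also have "\<dots> = 3 * 2 powr (real (Suc j) / 2)"
    by (simp add: add_divide_distrib powr_add powr_half_sqrt)
  finally show ?case using Suc by simp
qed simp

text \<open>
  The three summands are the noise and the two parts of the discretisation bias. Weighted by 2^(l/2),
  the noise and the first part of the bias grow geometrically in l, while the second part is constant
  in l and is summed over a logarithmic number of levels.
\<close>

lemma sum_error_le_rate:
  assumes n: "3 \<le> n" and t: "0 < t" and u: "t / (2 * t + 1) < u" and c: "0 \<le> \<kappa>" "0 \<le> A" "0 \<le> A'"
  shows "(\<Sum>l<resolution n t. (\<kappa> * sqrt (ln (real n) / real n) +
      (A * (2 powr (real l / 2) / real n) + A' * (real n powr (- u) * 2 powr (- (real l / 2))))) * 2 powr (real l / 2))
    \<le> (\<kappa> * (3 * sqrt 2) + 2 * A + 3 * A' / (u - t / (2 * t + 1))) * rate n t"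
proof -
  define j where "j = resolution n t"
  define N where "N = sqrt (ln (real n) / real n)"
  have N0: "0 \<le> N" using ln_ge_1 [OF n] by (simp add: N_def)
  have "(\<Sum>l<j. (\<kappa> * N + (A * (2 powr (real l / 2) / real n) +
        A' * (real n powr (- u) * 2 powr (- (real l / 2))))) * 2 powr (real l / 2)) =
      (\<Sum>l<j. \<kappa> * N * 2 powr (real l / 2) + (A / real n * 2 ^ l + A' * real n powr (- u)))"
  proof (intro sum.cong refl)
    fix l
    have 1: "2 powr (real l / 2) * 2 powr (real l / 2) = (2::real) ^ l"
      by (simp add: powr_add [symmetric] powr_realpow [symmetric])
    have 2: "2 powr (- (real l / 2)) * 2 powr (real l / 2) = (1::real)"
      by (simp add: powr_add [symmetric])
    show "(\<kappa> * N + (A * (2 powr (real l / 2) / real n) +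
        A' * (real n powr (- u) * 2 powr (- (real l / 2))))) * 2 powr (real l / 2) =
      \<kappa> * N * 2 powr (real l / 2) + (A / real n * 2 ^ l + A' * real n powr (- u))"
      unfolding distrib_right mult.assoc 2 by (simp add: 1)
  qed
  also have "\<dots> = \<kappa> * N * (\<Sum>l<j. 2 powr (real l / 2)) + (A / real n * (\<Sum>l<j. 2 ^ l) +
      real j * (A' * real n powr (- u)))"
    by (simp add: sum.distrib sum_distrib_left)
  also have "\<dots> \<le> \<kappa> * N * (3 * 2 powr (real j / 2)) + (A / real n * 2 ^ j + (3 * ln (real n)) * (A' * real n powr (- u)))"
  proof (intro add_mono mult_left_mono mult_right_mono sum_half_powers)
    have "(\<Sum>l<j. (2::real) ^ l) = 2 ^ j - 1" by (simp add: sum_gp_strict)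
    then show "(\<Sum>l<j. (2::real) ^ l) \<le> 2 ^ j" by simp
    show "real j \<le> 3 * ln (real n)" unfolding j_def by (rule resolution_le_ln [OF n t])
  qed (use c N0 in auto)
  also have "\<dots> = \<kappa> * 3 * (N * 2 powr (real j / 2)) + (A * (2 ^ j / real n) + 3 * A' * (ln (real n) * real n powr (- u)))"
    by simp
  also have "\<dots> \<le> \<kappa> * 3 * (sqrt 2 * rate n t) + (A * (2 * rate n t) + 3 * A' * (rate n t / (u - t / (2 * t + 1))))"
    unfolding N_def j_def using c
    by (intro add_mono mult_left_mono stochastic_le_rate resolution_over_n_le_rate ln_powr_le_rate n t u) auto
  also have "\<dots> = (\<kappa> * (3 * sqrt 2) + 2 * A + 3 * A' / (u - t / (2 * t + 1))) * rate n t"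
    by (simp add: distrib_right)
  finally show ?thesis by (simp add: N_def j_def)
qed

section \<open>Necessity of the separation\<close>

lemma inverse_bandwidth_at_top:
  assumes "0 < t"
  shows "filterlim (\<lambda>n. inverse_bandwidth n t) at_top sequentially"
proof -
  have "0 < 1 / (2 * t + 1)" using assms by simp
  then show ?thesis unfolding inverse_bandwidth_def by real_asymp
qed

lemma two_power_powr: "((2::real) ^ j) powr x = 2 powr (real j * x)"
  by (simp add: powr_realpow [symmetric] powr_powr)

lemma sup_norm_le_iff: "0 \<le> H \<Longrightarrow> sup_norm f \<le> ennreal H \<longleftrightarrow> (\<forall>x\<in>{0..1}. \<bar>f x\<bar> \<le> H)"
  by (auto simp: sup_norm_def SUP_le_iff)

lemma log_power_null:
  fixes \<theta> :: real
  assumes "0 < \<theta>"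
  shows "(\<lambda>n. ln (real n) powr (2 * \<theta>) * real n powr (- \<theta>)) \<longlonglongrightarrow> 0"
  using assms by real_asymp

context regular_basis
begin

text \<open>
  The scaling puts the bump on the boundary of the ball of smoothness r and radius \<beta>.
\<close>

definition bump :: "real \<Rightarrow> real \<Rightarrow> nat \<Rightarrow> nat \<Rightarrow> real \<Rightarrow> real" where
  "bump \<beta> r j m x = \<beta> * 2 powr (- (real j * (r + 1 / 2))) * e (Inr (j, m)) x"

lemma wavelet_index: "J \<le> j \<Longrightarrow> m < 2 ^ j \<Longrightarrow> Inr (j, m) \<in> I"
  by (auto simp: indices_def)

lemma continuous_bump: "J \<le> j \<Longrightarrow> m < 2 ^ j \<Longrightarrow> continuous_on {0..1} (bump \<beta> r j m)"
  unfolding bump_def by (intro continuous_intros continuous_e wavelet_index)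

lemma coef_bump:
  assumes "J \<le> j" "m < 2 ^ j" "i \<in> I"
  shows "coef (bump \<beta> r j m) i = (if i = Inr (j, m) then \<beta> * 2 powr (- (real j * (r + 1 / 2))) else 0)"
  using coef_sum [of "{Inr (j, m)}" i "\<lambda>_. \<beta> * 2 powr (- (real j * (r + 1 / 2)))"]
    assms wavelet_index [OF assms(1,2)]
  by (simp add: bump_def [abs_def])

lemma zero_in_holder_ball: "0 \<le> B \<Longrightarrow> (\<lambda>_. 0) \<in> holder_ball J phi psi B t"
  by (simp add: holder_ball_iff coef_def L2_inner_def threshold_nonneg)

lemma bump_in_holder_ball:
  assumes "J \<le> j" "m < 2 ^ j" "0 \<le> \<beta>" "\<beta> \<le> B"
  shows "bump \<beta> r j m \<in> holder_ball J phi psi B r"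
proof -
  have "0 \<le> B" using assms by simp
  moreover have "threshold B r (Inr (j, m)) = B * 2 powr (- (real j * (r + 1 / 2)))"
    by (simp add: threshold_def)
  ultimately show ?thesis
    using assms by (auto simp: holder_ball_iff continuous_bump coef_bump threshold_nonneg)
qed

text \<open>
  Pairing the difference to g with the wavelet of the bump isolates a coefficient that is at least
  half that of the bump, since g has a much smaller one; \<open>coef_bound\<close> turns it into a lower bound on
  the supremum norm.
\<close>

lemma bump_separation:
  assumes jm: "J \<le> j" "m < 2 ^ j" and B: "0 \<le> B" "0 \<le> \<beta>"
    and small: "B * 2 powr (- (real j * (s - r))) \<le> \<beta> / 2"
    and g: "g \<in> holder_ball J phi psi B s"
  shows "ennreal (\<beta> / (4 * K\<^sup>2) * 2 powr (- (real j * r))) \<le> sup_norm (\<lambda>x. bump \<beta> r j m x - g x)"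
proof (cases "sup_norm (\<lambda>x. bump \<beta> r j m x - g x)")
  case (real H)
  let ?i = "Inr (j, m) :: index"
  have i: "?i \<in> I" by (rule wavelet_index [OF jm])
  from real have H: "\<And>x. x \<in> {0..1} \<Longrightarrow> \<bar>bump \<beta> r j m x - g x\<bar> \<le> H"
    using sup_norm_le_iff [of H "\<lambda>x. bump \<beta> r j m x - g x"] by simp
  have g': "continuous_on {0..1} g" "\<bar>coef g ?i\<bar> \<le> B * 2 powr (- (real j * (s + 1 / 2)))"
    using g i B by (auto simp: holder_ball_iff threshold_def)
  have "\<beta> * 2 powr (- (real j * (r + 1 / 2))) - B * 2 powr (- (real j * (s + 1 / 2))) \<le>
      coef (bump \<beta> r j m) ?i - coef g ?i"
    using g' by (simp add: coef_bump [OF jm i])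
  also have "\<dots> = coef (\<lambda>x. bump \<beta> r j m x - g x) ?i"
    by (simp add: coef_diff i g' continuous_bump jm)
  also have "\<dots> \<le> 2 * K\<^sup>2 * H * 2 powr (- (real j / 2))"
    using coef_bound [OF i, of "\<lambda>x. bump \<beta> r j m x - g x" H] H
    by (simp add: continuous_on_diff g' continuous_bump jm lev_def)
  finally have 1: "\<beta> * 2 powr (- (real j * (r + 1 / 2))) - B * 2 powr (- (real j * (s + 1 / 2))) \<le>
      2 * K\<^sup>2 * H * 2 powr (- (real j / 2))" .
  have split: "2 powr (- (real j * (r + 1 / 2))) = 2 powr (- (real j * r)) * 2 powr (- (real j / 2))"
    "2 powr (- (real j * (s + 1 / 2))) = 2 powr (- (real j * (s - r))) * 2 powr (- (real j * r)) * 2 powr (- (real j / 2))"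
    by (simp_all add: powr_add [symmetric] algebra_simps)
  have "(\<beta> * 2 powr (- (real j * r)) - B * 2 powr (- (real j * (s - r))) * 2 powr (- (real j * r))) * 2 powr (- (real j / 2))
      \<le> (2 * K\<^sup>2 * H) * 2 powr (- (real j / 2))"
    using 1 unfolding split by (simp add: algebra_simps)
  then have 2: "\<beta> * 2 powr (- (real j * r)) - B * 2 powr (- (real j * (s - r))) * 2 powr (- (real j * r)) \<le> 2 * K\<^sup>2 * H"
    by (rule mult_right_le_imp_le) simp
  have "B * 2 powr (- (real j * (s - r))) * 2 powr (- (real j * r)) \<le> \<beta> / 2 * 2 powr (- (real j * r))"
    using small by (rule mult_right_mono) simp
  with 2 have "\<beta> / 2 * 2 powr (- (real j * r)) \<le> 2 * K\<^sup>2 * H" by linarith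
  then have "\<beta> / (4 * K\<^sup>2) * 2 powr (- (real j * r)) \<le> H"
    using K_ge_1 by (simp add: field_simps)
  then show ?thesis using real by (simp add: ennreal_leI)
qed simp

lemma bumps_disjoint:
  assumes jm: "J \<le> j" "m < 2 ^ j" "m' < 2 ^ j" and far: "2 * K < \<bar>real m - real m'\<bar>" and x: "x \<in> {0..1}"
  shows "bump \<beta> r j m x * bump \<beta> r j m' x = 0"
proof (rule ccontr)
  assume "bump \<beta> r j m x * bump \<beta> r j m' x \<noteq> 0"
  then have "e (Inr (j, m)) x \<noteq> 0" "e (Inr (j, m')) x \<noteq> 0" by (auto simp: bump_def)
  then have "\<bar>2 ^ j * x - real m\<bar> \<le> K" "\<bar>2 ^ j * x - real m'\<bar> \<le> K"
    using basis_support [OF wavelet_index [OF jm(1,2)] x] basis_support [OF wavelet_index [OF jm(1,3)] x]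
    by (auto simp: lev_def pos_def)
  with far show False by linarith
qed

lemma bump_energy:
  assumes jm: "J \<le> j" "m < 2 ^ j" and n: "1 \<le> n" "2 ^ j \<le> n"
  shows "(\<Sum>k=1..n. (bump \<beta> r j m (real k / real n))\<^sup>2) \<le>
    \<beta>\<^sup>2 * 2 powr (- (real j * (2 * r + 1))) * (3 * K ^ 3 * real n)"
proof -
  have "(\<Sum>k=1..n. (bump \<beta> r j m (real k / real n))\<^sup>2) =
      \<beta>\<^sup>2 * 2 powr (- (real j * (2 * r + 1))) * (\<Sum>k=1..n. (e (Inr (j, m)) (real k / real n))\<^sup>2)"
  proof -
    have "(2 powr (- (real j * (r + 1 / 2))))\<^sup>2 = (2::real) powr (- (real j * (2 * r + 1)))"
      unfolding power2_eq_square powr_add [symmetric] by (rule arg_cong) (simp add: algebra_simps)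
    then show ?thesis by (simp add: bump_def power_mult_distrib sum_distrib_left)
  qed
  also have "\<dots> \<le> \<beta>\<^sup>2 * 2 powr (- (real j * (2 * r + 1))) * (3 * K ^ 3 * real n)"
    using design_square_sum [OF wavelet_index [OF jm] n(1)] n(2)
    by (intro mult_left_mono) (auto simp: lev_def)
  finally show ?thesis .
qed

text \<open>
  Honesty is applied at the zero function and at the bumps, adaptivity at the zero function. The event
  U that the band covers 0 and is shorter than the bumps are high is a test whose two error
  probabilities are close to \<alpha> at most, which is impossible for indistinguishable hypotheses
  when \<alpha> < 1/2.
\<close>

theorem separation_rate_necessary:
  fixes B r s \<sigma> \<alpha> :: real and \<rho> :: "nat \<Rightarrow> real"
  defines "P \<equiv> \<lambda>n. holder_ball J phi psi B s \<union>
      separated (holder_ball J phi psi B r) (holder_ball J phi psi B s) (\<rho> n)"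
  assumes rs: "0 < r" "r < s" and B: "0 < B" and \<sigma>: "0 < \<sigma>" and \<alpha>: "\<alpha> < 1 / 2"
    and honest: "asymptotically_honest \<sigma> lo hi \<alpha> P"
    and adapt: "\<And>n. 1 \<le> n \<Longrightarrow> diameter lo hi n \<in> borel_measurable (sample_space n)"
      "\<And>n. 1 \<le> n \<Longrightarrow> (\<integral>\<^sup>+ Y. diameter lo hi n Y \<partial>data_law \<sigma> n (\<lambda>_. 0)) \<le> ennreal (L * rate n s)"
  shows "0 < liminf (\<lambda>n. ereal (\<rho> n / rate n r))"
proof -
  \<comment> \<open>Half the exponent of the number of bumps: one bump contributes at most n^\<theta> to the second
    moment, negligible against 2^j, which is of order (n / log n)^(2 \<theta>).\<close>
  define \<theta> where "\<theta> = 1 / (2 * (2 * r + 1))"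
  define \<beta> where "\<beta> = min B (sqrt (\<sigma>\<^sup>2 * \<theta> / (3 * K ^ 3)))"
  \<comment> \<open>c times r_n(r) bounds the height of the bumps and their distance to \<Sigma>(s) from below.\<close>
  define c where "c = \<beta> / (4 * K\<^sup>2) * 2 powr (- r)"
  \<comment> \<open>the probability that can be lost in each of the four steps that lead to the contradiction\<close>
  define \<eta> where "\<eta> = (1 - 2 * \<alpha>) / 8"
  \<comment> \<open>Keeping every p-th position only makes the supports disjoint.\<close>
  define p where "p = nat \<lceil>2 * K\<rceil> + 1"
  have \<theta>: "0 < \<theta>" using rs by (simp add: \<theta>_def)
  have K0: "0 < K" using K_ge_1 by simp
  have \<beta>: "0 < \<beta>" "\<beta> \<le> B" using B \<sigma> \<theta> K0 by (auto simp: \<beta>_def)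
  have \<beta>2: "\<beta>\<^sup>2 * (3 * K ^ 3) / \<sigma>\<^sup>2 \<le> \<theta>"
  proof -
    have "\<beta>\<^sup>2 \<le> (sqrt (\<sigma>\<^sup>2 * \<theta> / (3 * K ^ 3)))\<^sup>2" using \<beta>(1) by (intro power_mono) (auto simp: \<beta>_def)
    also have "\<dots> = \<sigma>\<^sup>2 * \<theta> / (3 * K ^ 3)" using \<theta> K0 by simp
    finally show ?thesis using \<sigma> K0 by (simp add: field_simps)
  qed
  have c: "0 < c" using \<beta> K0 by (simp add: c_def)
  have \<eta>: "0 < \<eta>" using \<alpha> by (simp add: \<eta>_def)
  have p: "2 * K < real p" "0 < p"
    using of_nat_ceiling [of "2 * K"] by (auto simp: p_def)
  show ?thesis
  proof (rule ccontr)
    assume "\<not> 0 < liminf (\<lambda>n. ereal (\<rho> n / rate n r))"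
    then have "\<not> ereal c \<le> liminf (\<lambda>n. ereal (\<rho> n / rate n r))" using c
      by (metis ereal_less(2) less_le_trans)
    then have freq: "\<exists>\<^sub>F n in sequentially. \<rho> n / rate n r < c"
      unfolding frequently_def using Liminf_bounded [of "ereal c" "\<lambda>n. ereal (\<rho> n / rate n r)" sequentially]
      by (auto simp: not_less)
    \<comment> \<open>Each of the following holds for all large n, so all of them hold for one n from the subsequence.\<close>
    define j where "j n = resolution n r" for n
    have ev_n: "\<forall>\<^sub>F n in sequentially. 3 \<le> n" by (rule eventually_ge_at_top)
    have ev_J: "\<forall>\<^sub>F n in sequentially. J \<le> j n"
    proof -
      have "\<forall>\<^sub>F n in sequentially. 2 ^ J < inverse_bandwidth n r"
        using inverse_bandwidth_at_top [OF rs(1)] by (simp add: filterlim_at_top_dense)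
      with ev_n show ?thesis
      proof eventually_elim
        case (elim n)
        have "(2::real) ^ J < 2 ^ j n"
          using elim(2) resolution_bounds(1) [OF elim(1) rs(1)] unfolding j_def by (rule less_le_trans)
        then show ?case by simp
      qed
    qed
    have rate0: "(\<lambda>n. rate n r) \<longlonglongrightarrow> 0"
    proof -
      have "(\<lambda>n. ln (real n) / real n) \<longlonglongrightarrow> 0" by real_asymp
      then have "(\<lambda>n. (ln (real n) / real n) powr (r / (2 * r + 1))) \<longlonglongrightarrow> 0 powr (r / (2 * r + 1))"
        using exponent_bounds [OF rs(1)]
        by (intro tendsto_powr') (auto intro!: eventually_sequentiallyI [of 1])
      then show ?thesis by (simp add: rate_def)
    qed
    have ev_jn: "\<forall>\<^sub>F n in sequentially. 2 ^ j n \<le> n"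
    proof -
      have "\<forall>\<^sub>F n in sequentially. rate n r < 1 / 2" using rate0 by (rule order_tendstoD) simp
      with ev_n show ?thesis
      proof eventually_elim
        case (elim n)
        then have "2 ^ j n / real n \<le> 1"
          using resolution_over_n_le_rate [OF elim(1) rs(1)] unfolding j_def by linarith
        then have "real (2 ^ j n) \<le> real n" using elim by (simp add: field_simps)
        then show ?case by (simp only: of_nat_le_iff)
      qed
    qed
    have ev_sep: "\<forall>\<^sub>F n in sequentially. B * 2 powr (- (real (j n) * (s - r))) \<le> \<beta> / 2"
    proof -
      have "((\<lambda>n. inverse_bandwidth n r powr (- (s - r))) \<longlongrightarrow> 0) sequentially"
        using rs by (intro tendsto_neg_powr inverse_bandwidth_at_top) auto
      then have "\<forall>\<^sub>F n in sequentially. inverse_bandwidth n r powr (- (s - r)) < \<beta> / (2 * B)"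
        using \<beta> B by (intro order_tendstoD) auto
      with ev_n show ?thesis
      proof eventually_elim
        case (elim n)
        have "2 powr (- (real (j n) * (s - r))) = (2 ^ j n) powr (- (s - r))"
          by (simp only: two_power_powr mult_minus_right)
        also have "\<dots> \<le> inverse_bandwidth n r powr (- (s - r))"
          using elim rs inverse_bandwidth_ge_1 [of n r] resolution_bounds(1) [of n r]
          by (intro powr_mono2') (auto simp: j_def)
        also have "\<dots> \<le> \<beta> / (2 * B)" using elim by simp
        finally show ?case using B by (simp add: field_simps)
      qed
    qed
    have ev_honest: "\<forall>\<^sub>F n in sequentially. \<forall>f\<in>P n. 1 - \<alpha> - \<eta> < measure (data_law \<sigma> n f) (covering lo hi n f)"
    proof -
      have "ereal (1 - \<alpha> - \<eta>) < ereal (1 - \<alpha>)" using \<eta> by simp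
      also have "\<dots> \<le> liminf (\<lambda>n. INF f\<in>P n. ereal (measure (data_law \<sigma> n f) (covering lo hi n f)))"
        using honest by (simp add: asymptotically_honest_def)
      finally have "\<forall>\<^sub>F n in sequentially. ereal (1 - \<alpha> - \<eta>) <
          (INF f\<in>P n. ereal (measure (data_law \<sigma> n f) (covering lo hi n f)))"
        by (rule less_LiminfD)
      then show ?thesis
      proof eventually_elim
        case (elim n)
        show ?case
        proof
          fix f assume "f \<in> P n"
          then have "(INF f\<in>P n. ereal (measure (data_law \<sigma> n f) (covering lo hi n f))) \<le>
              ereal (measure (data_law \<sigma> n f) (covering lo hi n f))" by (rule INF_lower)
          with elim have "ereal (1 - \<alpha> - \<eta>) < ereal (measure (data_law \<sigma> n f) (covering lo hi n f))"
            by (rule less_le_trans)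
          then show "1 - \<alpha> - \<eta> < measure (data_law \<sigma> n f) (covering lo hi n f)" by simp
        qed
      qed
    qed
    have ev_diam: "\<forall>\<^sub>F n in sequentially. L * rate n s \<le> \<eta> * (c * rate n r)"
    proof -
      have "(\<lambda>n. L * (rate n s / rate n r)) \<longlonglongrightarrow> L * 0"
        by (intro tendsto_mult tendsto_const rate_ratio_tendsto_0 rs)
      then have "\<forall>\<^sub>F n in sequentially. L * (rate n s / rate n r) < \<eta> * c"
        using \<eta> c by (intro order_tendstoD) auto
      with ev_n show ?thesis
      proof eventually_elim
        case (elim n)
        then show ?case using rate_pos [of n r] rs by (simp add: field_simps)
      qed
    qed
    have ev_chi: "\<forall>\<^sub>F n in sequentially. real p * (ln (real n) powr (2 * \<theta>) * real n powr (- \<theta>)) < \<eta>\<^sup>2"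
    proof -
      have "(\<lambda>n. real p * (ln (real n) powr (2 * \<theta>) * real n powr (- \<theta>))) \<longlonglongrightarrow> real p * 0"
        by (intro tendsto_mult tendsto_const log_power_null \<theta>)
      then show ?thesis using \<eta> by (intro order_tendstoD) auto
    qed
    have "\<exists>\<^sub>F n in sequentially. \<rho> n / rate n r < c \<and> 3 \<le> n \<and> J \<le> j n \<and> 2 ^ j n \<le> n \<and>
        B * 2 powr (- (real (j n) * (s - r))) \<le> \<beta> / 2 \<and>
        (\<forall>f\<in>P n. 1 - \<alpha> - \<eta> < measure (data_law \<sigma> n f) (covering lo hi n f)) \<and>
        L * rate n s \<le> \<eta> * (c * rate n r) \<and>
        real p * (ln (real n) powr (2 * \<theta>) * real n powr (- \<theta>)) < \<eta>\<^sup>2"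
      by (intro frequently_eventually_frequently freq eventually_conj ev_n ev_J ev_jn ev_sep
          ev_honest ev_diam ev_chi)
    from frequently_ex [OF this] obtain n where n: "3 \<le> n" and small: "\<rho> n / rate n r < c"
      and Jj: "J \<le> j n" and jn: "2 ^ j n \<le> n"
      and sep: "B * 2 powr (- (real (j n) * (s - r))) \<le> \<beta> / 2"
      and cover: "\<And>f. f \<in> P n \<Longrightarrow> 1 - \<alpha> - \<eta> < measure (data_law \<sigma> n f) (covering lo hi n f)"
      and diam: "L * rate n s \<le> \<eta> * (c * rate n r)"
      and chi: "real p * (ln (real n) powr (2 * \<theta>) * real n powr (- \<theta>)) < \<eta>\<^sup>2"
      by blast
    have rate: "0 < rate n r" using n rs(1) by (rule rate_pos)
    have n1: "1 \<le> n" using n by simp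
    define M where "M = (2 ^ j n - 1) div p + 1"
    have Mp: "k * p < 2 ^ j n" if "k < M" for k
    proof -
      have "k * p \<le> (2 ^ j n - 1) div p * p" using that by (intro mult_right_mono) (auto simp: M_def)
      also have "\<dots> \<le> 2 ^ j n - 1" by simp
      finally show ?thesis using zero_less_power [of "2::nat" "j n"] by linarith
    qed
    define F where "F k = bump \<beta> r (j n) (k * p)" for k
    have c_le: "c * rate n r \<le> \<beta> / (4 * K\<^sup>2) * 2 powr (- (real (j n) * r))"
    proof -
      have "2 powr (- r) * rate n r \<le> 2 powr (- r) * (2 powr r * 2 powr (- (real (j n) * r)))"
        unfolding j_def by (intro mult_left_mono rate_le_resolution_powr n rs) auto
      also have "\<dots> = 2 powr (- (real (j n) * r))" by (simp add: powr_minus)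
      finally show ?thesis unfolding c_def mult.assoc using \<beta> by (intro mult_left_mono) auto
    qed
    have far: "ennreal (c * rate n r) \<le> sup_norm (\<lambda>x. F k x - g x)"
      if "k < M" "g \<in> holder_ball J phi psi B s" for k g
      unfolding F_def
      by (rule order_trans [OF ennreal_leI [OF c_le] bump_separation [OF Jj Mp [OF that(1)] _ _ sep that(2)]])
        (use B \<beta> in auto)
    have FP: "F k \<in> P n" if "k < M" for k
    proof -
      have "ennreal (\<rho> n) \<le> ennreal (c * rate n r)"
        using small rate by (intro ennreal_leI) (simp add: field_simps)
      then have "ennreal (\<rho> n) \<le> sup_dist (F k) (holder_ball J phi psi B s)"
        unfolding sup_dist_def using far [OF that] by (intro INF_greatest) (auto intro: order_trans)
      moreover have "F k \<in> holder_ball J phi psi B r"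
        unfolding F_def using \<beta> Jj Mp [OF that] by (intro bump_in_holder_ball) auto
      ultimately show ?thesis by (simp add: P_def separated_def)
    qed
    have zero: "(\<lambda>_. 0) \<in> holder_ball J phi psi B s" using B by (intro zero_in_holder_ball) simp
    have meas: "covering lo hi n f \<in> sets (sample_space n)" if "f \<in> P n" for f
      using honest n1 that by (auto simp: asymptotically_honest_def)
    have [measurable]: "diameter lo hi n \<in> borel_measurable (sample_space n)" by (rule adapt(1) [OF n1])
    interpret N: prob_space "noise \<sigma> n" by (rule prob_space_noise [OF \<sigma>])
    define D where "D = {Y \<in> space (sample_space n). ennreal (c * rate n r) \<le> diameter lo hi n Y}"
    have D: "D \<in> sets (sample_space n)" unfolding D_def by measurable
    have PD: "N.prob D \<le> \<eta>"
    proof -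
      have "ennreal (c * rate n r) * emeasure (noise \<sigma> n) D = (\<integral>\<^sup>+ Y. ennreal (c * rate n r) * indicator D Y \<partial>noise \<sigma> n)"
        using D by (subst nn_integral_cmult_indicator) auto
      also have "\<dots> \<le> (\<integral>\<^sup>+ Y. diameter lo hi n Y \<partial>noise \<sigma> n)"
        by (intro nn_integral_mono) (auto simp: D_def indicator_def)
      also have "\<dots> \<le> ennreal (L * rate n s)"
        using adapt(2) [OF n1] by (simp add: data_law_zero [OF \<sigma>])
      also have "\<dots> \<le> ennreal (\<eta> * (c * rate n r))" using diam by (rule ennreal_leI)
      finally have "ennreal (c * rate n r * N.prob D) \<le> ennreal (\<eta> * (c * rate n r))"
        using c rate by (simp add: N.emeasure_eq_measure ennreal_mult')
      then have "c * rate n r * N.prob D \<le> c * rate n r * \<eta>"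
        using \<eta> c rate by (simp add: mult_ac)
      then show ?thesis using c rate by simp
    qed
    have zeroP: "(\<lambda>_. 0) \<in> P n" using zero by (simp add: P_def)
    define A where "A = covering lo hi n (\<lambda>_. 0)"
    have A: "A \<in> sets (sample_space n)" unfolding A_def by (rule meas [OF zeroP])
    have PA: "1 - \<alpha> - \<eta> < N.prob A"
      using cover [OF zeroP] by (simp add: A_def data_law_zero [OF \<sigma>])
    define U where "U = A - D"
    have U: "U \<in> sets (sample_space n)" using A D by (auto simp: U_def)
    have "N.prob A \<le> N.prob (U \<union> D)"
      using A D U by (intro N.finite_measure_mono) (auto simp: U_def)
    also have "\<dots> \<le> N.prob U + N.prob D" using U D by (intro measure_Un_le) auto
    finally have PU: "1 - \<alpha> - 2 * \<eta> < N.prob U" using PA PD by linarith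
    have q: "measure (data_law \<sigma> n (F k)) U \<le> \<alpha> + \<eta>" if k: "k < M" for k
    proof -
      interpret Q: prob_space "data_law \<sigma> n (F k)" by (rule prob_space_data_law [OF \<sigma>])
      let ?C = "covering lo hi n (F k)"
      have "U \<inter> ?C = {}"
      proof (rule ccontr)
        assume "U \<inter> ?C \<noteq> {}"
        then obtain Y where Y: "Y \<in> A" "Y \<notin> D" "Y \<in> ?C" by (auto simp: U_def)
        have "ennreal (c * rate n r) \<le> sup_norm (\<lambda>x. F k x - 0)" by (rule far [OF k zero])
        also have "\<dots> \<le> diameter lo hi n Y"
          unfolding sup_norm_def diameter_def
        proof (rule SUP_mono)
          fix x :: real assume "x \<in> {0..1}"
          with Y have "lo n Y x \<le> 0" "0 \<le> hi n Y x" "lo n Y x \<le> F k x" "F k x \<le> hi n Y x"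
            by (auto simp: A_def covering_def)
          then have "\<bar>F k x - 0\<bar> \<le> \<bar>hi n Y x - lo n Y x\<bar>" by linarith
          with \<open>x \<in> {0..1}\<close> show "\<exists>y\<in>{0..1}. ennreal \<bar>F k x - 0\<bar> \<le> ennreal \<bar>hi n Y y - lo n Y y\<bar>"
            by (intro bexI [of _ x] ennreal_leI) auto
        qed
        finally have "Y \<in> D" using Y by (auto simp: D_def A_def covering_def)
        with Y show False by simp
      qed
      then have "Q.prob U + Q.prob ?C = Q.prob (U \<union> ?C)"
        using U meas [OF FP [OF k]] by (intro Q.finite_measure_Union [symmetric]) auto
      also have "\<dots> \<le> 1" by simp
      finally show ?thesis using cover [OF FP [OF k]] by linarith
    qed
    define V where "V = \<theta> * \<sigma>\<^sup>2 * ln (real n)"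
    have "N.prob U \<le> (\<alpha> + \<eta>) + \<eta> / 2 + exp (V / \<sigma>\<^sup>2) / real M / (2 * \<eta>)"
    proof (rule mixture_indistinguishable [OF \<sigma> \<eta>])
      show "0 < M" by (simp add: M_def)
      show "F k (real i / real n) * F l (real i / real n) = 0"
        if "k < M" "l < M" "k \<noteq> l" "i \<in> {1..n}" for k l i
        unfolding F_def
      proof (rule bumps_disjoint [OF Jj Mp [OF that(1)] Mp [OF that(2)]])
        have "1 \<le> \<bar>real k - real l\<bar>" using that(3) by linarith
        then have "1 * real p \<le> \<bar>real k - real l\<bar> * real p" by (intro mult_right_mono) auto
        also have "\<dots> = \<bar>(real k - real l) * real p\<bar>" by (simp add: abs_mult)
        finally show "2 * K < \<bar>real (k * p) - real (l * p)\<bar>" using p by (simp add: left_diff_distrib)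
        show "real i / real n \<in> {0..1}" using that(4) by auto
      qed
      show "(\<Sum>i=1..n. (F k (real i / real n))\<^sup>2) \<le> V" if "k < M" for k
      proof -
        have "(\<Sum>i=1..n. (F k (real i / real n))\<^sup>2) \<le>
            \<beta>\<^sup>2 * 2 powr (- (real (j n) * (2 * r + 1))) * (3 * K ^ 3 * real n)"
          unfolding F_def by (rule bump_energy [OF Jj Mp [OF that] n1 jn])
        also have "2 powr (- (real (j n) * (2 * r + 1))) = (2 ^ j n) powr (- (2 * r + 1))"
          by (simp only: two_power_powr mult_minus_right)
        also have "\<beta>\<^sup>2 * (2 ^ j n) powr (- (2 * r + 1)) * (3 * K ^ 3 * real n) \<le>
            \<beta>\<^sup>2 * (ln (real n) / real n) * (3 * K ^ 3 * real n)"
          unfolding ln_over_n_eq [OF n rs(1)] using K0 rs inverse_bandwidth_ge_1 [OF n rs(1)]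
            resolution_bounds(1) [OF n rs(1)]
          by (intro mult_right_mono mult_left_mono powr_mono2') (auto simp: j_def)
        also have "\<dots> = \<beta>\<^sup>2 * (3 * K ^ 3) * ln (real n)" using n1 by simp
        also have "\<dots> \<le> \<theta> * \<sigma>\<^sup>2 * ln (real n)"
          using \<beta>2 \<sigma> ln_ge_1 [OF n] by (intro mult_right_mono) (auto simp: field_simps)
        finally show ?thesis by (simp add: V_def)
      qed
    qed (use U q in auto)
    moreover have "exp (V / \<sigma>\<^sup>2) / real M \<le> \<eta>\<^sup>2"
    proof -
      have e1: "exp (V / \<sigma>\<^sup>2) = real n powr \<theta>"
        using \<sigma> n1 by (simp add: V_def powr_def)
      have "2 ^ j n \<le> p * M"
      proof -
        have "2 ^ j n - 1 < p * M" unfolding M_def using p(2)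
          by (metis Suc_eq_plus1 dividend_less_times_div mult_Suc_right add.commute)
        then show ?thesis by linarith
      qed
      then have "real (2 ^ j n) \<le> real (p * M)" by (simp only: of_nat_le_iff)
      then have "inverse_bandwidth n r \<le> real p * real M"
        using resolution_bounds(1) [OF n rs(1)] by (simp add: j_def)
      then have "1 / (real p * real M) \<le> 1 / inverse_bandwidth n r"
        using inverse_bandwidth_ge_1 [OF n rs(1)] by (intro divide_left_mono) (auto intro: mult_pos_pos)
      then have "exp (V / \<sigma>\<^sup>2) * real p * (1 / (real p * real M)) \<le> exp (V / \<sigma>\<^sup>2) * real p * (1 / inverse_bandwidth n r)"
        by (intro mult_left_mono) auto
      then have "exp (V / \<sigma>\<^sup>2) / real M \<le> real p * (real n powr \<theta> / inverse_bandwidth n r)"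
        using p(2) by (simp add: e1 mult_ac)
      also have "real n powr \<theta> / inverse_bandwidth n r = ln (real n) powr (2 * \<theta>) * real n powr (- \<theta>)"
      proof -
        have "1 / (2 * r + 1) = 2 * \<theta>" using rs by (simp add: \<theta>_def divide_simps)
        then have "inverse_bandwidth n r = real n powr (2 * \<theta>) / ln (real n) powr (2 * \<theta>)"
          using ln_ge_1 [OF n] by (simp add: inverse_bandwidth_def powr_divide)
        moreover have "real n powr (2 * \<theta>) = real n powr \<theta> * real n powr \<theta>"
          by (simp add: powr_add [symmetric])
        ultimately show ?thesis using n1 by (simp add: powr_minus field_simps)
      qed
      finally show ?thesis using chi by linarith
    qed
    then have "exp (V / \<sigma>\<^sup>2) / real M / (2 * \<eta>) \<le> \<eta>\<^sup>2 / (2 * \<eta>)"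
      using \<eta> by (intro divide_right_mono) auto
    moreover have "\<eta>\<^sup>2 / (2 * \<eta>) = \<eta> / 2" using \<eta> by (simp add: power2_eq_square)
    ultimately have "1 - \<alpha> - 2 * \<eta> < \<alpha> + \<eta> + \<eta> / 2 + \<eta> / 2" using PU by linarith
    then show False using \<alpha> by (simp add: \<eta>_def field_simps)
  qed
qed

end

section \<open>Estimation of the wavelet coefficients\<close>

context regular_basis
begin

definition estimator :: "nat \<Rightarrow> real \<Rightarrow> (nat \<Rightarrow> real) \<Rightarrow> real \<Rightarrow> real" where
  "estimator n t Y x = (\<Sum>i\<in>indices_between J 0 (resolution n t). empirical_coef n Y i * e i x)"

text \<open>
  The good event, on which all further reasoning is deterministic.
\<close>

definition accurate :: "(nat \<Rightarrow> nat \<Rightarrow> real) \<Rightarrow> nat \<Rightarrow> real \<Rightarrow> (real \<Rightarrow> real) \<Rightarrow> (nat \<Rightarrow> real) \<Rightarrow> bool" where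
  "accurate \<delta> n t f Y \<longleftrightarrow>
     (\<forall>i\<in>indices_between J 0 (resolution n t). \<bar>empirical_coef n Y i - coef f i\<bar> \<le> \<delta> n (\<l> i))"

lemma empirical_coef_measurable [measurable]:
  "(\<lambda>Y. empirical_coef n Y i) \<in> borel_measurable (sample_space n)"
  unfolding empirical_coef_def by measurable

lemma accurate_sets [measurable]: "Measurable.pred (sample_space n) (accurate \<delta> n t f)"
  unfolding accurate_def by measurable

lemma card_indices_between: "card (indices_between J 0 j) \<le> 2 * 2 ^ j"
proof -
  have "card (indices_between J 0 j) \<le> (\<Sum>l\<in>{0..<j}. card {i \<in> I. \<l> i = l})"
    unfolding indices_between_eq by (rule card_UN_le) simp
  also have "\<dots> \<le> (\<Sum>l\<in>{0..<j}. 2 * 2 ^ l)" by (intro sum_mono card_level)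
  also have "\<dots> \<le> 2 * 2 ^ j" by (induction j) auto
  finally show ?thesis .
qed

text \<open>
  The constant 12 makes the tail of order n^(-2), so that a union over the order of n coefficients
  still has a probability of order 1/n.
\<close>

lemma empirical_coef_deviation:
  assumes \<sigma>: "0 < \<sigma>" and n: "3 \<le> n" and i: "i \<in> I" "2 ^ \<l> i \<le> n"
  shows "measure (noise \<sigma> n) {\<epsilon> \<in> space (noise \<sigma> n).
      sqrt (12 * \<sigma>\<^sup>2 * K ^ 3) * sqrt (ln (real n) / real n) \<le> \<bar>empirical_coef n \<epsilon> i\<bar>} \<le> 2 / (real n)\<^sup>2"
proof -
  define c where "c k = e i (real k / real n) / real n" for k
  define V where "V = 3 * K ^ 3 / real n"
  define x where "x = sqrt (12 * \<sigma>\<^sup>2 * K ^ 3) * sqrt (ln (real n) / real n)"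
  have K0: "0 < K" using K_ge_1 by simp
  have V: "0 < V" using K0 n by (simp add: V_def)
  have "(\<Sum>k=1..n. (c k)\<^sup>2) = (\<Sum>k=1..n. (e i (real k / real n))\<^sup>2) / (real n)\<^sup>2"
    by (simp add: c_def power_divide sum_divide_distrib)
  also have "\<dots> \<le> 3 * K ^ 3 * real n / (real n)\<^sup>2"
    using design_square_sum [OF i(1) _ i(2)] n by (intro divide_right_mono) auto
  also have "\<dots> = V" using n by (simp add: V_def power2_eq_square)
  finally have cV: "(\<Sum>k=1..n. (c k)\<^sup>2) \<le> V" .
  have x: "0 < x" using \<sigma> K0 n ln_ge_1 [OF n] by (simp add: x_def)
  have "x\<^sup>2 = 12 * \<sigma>\<^sup>2 * K ^ 3 * (ln (real n) / real n)"
    using \<sigma> K0 n ln_ge_1 [OF n] by (simp add: x_def power_mult_distrib)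
  then have "- x\<^sup>2 / (2 * \<sigma>\<^sup>2 * V) = - 2 * ln (real n)"
    using \<sigma> K0 n by (simp add: V_def field_simps)
  then have "exp (- x\<^sup>2 / (2 * \<sigma>\<^sup>2 * V)) = real n powr (- 2)"
    using n by (simp add: powr_def)
  then have ex: "exp (- x\<^sup>2 / (2 * \<sigma>\<^sup>2 * V)) = 1 / (real n)\<^sup>2"
    using n by (simp add: powr_minus inverse_eq_divide)
  have "(\<Sum>k=1..n. c k * \<epsilon> k) = empirical_coef n \<epsilon> i" for \<epsilon>
    by (simp add: c_def empirical_coef_def sum_divide_distrib)
  with noise_tail [OF \<sigma> cV V x] ex show ?thesis by (simp add: x_def)
qed

text \<open>
  The allowance \<delta> is the noise level plus the discretisation bias. Its weighted sum over the levels,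
  which controls the error in the supremum norm, is of the order of the rate.
\<close>

lemma coefficient_estimation:
  assumes t: "0 < t" and B: "0 < B" and \<sigma>: "0 < \<sigma>"
  shows "\<exists>\<delta> C. 0 \<le> C \<and> (\<forall>n l. 3 \<le> n \<longrightarrow> 0 \<le> \<delta> n l) \<and>
    (\<forall>n\<ge>3. (\<Sum>l<resolution n t. \<delta> n l * 2 powr (real l / 2)) \<le> C * rate n t) \<and>
    (\<forall>n\<ge>3. \<forall>f\<in>holder_ball J phi psi B t.
       measure (data_law \<sigma> n f) {Y \<in> space (sample_space n). \<not> accurate \<delta> n t f Y} \<le> 8 / real n)"
proof -
  define v where "v = t / (2 * t + 1)"
  \<comment> \<open>above the exponent v of the rate, below the smoothness t, and at most 1\<close>
  define u where "u = (v + min t 1) / 2"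
  have u: "v < u" "u < t" "u \<le> 1" "0 < u"
  proof -
    have "0 < v" "v < t" "v < 1" using exponent_bounds [OF t] by (auto simp: v_def)
    then show "v < u" "u < t" "u \<le> 1" "0 < u" by (auto simp: u_def min_def)
  qed
  define W where "W = B * 2 powr (real J * (t + 1 / 2))"
  have W: "0 \<le> W" using B by (simp add: W_def)
  have less: "(2::real) powr (- t) < 1" "(2::real) powr (- (t - u)) < 1"
    using powr_less_mono [of "- t" 0 2] powr_less_mono [of "- (t - u)" 0 2] t u by auto
  define F where "F = 6 * K\<^sup>2 * W / (1 - 2 powr (- t))"
  define D where "D = 24 * K\<^sup>2 * W / (1 - 2 powr (- (t - u)))"
  have FD: "0 \<le> F" "0 \<le> D" using less W by (simp_all add: F_def D_def)
  define A A' where "A = 5 * K\<^sup>2 * F" and "A' = 5 * K\<^sup>2 * D"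
  have A: "0 \<le> A" "0 \<le> A'" using FD by (simp_all add: A_def A'_def)
  define \<kappa> where "\<kappa> = sqrt (12 * \<sigma>\<^sup>2 * K ^ 3)"
  have \<kappa>: "0 \<le> \<kappa>" using K_ge_1 by (simp add: \<kappa>_def)
  define \<delta> where "\<delta> n l = \<kappa> * sqrt (ln (real n) / real n) +
      (A * (2 powr (real l / 2) / real n) + A' * (real n powr (- u) * 2 powr (- (real l / 2))))"
    for n l :: nat
  define C where "C = \<kappa> * (3 * sqrt 2) + 2 * A + 3 * A' / (u - v)"
  have "0 \<le> C" using A \<kappa> u by (simp add: C_def)
  moreover have "0 \<le> \<delta> n l" if "3 \<le> n" for n l
    using A \<kappa> ln_ge_1 [OF that] by (simp add: \<delta>_def)
  moreover have "(\<Sum>l<resolution n t. \<delta> n l * 2 powr (real l / 2)) \<le> C * rate n t" if "3 \<le> n" for n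
    unfolding \<delta>_def C_def v_def using u by (intro sum_error_le_rate that t \<kappa> A) (simp add: v_def)
  moreover have "measure (data_law \<sigma> n f) {Y \<in> space (sample_space n). \<not> accurate \<delta> n t f Y} \<le> 8 / real n"
    if n: "3 \<le> n" and f: "f \<in> holder_ball J phi psi B t" for n f
  proof -
    interpret N: prob_space "noise \<sigma> n" by (rule prob_space_noise [OF \<sigma>])
    have smooth: "smooth W t f" unfolding W_def using B t f by (intro holder_ball_smooth) auto
    then have cont: "continuous_on {0..1} f" by (simp add: smooth_def)
    let ?S = "indices_between J 0 (resolution n t)"
    let ?E = "\<lambda>i. {\<epsilon> \<in> space (noise \<sigma> n). \<kappa> * sqrt (ln (real n) / real n) \<le> \<bar>empirical_coef n \<epsilon> i\<bar>}"
    let ?T = "\<lambda>\<epsilon>. \<lambda>i\<in>{1..n}. f (real i / real n) + \<epsilon> i"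
    have sub: "?T -` {Y \<in> space (sample_space n). \<not> accurate \<delta> n t f Y} \<inter> space (noise \<sigma> n) \<subseteq> (\<Union>i\<in>?S. ?E i)"
    proof
      fix \<epsilon> assume "\<epsilon> \<in> ?T -` {Y \<in> space (sample_space n). \<not> accurate \<delta> n t f Y} \<inter> space (noise \<sigma> n)"
      then obtain i where \<epsilon>: "\<epsilon> \<in> space (noise \<sigma> n)" and i: "i \<in> ?S"
        and dev: "\<delta> n (\<l> i) < \<bar>empirical_coef n (?T \<epsilon>) i - coef f i\<bar>"
        by (auto simp: accurate_def not_le)
      have iI: "i \<in> I" "\<l> i < resolution n t" using i by (auto simp: indices_between_def)
      have "empirical_coef n (?T \<epsilon>) i = empirical_coef n (\<lambda>k. f (real k / real n)) i + empirical_coef n \<epsilon> i"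
        by (simp add: empirical_coef_def add_divide_distrib [symmetric] sum.distrib [symmetric] distrib_left)
      moreover have "\<bar>empirical_coef n (\<lambda>k. f (real k / real n)) i - coef f i\<bar> \<le>
          5 * K\<^sup>2 * (F * 2 powr (real (\<l> i) / 2) / real n + D * real n powr (- u) * 2 powr (- (real (\<l> i) / 2)))"
      proof (rule riemann_error [OF iI(1) _ level_le_n [OF n t iI(2)] cont])
        show "\<bar>f x\<bar> \<le> F" if "x \<in> {0..1}" for x
          unfolding F_def by (rule smooth_bounded [OF smooth t W that])
        show "\<bar>f x - f y\<bar> \<le> D * \<bar>x - y\<bar> powr u" if "x \<in> {0..1}" "y \<in> {0..1}" for x y
          unfolding D_def by (rule smooth_holder [OF smooth u(4,3,2) W that])
      qed (use n u FD in auto)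
      moreover have "\<dots> = A * (2 powr (real (\<l> i) / 2) / real n) + A' * (real n powr (- u) * 2 powr (- (real (\<l> i) / 2)))"
        by (simp add: A_def A'_def distrib_left)
      ultimately have "\<kappa> * sqrt (ln (real n) / real n) \<le> \<bar>empirical_coef n \<epsilon> i\<bar>"
        using dev unfolding \<delta>_def by linarith
      with \<epsilon> i show "\<epsilon> \<in> (\<Union>i\<in>?S. ?E i)" by blast
    qed
    have "measure (data_law \<sigma> n f) {Y \<in> space (sample_space n). \<not> accurate \<delta> n t f Y} =
        N.prob (?T -` {Y \<in> space (sample_space n). \<not> accurate \<delta> n t f Y} \<inter> space (noise \<sigma> n))"
      unfolding data_law_def by (rule measure_distr [OF measurable_data]) measurable
    also have "\<dots> \<le> N.prob (\<Union>i\<in>?S. ?E i)"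
      by (rule N.finite_measure_mono [OF sub]) measurable
    also have "\<dots> \<le> (\<Sum>i\<in>?S. N.prob (?E i))"
    proof (rule N.finite_measure_subadditive_finite [OF finite_indices_between])
      show "?E ` ?S \<subseteq> sets (noise \<sigma> n)" by (intro image_subsetI) measurable
    qed
    also have "\<dots> \<le> (\<Sum>i\<in>?S. 2 / (real n)\<^sup>2)"
      unfolding \<kappa>_def using level_le_n [OF n t]
      by (intro sum_mono empirical_coef_deviation \<sigma> n) (auto simp: indices_between_def)
    also have "\<dots> = real (card ?S) * (2 / (real n)\<^sup>2)" by simp
    also have "\<dots> \<le> (4 * real n) * (2 / (real n)\<^sup>2)"
    proof (rule mult_right_mono)
      have "real (card ?S) \<le> real (2 * 2 ^ resolution n t)"
        using card_indices_between by (simp only: of_nat_le_iff)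
      then show "real (card ?S) \<le> 4 * real n"
        using resolution_bounds(2) [OF n t] inverse_bandwidth_le [OF n t] by simp
    qed simp
    also have "\<dots> = 8 / real n" using n by (simp add: power2_eq_square)
    finally show ?thesis .
  qed
  ultimately show ?thesis by blast
qed

text \<open>
  The error splits into the truncated tail of the wavelet series of f and the coefficient errors below
  the resolution.
\<close>

lemma estimator_error:
  assumes t: "0 < t" and B: "0 < B" and n: "3 \<le> n" and f: "f \<in> holder_ball J phi psi B t"
    and \<delta>: "\<And>l. 0 \<le> \<delta> n l" "(\<Sum>l<resolution n t. \<delta> n l * 2 powr (real l / 2)) \<le> C * rate n t"
    and acc: "accurate \<delta> n t f Y" and x: "x \<in> {0..1}"
  shows "\<bar>f x - estimator n t Y x\<bar> \<le>
    (6 * K\<^sup>2 * (B * 2 powr (real J * (t + 1 / 2))) / (1 - 2 powr (- t)) + 6 * K\<^sup>2 * C) * rate n t"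
proof -
  define W where "W = B * 2 powr (real J * (t + 1 / 2))"
  define j where "j = resolution n t"
  have W: "0 \<le> W" using B by (simp add: W_def)
  have smooth: "smooth W t f" unfolding W_def using B t f by (intro holder_ball_smooth) auto
  have less: "(2::real) powr (- t) < 1" using powr_less_mono [of "- t" 0 2] t by simp
  have "\<bar>f x - partial f j x\<bar> \<le> 6 * K\<^sup>2 * W / (1 - 2 powr (- t)) * 2 powr (- (real j * t))"
    by (rule wavelet_approximation [OF smooth t W x])
  also have "\<dots> \<le> 6 * K\<^sup>2 * W / (1 - 2 powr (- t)) * rate n t"
    unfolding j_def using W less by (intro mult_left_mono resolution_powr_le_rate n t) auto
  finally have 1: "\<bar>f x - partial f j x\<bar> \<le> 6 * K\<^sup>2 * W / (1 - 2 powr (- t)) * rate n t" .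
  have "\<bar>estimator n t Y x - partial f j x\<bar> =
      \<bar>\<Sum>i\<in>indices_between J 0 j. (empirical_coef n Y i - coef f i) * e i x\<bar>"
    by (simp add: estimator_def partial_def j_def sum_subtractf left_diff_distrib)
  also have "\<dots> \<le> 6 * K\<^sup>2 * (\<Sum>l=0..<j. \<delta> n l * 2 powr (real l / 2))"
    using acc \<delta>(1) by (intro level_sum_bound x) (auto simp: accurate_def indices_between_def j_def)
  also have "\<dots> \<le> 6 * K\<^sup>2 * (C * rate n t)"
    using \<delta>(2) by (intro mult_left_mono) (auto simp: j_def atLeast0LessThan)
  finally have "\<bar>estimator n t Y x - partial f j x\<bar> \<le> 6 * K\<^sup>2 * C * rate n t" by simp
  with 1 show ?thesis unfolding distrib_right W_def by linarith
qed

text \<open>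
  The test of smoothness s. It inspects the levels below the resolution for smoothness r, which is
  fine enough to detect a distance of order r_n(r).
\<close>

definition accepts :: "real \<Rightarrow> real \<Rightarrow> real \<Rightarrow> (nat \<Rightarrow> nat \<Rightarrow> real) \<Rightarrow> nat \<Rightarrow> (nat \<Rightarrow> real) \<Rightarrow> bool" where
  "accepts B r s \<delta> n Y \<longleftrightarrow>
     (\<forall>i\<in>indices_between J 0 (resolution n r). \<bar>empirical_coef n Y i\<bar> \<le> threshold B s i + \<delta> n (\<l> i))"

lemma accepts_sets [measurable]: "Measurable.pred (sample_space n) (accepts B r s \<delta> n)"
  unfolding accepts_def by measurable

lemma accepts_if_smooth:
  assumes "0 < B" "f \<in> holder_ball J phi psi B s" "accurate \<delta> n r f Y"
  shows "accepts B r s \<delta> n Y"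
  unfolding accepts_def
proof
  fix i assume i: "i \<in> indices_between J 0 (resolution n r)"
  then have "\<bar>coef f i\<bar> \<le> threshold B s i"
    using assms(1,2) indices_between_subset by (auto simp: holder_ball_iff)
  moreover have "\<bar>empirical_coef n Y i - coef f i\<bar> \<le> \<delta> n (\<l> i)"
    using assms(3) i by (simp add: accurate_def)
  ultimately show "\<bar>empirical_coef n Y i\<bar> \<le> threshold B s i + \<delta> n (\<l> i)" by linarith
qed

text \<open>
  Clipping the coefficients of f at the bounds of the ball of smoothness s, and discarding the high
  levels, yields a member of that ball. When the test accepts on the good event, no coefficient is
  changed by more than 2 \<delta>.
\<close>

lemma near_smooth_if_accepts:
  assumes r: "0 < r" and B: "0 < B" and n: "3 \<le> n" and f: "f \<in> holder_ball J phi psi B r"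
    and \<delta>: "\<And>l. 0 \<le> \<delta> n l" "(\<Sum>l<resolution n r. \<delta> n l * 2 powr (real l / 2)) \<le> C * rate n r"
    and C: "0 \<le> C"
    and acc: "accurate \<delta> n r f Y" and test: "accepts B r s \<delta> n Y"
  shows "sup_dist f (holder_ball J phi psi B s) \<le>
    ennreal ((6 * K\<^sup>2 * (B * 2 powr (real J * (r + 1 / 2))) / (1 - 2 powr (- r)) + 12 * K\<^sup>2 * C) * rate n r)"
proof -
  define W where "W = B * 2 powr (real J * (r + 1 / 2))"
  define j where "j = resolution n r"
  have W: "0 \<le> W" using B by (simp add: W_def)
  have smooth: "smooth W r f" unfolding W_def using B r f by (intro holder_ball_smooth) auto
  have less: "(2::real) powr (- r) < 1" using powr_less_mono [of "- r" 0 2] r by simp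
  \<comment> \<open>the coefficient of f, clipped\<close>
  define a where "a i = max (- threshold B s i) (min (threshold B s i) (coef f i))" for i
  define g where "g x = (\<Sum>i\<in>indices_between J 0 j. a i * e i x)" for x
  have th: "0 \<le> threshold B s i" for i using B by (simp add: threshold_nonneg)
  have "g \<in> holder_ball J phi psi B s"
  proof -
    have "continuous_on {0..1} g" unfolding g_def by (intro continuous_partial indices_between_subset)
    moreover have "\<bar>coef g i\<bar> \<le> threshold B s i" if "i \<in> I" for i
    proof -
      have "\<bar>a i\<bar> \<le> threshold B s i" using th [of i] by (auto simp: a_def abs_le_iff)
      then show ?thesis unfolding g_def
        by (subst coef_sum [OF finite_indices_between indices_between_subset that]) (simp add: th)
    qed
    ultimately show ?thesis using B by (simp add: holder_ball_iff)
  qed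
  then have "sup_dist f (holder_ball J phi psi B s) \<le> sup_norm (\<lambda>x. f x - g x)"
    unfolding sup_dist_def by (rule INF_lower)
  also have "\<dots> \<le> ennreal ((6 * K\<^sup>2 * W / (1 - 2 powr (- r)) + 12 * K\<^sup>2 * C) * rate n r)"
    unfolding sup_norm_def
  proof (intro SUP_least ennreal_leI)
    fix x :: real assume x: "x \<in> {0..1}"
    have "\<bar>f x - partial f j x\<bar> \<le> 6 * K\<^sup>2 * W / (1 - 2 powr (- r)) * 2 powr (- (real j * r))"
      by (rule wavelet_approximation [OF smooth r W x])
    also have "\<dots> \<le> 6 * K\<^sup>2 * W / (1 - 2 powr (- r)) * rate n r"
      unfolding j_def using W less by (intro mult_left_mono resolution_powr_le_rate n r) auto
    finally have 1: "\<bar>f x - partial f j x\<bar> \<le> 6 * K\<^sup>2 * W / (1 - 2 powr (- r)) * rate n r" .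
    have "\<bar>partial f j x - g x\<bar> = \<bar>\<Sum>i\<in>indices_between J 0 j. (coef f i - a i) * e i x\<bar>"
      by (simp add: g_def partial_def sum_subtractf left_diff_distrib)
    also have "\<dots> \<le> 6 * K\<^sup>2 * (\<Sum>l=0..<j. (2 * \<delta> n l) * 2 powr (real l / 2))"
    proof (intro level_sum_bound x)
      fix i assume "i \<in> I" "\<l> i < j"
      then have i: "i \<in> indices_between J 0 (resolution n r)" by (simp add: indices_between_def j_def)
      have "\<bar>empirical_coef n Y i - coef f i\<bar> \<le> \<delta> n (\<l> i)" using acc i by (simp add: accurate_def)
      moreover have "\<bar>empirical_coef n Y i\<bar> \<le> threshold B s i + \<delta> n (\<l> i)"
        using test i by (simp add: accepts_def)
      ultimately have "\<bar>coef f i\<bar> \<le> threshold B s i + 2 * \<delta> n (\<l> i)" by linarith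
      then show "\<bar>coef f i - a i\<bar> \<le> 2 * \<delta> n (\<l> i)"
        using th [of i] \<delta>(1) [of "\<l> i"] unfolding a_def by (auto simp: max_def min_def abs_le_iff)
    qed (use \<delta>(1) in auto)
    also have "\<dots> = 12 * K\<^sup>2 * (\<Sum>l<j. \<delta> n l * 2 powr (real l / 2))"
      by (simp add: sum_distrib_left mult_ac atLeast0LessThan)
    also have "\<dots> \<le> 12 * K\<^sup>2 * (C * rate n r)"
      using \<delta>(2) by (intro mult_left_mono) (auto simp: j_def)
    finally have "\<bar>partial f j x - g x\<bar> \<le> 12 * K\<^sup>2 * C * rate n r" by simp
    with 1 show "\<bar>f x - g x\<bar> \<le> (6 * K\<^sup>2 * W / (1 - 2 powr (- r)) + 12 * K\<^sup>2 * C) * rate n r"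
      unfolding distrib_right by linarith
  qed
  finally show ?thesis by (simp only: W_def)
qed

end

section \<open>An honest adaptive band\<close>

lemma diameter_const:
  assumes "\<And>y. y \<in> {0..1} \<Longrightarrow> hi n Y y - lo n Y y = d" "0 \<le> d"
  shows "diameter lo hi n Y = ennreal d"
proof -
  have "diameter lo hi n Y = (SUP y\<in>{0..1::real}. ennreal d)"
    unfolding diameter_def using assms by (intro SUP_cong) auto
  then show ?thesis by simp
qed

text \<open>
  By continuity, covering needs to be checked on a countable dense set of points only.
\<close>

lemma covering_sets:
  assumes f: "continuous_on {0..1} f"
    and cont: "\<And>Y. continuous_on {0..1} (lo n Y)" "\<And>Y. continuous_on {0..1} (hi n Y)"
    and [measurable]: "\<And>y. (\<lambda>Y. lo n Y y) \<in> borel_measurable (sample_space n)"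
      "\<And>y. (\<lambda>Y. hi n Y y) \<in> borel_measurable (sample_space n)"
  shows "covering lo hi n f \<in> sets (sample_space n)"
proof -
  obtain T where T: "countable T" "T \<subseteq> {0..1::real}" "{0..1} \<subseteq> closure T" by (rule separable)
  have cl: "closure T = {0..1}" using T closure_minimal [of T "{0..1}"] by auto
  have ext: "\<forall>y\<in>{0..1}. lo n Y y \<le> f y \<and> f y \<le> hi n Y y"
    if "\<forall>y\<in>T. lo n Y y \<le> f y \<and> f y \<le> hi n Y y" for Y
  proof
    fix y :: real assume y: "y \<in> {0..1}"
    have "lo n Y y - f y \<le> 0"
      by (rule continuous_le_on_closure [of T "\<lambda>y. lo n Y y - f y"])
        (use y that in \<open>auto simp: cl intro!: continuous_intros f cont\<close>)
    moreover have "f y - hi n Y y \<le> 0"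
      by (rule continuous_le_on_closure [of T "\<lambda>y. f y - hi n Y y"])
        (use y that in \<open>auto simp: cl intro!: continuous_intros f cont\<close>)
    ultimately show "lo n Y y \<le> f y \<and> f y \<le> hi n Y y" by simp
  qed
  have "T \<noteq> {}" using T(3) by auto
  then have range: "(\<forall>y\<in>T. R y) \<longleftrightarrow> (\<forall>k. R (from_nat_into T k))" for R
    by (metis T(1) from_nat_into from_nat_into_surj)
  have "covering lo hi n f = {Y \<in> space (sample_space n). \<forall>y\<in>T. lo n Y y \<le> f y \<and> f y \<le> hi n Y y}"
    unfolding covering_def using ext T(2) by auto
  also have "\<dots> \<in> sets (sample_space n)"
    unfolding range by measurable
  finally show ?thesis .
qed

context regular_basis
begin

lemma continuous_estimator: "continuous_on {0..1} (estimator n t Y)"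
  unfolding estimator_def by (intro continuous_partial indices_between_subset)

lemma estimator_measurable [measurable]:
  "(\<lambda>Y. estimator n t Y y) \<in> borel_measurable (sample_space n)"
  unfolding estimator_def by measurable

text \<open>
  On \<Sigma>(s) the wide band occurs with probability at most 8/n, which is below a multiple of r_n(s); this
  is why it does not spoil the expected diameter.
\<close>

theorem adaptive_band_exists:
  fixes B r s \<sigma> \<alpha> :: real
  defines "\<Sigma> \<equiv> holder_ball J phi psi B"
  defines "\<Sigma>tilde \<equiv> \<lambda>\<rho> n. separated (\<Sigma> r) (\<Sigma> s) (\<rho> n)"
  assumes rs: "0 < r" "r < s" and B: "0 < B" and \<sigma>: "0 < \<sigma>" and \<alpha>: "0 < \<alpha>"
  shows "\<exists>\<rho>. (\<forall>n\<ge>1. 0 < \<rho> n) \<and> limsup (\<lambda>n. ereal (\<rho> n / rate n r)) < \<infinity> \<and>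
    (\<exists>lo hi. confidence_band lo hi \<and>
      asymptotically_honest \<sigma> lo hi \<alpha> (\<lambda>n. \<Sigma> s \<union> \<Sigma>tilde \<rho> n) \<and>
      adaptive \<sigma> lo hi r s (\<Sigma> s) (\<Sigma>tilde \<rho>))"
proof -
  have s: "0 < s" using rs by simp
  obtain \<delta>r Cr where r1: "0 \<le> Cr" "\<And>n l. 3 \<le> n \<Longrightarrow> 0 \<le> \<delta>r n l"
    "\<And>n. 3 \<le> n \<Longrightarrow> (\<Sum>l<resolution n r. \<delta>r n l * 2 powr (real l / 2)) \<le> Cr * rate n r"
    "\<And>n f. 3 \<le> n \<Longrightarrow> f \<in> \<Sigma> r \<Longrightarrow>
       measure (data_law \<sigma> n f) {Y \<in> space (sample_space n). \<not> accurate \<delta>r n r f Y} \<le> 8 / real n"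
    using coefficient_estimation [OF rs(1) B \<sigma>] unfolding \<Sigma>_def by blast
  obtain \<delta>s Cs where s1: "0 \<le> Cs" "\<And>n l. 3 \<le> n \<Longrightarrow> 0 \<le> \<delta>s n l"
    "\<And>n. 3 \<le> n \<Longrightarrow> (\<Sum>l<resolution n s. \<delta>s n l * 2 powr (real l / 2)) \<le> Cs * rate n s"
    "\<And>n f. 3 \<le> n \<Longrightarrow> f \<in> \<Sigma> s \<Longrightarrow>
       measure (data_law \<sigma> n f) {Y \<in> space (sample_space n). \<not> accurate \<delta>s n s f Y} \<le> 8 / real n"
    using coefficient_estimation [OF s B \<sigma>] unfolding \<Sigma>_def by blast
  define Gr where "Gr = 6 * K\<^sup>2 * (B * 2 powr (real J * (r + 1 / 2))) / (1 - 2 powr (- r))"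
  define Gs where "Gs = 6 * K\<^sup>2 * (B * 2 powr (real J * (s + 1 / 2))) / (1 - 2 powr (- s))"
  have less: "(2::real) powr (- r) < 1" "(2::real) powr (- s) < 1"
    using powr_less_mono [of "- r" 0 2] powr_less_mono [of "- s" 0 2] rs s by auto
  have G: "0 \<le> Gr" "0 \<le> Gs" using less B by (simp_all add: Gr_def Gs_def)
  define Hr Hs where "Hr = Gr + 6 * K\<^sup>2 * Cr" and "Hs = Gs + 6 * K\<^sup>2 * Cs"
  have H: "0 \<le> Hr" "0 \<le> Hs" using G r1(1) s1(1) by (simp_all add: Hr_def Hs_def)
  define Q where "Q = Gr + 12 * K\<^sup>2 * Cr"
  have Q: "0 \<le> Q" using G r1(1) by (simp add: Q_def)
  \<comment> \<open>Sample sizes below 3 are set apart: the rate is 0 for n = 1, so the band must have zero width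
    there, and the comparisons of rates rely on ln n \<ge> 1.\<close>
  define \<rho> where "\<rho> n = (if n < 3 then 1 else (Q + 1) * rate n r)" for n
  define acc where "acc = accepts B r s \<delta>r"
  have [measurable]: "Measurable.pred (sample_space n) (acc n)" for n unfolding acc_def by (rule accepts_sets)
  define center where "center n Y y = (if n < 3 then 0 else
      if acc n Y then estimator n s Y y else estimator n r Y y)" for n Y y
  define width where "width n Y = (if n < 3 then 0 else
      if acc n Y then Hs * rate n s else Hr * rate n r)" for n Y
  define lo where "lo n Y y = center n Y y - width n Y" for n Y y
  define hi where "hi n Y y = center n Y y + width n Y" for n Y y
  have rate0: "0 \<le> rate n t" for n t by (simp add: rate_def)
  have width0: "0 \<le> width n Y" for n Y using H rate0 by (simp add: width_def)
  have center_meas [measurable]: "(\<lambda>Y. center n Y y) \<in> borel_measurable (sample_space n)" for n y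
    unfolding center_def by measurable
  have width_meas [measurable]: "width n \<in> borel_measurable (sample_space n)" for n
    unfolding width_def by measurable
  have center_cont: "continuous_on {0..1} (center n Y)" for n Y
  proof -
    have "center n Y = (if n < 3 then (\<lambda>_. 0) else if acc n Y then estimator n s Y else estimator n r Y)"
      by (auto simp: center_def)
    then show ?thesis by (simp add: continuous_estimator)
  qed
  have lo_meas [measurable]: "(\<lambda>Y. lo n Y y) \<in> borel_measurable (sample_space n)"
    and hi_meas [measurable]: "(\<lambda>Y. hi n Y y) \<in> borel_measurable (sample_space n)" for n y
    unfolding lo_def hi_def by measurable
  have cover_meas: "covering lo hi n f \<in> sets (sample_space n)" if "continuous_on {0..1} f" for n f
  proof (rule covering_sets [OF that])
    show "continuous_on {0..1} (lo n Y)" "continuous_on {0..1} (hi n Y)" for Y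
      unfolding lo_def hi_def by (intro continuous_intros center_cont)+
  qed measurable
  have diam: "diameter lo hi n Y = ennreal (2 * width n Y)" for n Y
    using width0 by (intro diameter_const) (auto simp: lo_def hi_def)
  have coverI: "Y \<in> covering lo hi n f"
    if "Y \<in> space (sample_space n)" "\<And>y. y \<in> {0..1} \<Longrightarrow> \<bar>f y - center n Y y\<bar> \<le> width n Y" for n Y f
    using that by (force simp: covering_def lo_def hi_def abs_le_iff)
  have sub: "\<Sigma> s \<subseteq> \<Sigma> r" unfolding \<Sigma>_def using B rs by (intro holder_ball_mono) auto
  have cont: "continuous_on {0..1} f" if "f \<in> \<Sigma> t" for f t
    using that by (simp add: \<Sigma>_def holder_ball_def)
  let ?bad = "\<lambda>\<delta> n t f. {Y \<in> space (sample_space n). \<not> accurate \<delta> n t f Y}"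
  have bad_meas: "?bad \<delta> n t f \<in> sets (sample_space n)" for \<delta> n t f by measurable
  have cover_smooth: "1 - 16 / real n \<le> measure (data_law \<sigma> n f) (covering lo hi n f)"
    if n: "3 \<le> n" and f: "f \<in> \<Sigma> s" for n f
  proof -
    interpret D: prob_space "data_law \<sigma> n f" by (rule prob_space_data_law [OF \<sigma>])
    have fr: "f \<in> \<Sigma> r" using f sub by blast
    have inc: "space (data_law \<sigma> n f) - covering lo hi n f \<subseteq> ?bad \<delta>r n r f \<union> ?bad \<delta>s n s f"
    proof (rule subsetI, rule ccontr)
      fix Y assume Y: "Y \<in> space (data_law \<sigma> n f) - covering lo hi n f" "Y \<notin> ?bad \<delta>r n r f \<union> ?bad \<delta>s n s f"
      then have sp: "Y \<in> space (sample_space n)" and a: "accurate \<delta>r n r f Y" "accurate \<delta>s n s f Y" by auto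
      have "acc n Y" unfolding acc_def
        using accepts_if_smooth [OF B _ a(1)] f by (simp add: \<Sigma>_def)
      have "Y \<in> covering lo hi n f"
      proof (rule coverI [OF sp])
        fix y :: real assume y: "y \<in> {0..1}"
        have "\<bar>f y - estimator n s Y y\<bar> \<le> Hs * rate n s"
          unfolding Hs_def Gs_def
          by (rule estimator_error [OF s B n f [unfolded \<Sigma>_def] s1(2) [OF n] s1(3) [OF n] a(2) y])
        then show "\<bar>f y - center n Y y\<bar> \<le> width n Y"
          using \<open>acc n Y\<close> n by (simp add: center_def width_def)
      qed
      with Y show False by simp
    qed
    have "1 - D.prob (covering lo hi n f) = D.prob (space (data_law \<sigma> n f) - covering lo hi n f)"
      using cover_meas [OF cont [OF f]] by (subst D.prob_compl) auto
    also have "\<dots> \<le> D.prob (?bad \<delta>r n r f \<union> ?bad \<delta>s n s f)"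
      using bad_meas by (intro D.finite_measure_mono inc) auto
    also have "\<dots> \<le> D.prob (?bad \<delta>r n r f) + D.prob (?bad \<delta>s n s f)"
      using bad_meas by (intro measure_Un_le) auto
    also have "\<dots> \<le> 8 / real n + 8 / real n"
      by (intro add_mono r1(4) s1(4) n f fr)
    finally show ?thesis by simp
  qed
  have cover_rough: "1 - 16 / real n \<le> measure (data_law \<sigma> n f) (covering lo hi n f)"
    if n: "3 \<le> n" and f: "f \<in> \<Sigma>tilde \<rho> n" for n f
  proof -
    interpret D: prob_space "data_law \<sigma> n f" by (rule prob_space_data_law [OF \<sigma>])
    have fr: "f \<in> \<Sigma> r" and dist: "ennreal (\<rho> n) \<le> sup_dist f (\<Sigma> s)"
      using f by (auto simp: \<Sigma>tilde_def separated_def)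
    have inc: "space (data_law \<sigma> n f) - covering lo hi n f \<subseteq> ?bad \<delta>r n r f"
    proof (rule subsetI, rule ccontr)
      fix Y assume Y: "Y \<in> space (data_law \<sigma> n f) - covering lo hi n f" "Y \<notin> ?bad \<delta>r n r f"
      then have sp: "Y \<in> space (sample_space n)" and a: "accurate \<delta>r n r f Y" by auto
      have "\<not> acc n Y"
      proof
        assume "acc n Y"
        have "sup_dist f (\<Sigma> s) \<le> ennreal (Q * rate n r)"
          unfolding \<Sigma>_def Q_def Gr_def
          by (rule near_smooth_if_accepts [OF rs(1) B n fr [unfolded \<Sigma>_def] r1(2) [OF n] r1(3) [OF n] r1(1) a
                \<open>acc n Y\<close> [unfolded acc_def]])
        with dist have "ennreal (\<rho> n) \<le> ennreal (Q * rate n r)" by (rule order_trans)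
        then have "\<rho> n \<le> Q * rate n r" using Q rate0 by simp
        then show False using n rate_pos [OF n rs(1)] by (simp add: \<rho>_def distrib_right)
      qed
      have "Y \<in> covering lo hi n f"
      proof (rule coverI [OF sp])
        fix y :: real assume y: "y \<in> {0..1}"
        have "\<bar>f y - estimator n r Y y\<bar> \<le> Hr * rate n r"
          unfolding Hr_def Gr_def
          by (rule estimator_error [OF rs(1) B n fr [unfolded \<Sigma>_def] r1(2) [OF n] r1(3) [OF n] a y])
        then show "\<bar>f y - center n Y y\<bar> \<le> width n Y"
          using \<open>\<not> acc n Y\<close> n by (simp add: center_def width_def)
      qed
      with Y show False by simp
    qed
    have "1 - D.prob (covering lo hi n f) = D.prob (space (data_law \<sigma> n f) - covering lo hi n f)"
      using cover_meas [OF cont [OF fr]] by (subst D.prob_compl) auto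
    also have "\<dots> \<le> D.prob (?bad \<delta>r n r f)"
      using bad_meas by (intro D.finite_measure_mono inc) auto
    also have "\<dots> \<le> 8 / real n" by (rule r1(4) [OF n fr])
    also have "\<dots> \<le> 16 / real n" by (simp add: divide_right_mono)
    finally show ?thesis by simp
  qed
  have honest: "asymptotically_honest \<sigma> lo hi \<alpha> (\<lambda>n. \<Sigma> s \<union> \<Sigma>tilde \<rho> n)"
    unfolding asymptotically_honest_def
  proof (intro conjI allI impI ballI)
    fix n f assume "f \<in> \<Sigma> s \<union> \<Sigma>tilde \<rho> n"
    then have "continuous_on {0..1} f" by (auto simp: \<Sigma>tilde_def separated_def intro: cont)
    then show "covering lo hi n f \<in> sets (sample_space n)" by (rule cover_meas)
  next
    have "(\<lambda>n. 16 / real n) \<longlonglongrightarrow> 0" by real_asymp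
    then have "\<forall>\<^sub>F n in sequentially. 16 / real n < \<alpha>" using \<alpha> by (rule order_tendstoD)
    with eventually_ge_at_top [of 3]
    have "\<forall>\<^sub>F n in sequentially. ereal (1 - \<alpha>) \<le>
        (INF f\<in>\<Sigma> s \<union> \<Sigma>tilde \<rho> n. ereal (measure (data_law \<sigma> n f) (covering lo hi n f)))"
    proof eventually_elim
      case (elim n)
      show ?case
      proof (rule INF_greatest)
        fix f assume "f \<in> \<Sigma> s \<union> \<Sigma>tilde \<rho> n"
        then have "1 - 16 / real n \<le> measure (data_law \<sigma> n f) (covering lo hi n f)"
          using cover_smooth [OF elim(1)] cover_rough [OF elim(1)] by blast
        with elim(2) show "ereal (1 - \<alpha>) \<le> ereal (measure (data_law \<sigma> n f) (covering lo hi n f))" by simp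
      qed
    qed
    then show "ereal (1 - \<alpha>) \<le> liminf (\<lambda>n. INF f\<in>\<Sigma> s \<union> \<Sigma>tilde \<rho> n.
        ereal (measure (data_law \<sigma> n f) (covering lo hi n f)))" by (rule Liminf_bounded)
  qed
  define L where "L = 2 * Hs + 16 * Hr"
  have small_n: "(\<integral>\<^sup>+ Y. diameter lo hi n Y \<partial>data_law \<sigma> n f) = 0" if "n < 3" for n f
    using that by (simp add: diam width_def)
  have diam_smooth: "(\<integral>\<^sup>+ Y. diameter lo hi n Y \<partial>data_law \<sigma> n f) \<le> ennreal (L * rate n s)"
    if f: "f \<in> \<Sigma> s" for n f
  proof (cases "n < 3")
    case False
    then have n: "3 \<le> n" by simp
    interpret D: prob_space "data_law \<sigma> n f" by (rule prob_space_data_law [OF \<sigma>])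
    have "(\<integral>\<^sup>+ Y. diameter lo hi n Y \<partial>data_law \<sigma> n f) \<le>
        (\<integral>\<^sup>+ Y. ennreal (2 * Hs * rate n s) + ennreal (2 * Hr) * indicator (?bad \<delta>r n r f) Y \<partial>data_law \<sigma> n f)"
    proof (rule nn_integral_mono)
      fix Y assume Y: "Y \<in> space (data_law \<sigma> n f)"
      show "diameter lo hi n Y \<le> ennreal (2 * Hs * rate n s) + ennreal (2 * Hr) * indicator (?bad \<delta>r n r f) Y"
      proof (cases "acc n Y")
        case True
        then have "diameter lo hi n Y = ennreal (2 * Hs * rate n s) + 0"
          using n by (simp add: diam width_def mult.assoc)
        also have "\<dots> \<le> ennreal (2 * Hs * rate n s) + ennreal (2 * Hr) * indicator (?bad \<delta>r n r f) Y"
          by (intro add_left_mono) simp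
        finally show ?thesis .
      next
        case False
        then have "Y \<in> ?bad \<delta>r n r f"
          using Y accepts_if_smooth [OF B, of f s] f by (auto simp: acc_def \<Sigma>_def)
        moreover have "diameter lo hi n Y \<le> ennreal (2 * Hr)"
          using False n H rate_le_1 [OF n rs(1)]
          by (auto simp: diam width_def mult_left_le intro!: ennreal_leI)
        ultimately show ?thesis by (simp add: add_increasing)
      qed
    qed
    also have "\<dots> = ennreal (2 * Hs * rate n s) + ennreal (2 * Hr) * emeasure (data_law \<sigma> n f) (?bad \<delta>r n r f)"
    proof -
      have *: "?bad \<delta>r n r f \<in> sets (data_law \<sigma> n f)" unfolding sets_data_law by (rule bad_meas)
      show ?thesis
        by (subst nn_integral_add)
          (use * D.emeasure_space_1 in \<open>auto simp del: sets_data_law simp: nn_integral_cmult_indicator\<close>)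
    qed
    also have "\<dots> = ennreal (2 * Hs * rate n s + 2 * Hr * D.prob (?bad \<delta>r n r f))"
      using H rate0 by (simp add: D.emeasure_eq_measure ennreal_mult')
    also have "\<dots> \<le> ennreal (L * rate n s)"
    proof (rule ennreal_leI)
      have "D.prob (?bad \<delta>r n r f) \<le> 8 / real n" using r1(4) [OF n] f sub by blast
      also have "\<dots> = 8 * (1 / real n)" by simp
      also have "\<dots> \<le> 8 * rate n s" by (intro mult_left_mono inverse_le_rate n s) auto
      finally have "2 * Hr * D.prob (?bad \<delta>r n r f) \<le> 2 * Hr * (8 * rate n s)"
        using H by (intro mult_left_mono) auto
      then show "2 * Hs * rate n s + 2 * Hr * D.prob (?bad \<delta>r n r f) \<le> L * rate n s"
        by (simp add: L_def distrib_right)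
    qed
    finally show ?thesis .
  qed (simp add: small_n)
  have diam_rough: "(\<integral>\<^sup>+ Y. diameter lo hi n Y \<partial>data_law \<sigma> n f) \<le> ennreal (L * rate n r)" for n f
  proof (cases "n < 3")
    case False
    then have n: "3 \<le> n" by simp
    interpret D: prob_space "data_law \<sigma> n f" by (rule prob_space_data_law [OF \<sigma>])
    have "diameter lo hi n Y \<le> ennreal (L * rate n r)" for Y
    proof -
      have "Hs * rate n s \<le> Hs * rate n r" using H rs n by (intro mult_left_mono rate_antimono) auto
      moreover have "0 \<le> Hr * rate n r" "0 \<le> Hs * rate n r" using H rate0 by auto
      ultimately have "2 * width n Y \<le> L * rate n r"
        using n by (auto simp: width_def L_def distrib_right)
      then show ?thesis unfolding diam by (rule ennreal_leI)
    qed
    then have "(\<integral>\<^sup>+ Y. diameter lo hi n Y \<partial>data_law \<sigma> n f) \<le> (\<integral>\<^sup>+ Y. ennreal (L * rate n r) \<partial>data_law \<sigma> n f)"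
      by (intro nn_integral_mono)
    then show ?thesis using D.emeasure_space_1 by simp
  qed (simp add: small_n)
  have "adaptive \<sigma> lo hi r s (\<Sigma> s) (\<Sigma>tilde \<rho>)"
    unfolding adaptive_def
  proof (intro conjI allI impI exI [of _ L])
    show "diameter lo hi n \<in> borel_measurable (sample_space n)" for n
    proof -
      have "diameter lo hi n = (\<lambda>Y. ennreal (2 * width n Y))" by (rule ext) (rule diam)
      also have "\<dots> \<in> borel_measurable (sample_space n)" by measurable
      finally show ?thesis .
    qed
    show "(SUP f\<in>\<Sigma> s. \<integral>\<^sup>+ Y. diameter lo hi n Y \<partial>data_law \<sigma> n f) \<le> ennreal (L * rate n s)" for n
      by (intro SUP_least diam_smooth)
    show "(SUP f\<in>\<Sigma>tilde \<rho> n. \<integral>\<^sup>+ Y. diameter lo hi n Y \<partial>data_law \<sigma> n f) \<le> ennreal (L * rate n r)" for n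
      by (intro SUP_least diam_rough)
  qed
  moreover have "confidence_band lo hi"
    unfolding confidence_band_def using lo_meas hi_meas width0
    by (auto simp: lo_def hi_def intro: order_trans [of _ 0])
  moreover have "0 < \<rho> n" for n
    using Q rate_pos [of n r] rs by (auto simp: \<rho>_def not_less intro!: mult_pos_pos)
  moreover have "limsup (\<lambda>n. ereal (\<rho> n / rate n r)) < \<infinity>"
  proof -
    have "\<forall>\<^sub>F n in sequentially. ereal (\<rho> n / rate n r) \<le> ereal (Q + 1)"
      using eventually_ge_at_top [of 3]
    proof eventually_elim
      case (elim n)
      then show ?case using rate_pos [of n r] rs by (simp add: \<rho>_def)
    qed
    then have "limsup (\<lambda>n. ereal (\<rho> n / rate n r)) \<le> ereal (Q + 1)" by (rule Limsup_bounded)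
    also have "\<dots> < \<infinity>" by simp
    finally show ?thesis .
  qed
  ultimately show ?thesis using honest by blast
qed

end


section \<open>The critical separation rate\<close>

theorem theorem2:
  fixes r s B \<sigma> :: real and S J :: nat
    and phi :: "nat \<Rightarrow> real \<Rightarrow> real" and psi :: "nat \<Rightarrow> nat \<Rightarrow> real \<Rightarrow> real"
  defines "\<Sigma> \<equiv> holder_ball J phi psi B"
  defines "\<Sigma>tilde \<equiv> \<lambda>\<rho> n. separated (\<Sigma> r) (\<Sigma> s) (\<rho> n)"
  defines "P \<equiv> \<lambda>\<rho> n. \<Sigma> s \<union> \<Sigma>tilde \<rho> n"
  assumes "0 < r" and "r < s" and "0 < B" and "0 < \<sigma>"
    and "CDV_wavelet_basis S J phi psi" and "s < real S"
  shows "(1/2 < r \<longrightarrow> (\<forall>\<alpha> \<rho> lo hi.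
      0 < \<alpha> \<and> \<alpha> < 1/2 \<and> (\<forall>n\<ge>1. 0 < \<rho> n) \<and> confidence_band lo hi \<and>
      asymptotically_honest \<sigma> lo hi \<alpha> (P \<rho>) \<and> adaptive \<sigma> lo hi r s (\<Sigma> s) (\<Sigma>tilde \<rho>) \<longrightarrow>
      liminf (\<lambda>n. ereal (\<rho> n / rate n r)) > 0)) \<and>
    (\<forall>\<alpha>. 0 < \<alpha> \<and> \<alpha> < 1 \<longrightarrow> (\<exists>\<rho>. (\<forall>n\<ge>1. 0 < \<rho> n) \<and>
      limsup (\<lambda>n. ereal (\<rho> n / rate n r)) < \<infinity> \<and>
      (\<exists>lo hi. confidence_band lo hi \<and>
        asymptotically_honest \<sigma> lo hi \<alpha> (P \<rho>) \<and> adaptive \<sigma> lo hi r s (\<Sigma> s) (\<Sigma>tilde \<rho>))))"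
proof -
  have "0 < S" using assms(4,5,9) by (cases S) auto
  then obtain K where "regular_basis J phi psi K"
    using CDV_regular_basis [OF assms(8)] by blast
  then interpret regular_basis J phi psi K .
  have "0 < liminf (\<lambda>n. ereal (\<rho> n / rate n r))"
    if \<alpha>: "\<alpha> < 1 / 2" and honest: "asymptotically_honest \<sigma> lo hi \<alpha> (P \<rho>)"
      and adapt: "adaptive \<sigma> lo hi r s (\<Sigma> s) (\<Sigma>tilde \<rho>)" for \<alpha> \<rho> lo hi
  proof -
    from adapt obtain L where L: "\<And>n. 1 \<le> n \<Longrightarrow> diameter lo hi n \<in> borel_measurable (sample_space n)"
      "\<And>n. 1 \<le> n \<Longrightarrow> (SUP f\<in>\<Sigma> s. \<integral>\<^sup>+ Y. diameter lo hi n Y \<partial>data_law \<sigma> n f) \<le> ennreal (L * rate n s)"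
      unfolding adaptive_def by blast
    have zero: "(\<lambda>_. 0) \<in> \<Sigma> s" unfolding \<Sigma>_def using assms(6) by (intro zero_in_holder_ball) simp
    show ?thesis
    proof (rule separation_rate_necessary [OF assms(4-7) \<alpha>])
      show "asymptotically_honest \<sigma> lo hi \<alpha> (\<lambda>n. holder_ball J phi psi B s \<union>
          separated (holder_ball J phi psi B r) (holder_ball J phi psi B s) (\<rho> n))"
        using honest by (simp add: P_def \<Sigma>tilde_def \<Sigma>_def)
      show "(\<integral>\<^sup>+ Y. diameter lo hi n Y \<partial>data_law \<sigma> n (\<lambda>_. 0)) \<le> ennreal (L * rate n s)" if "1 \<le> n" for n
        by (rule order_trans [OF SUP_upper [OF zero] L(2) [OF that]])
    qed (rule L(1))
  qed
  moreover have "\<exists>\<rho>. (\<forall>n\<ge>1. 0 < \<rho> n) \<and> limsup (\<lambda>n. ereal (\<rho> n / rate n r)) < \<infinity> \<and>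
      (\<exists>lo hi. confidence_band lo hi \<and> asymptotically_honest \<sigma> lo hi \<alpha> (P \<rho>) \<and>
        adaptive \<sigma> lo hi r s (\<Sigma> s) (\<Sigma>tilde \<rho>))" if "0 < \<alpha>" for \<alpha>
    unfolding P_def \<Sigma>tilde_def \<Sigma>_def by (rule adaptive_band_exists [OF assms(4-7) that])
  ultimately show ?thesis by blast
qed

end
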